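(* Let $G$ be a profinite group and let $N$ be a pronilpotent normal closed subgroup of $G$. Suppose that either $G$ is prosupersolvable or $G/N$ is pronilpotent. Then two closed supplements $H$ and $H'$ of $N$ in $G$ are conjugate in $G$ if and only if they are locally conjugate in $G$.
   Context: A profinite group is pronilpotent (resp. prosupersolvable) if it is an inverse limit of finite nilpotent (resp. finite supersolvable) groups. A closed supplement of $N$ in $G$ is a closed subgroup $H$ of $G$ with $NH=G$. Two closed subgroups $H$ and $H'$ of a profinite group $G$ are locally conjugate if for each prime $p$, a Sylow $p$-subgroup of $H$ is conjugate in $G$ to a Sylow $p$-subgroup of $H'$ (Sylow subgroups are in the profinite sense: maximal pro-$p$ subgroups). *)

theory Defs
  imports "HOL-Analysis.Analysis" "HOL-Algebra.Product_Groups" "HOL-Computational_Algebra.Primes"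
begin

section \<open>Classes of finite groups\<close>

primrec lower_central :: "('a, 'b) monoid_scheme \<Rightarrow> nat \<Rightarrow> 'a set" where
  "lower_central G 0 = carrier G"
| "lower_central G (Suc n) =
     generate G (\<Union>x \<in> lower_central G n. \<Union>y \<in> carrier G.
       {x \<otimes>\<^bsub>G\<^esub> y \<otimes>\<^bsub>G\<^esub> inv\<^bsub>G\<^esub> x \<otimes>\<^bsub>G\<^esub> inv\<^bsub>G\<^esub> y})"

definition nilpotent_group :: "('a, 'b) monoid_scheme \<Rightarrow> bool" where
  "nilpotent_group G \<longleftrightarrow> group G \<and> (\<exists>n. lower_central G n = {\<one>\<^bsub>G\<^esub>})"

text \<open>The terms of the series are normal in the whole group, not just in the next term.\<close>

definition supersolvable_group :: "('a, 'b) monoid_scheme \<Rightarrow> bool" where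
  "supersolvable_group G \<longleftrightarrow> group G \<and>
     (\<exists>(n::nat) S. S 0 = {\<one>\<^bsub>G\<^esub>} \<and> S n = carrier G \<and> (\<forall>i\<le>n. S i \<lhd> G) \<and>
        (\<forall>i<n. S i \<subseteq> S (Suc i) \<and> cyclic_group ((G\<lparr>carrier := S (Suc i)\<rparr>) Mod S i)))"

definition finite_p_group :: "nat \<Rightarrow> ('a, 'b) monoid_scheme \<Rightarrow> bool" where
  "finite_p_group p G \<longleftrightarrow> group G \<and> finite (carrier G) \<and> (\<exists>k. order G = p ^ k)"


section \<open>Topological groups\<close>

locale topological_group = group G for G :: "('a, 'b) monoid_scheme" (structure) +
  fixes T :: "'a topology"
  assumes topspace_eq: "topspace T = carrier G"
    and continuous_mult: "continuous_map (prod_topology T T) T (\<lambda>(x, y). x \<otimes> y)"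
    and continuous_inv: "continuous_map T T (\<lambda>x. inv x)"

definition closed_subgroup :: "('a, 'b) monoid_scheme \<Rightarrow> 'a topology \<Rightarrow> 'a set \<Rightarrow> bool" where
  "closed_subgroup G T H \<longleftrightarrow> subgroup H G \<and> closedin T H"

definition coset_topology :: "('a, 'b) monoid_scheme \<Rightarrow> 'a topology \<Rightarrow> 'a set \<Rightarrow> 'a set topology" where
  "coset_topology G T N =
     topology (\<lambda>U. U \<subseteq> carrier (G Mod N) \<and> openin T {x \<in> topspace T. N #>\<^bsub>G\<^esub> x \<in> U})"

lemma openin_coset_topology:
  "openin (coset_topology G T N) U \<longleftrightarrow>
     U \<subseteq> carrier (G Mod N) \<and> openin T {x \<in> topspace T. N #>\<^bsub>G\<^esub> x \<in> U}"
proof -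
  have "istopology (\<lambda>U. U \<subseteq> carrier (G Mod N) \<and> openin T {x \<in> topspace T. N #>\<^bsub>G\<^esub> x \<in> U})"
    unfolding istopology_def
  proof (intro conjI allI impI)
    fix U V
    assume U: "U \<subseteq> carrier (G Mod N) \<and> openin T {x \<in> topspace T. N #>\<^bsub>G\<^esub> x \<in> U}"
      and V: "V \<subseteq> carrier (G Mod N) \<and> openin T {x \<in> topspace T. N #>\<^bsub>G\<^esub> x \<in> V}"
    show "U \<inter> V \<subseteq> carrier (G Mod N)" using U by blast
    have "{x \<in> topspace T. N #>\<^bsub>G\<^esub> x \<in> U \<inter> V} =
        {x \<in> topspace T. N #>\<^bsub>G\<^esub> x \<in> U} \<inter> {x \<in> topspace T. N #>\<^bsub>G\<^esub> x \<in> V}" by blast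
    then show "openin T {x \<in> topspace T. N #>\<^bsub>G\<^esub> x \<in> U \<inter> V}"
      using U V by (simp add: openin_Int)
  next
    fix \<K>
    assume K: "\<forall>K\<in>\<K>. K \<subseteq> carrier (G Mod N) \<and> openin T {x \<in> topspace T. N #>\<^bsub>G\<^esub> x \<in> K}"
    show "\<Union>\<K> \<subseteq> carrier (G Mod N)" using K by blast
    have "{x \<in> topspace T. N #>\<^bsub>G\<^esub> x \<in> \<Union>\<K>} = (\<Union>K\<in>\<K>. {x \<in> topspace T. N #>\<^bsub>G\<^esub> x \<in> K})"
      by blast
    then show "openin T {x \<in> topspace T. N #>\<^bsub>G\<^esub> x \<in> \<Union>\<K>}"
      using K by auto
  qed
  then show ?thesis
    by (simp add: coset_topology_def)
qed

lemma quotient_map_coset_topology: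
  assumes "topspace T = carrier G"
  shows "quotient_map T (coset_topology G T N) (\<lambda>x. N #>\<^bsub>G\<^esub> x)"
proof -
  have img: "(\<lambda>x. N #>\<^bsub>G\<^esub> x) ` topspace T = carrier (G Mod N)"
    using assms by (auto simp: FactGroup_def RCOSETS_def)
  have "{x \<in> topspace T. N #>\<^bsub>G\<^esub> x \<in> carrier (G Mod N)} = topspace T"
    using img by blast
  then have "openin (coset_topology G T N) (carrier (G Mod N))"
    by (simp add: openin_coset_topology)
  then have "topspace (coset_topology G T N) = carrier (G Mod N)"
    by (metis openin_coset_topology openin_subset openin_topspace subset_antisym)
  then show ?thesis
    using img by (auto simp: quotient_map_def openin_coset_topology)
qed


section \<open>Inverse limits of finite groups\<close>

text \<open>An inverse system over a directed poset; for \<open>i \<le> j\<close>, i.e. \<open>(i, j) \<in> r\<close>,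
  the transition map \<open>f i j\<close> goes from \<open>K j\<close> to \<open>K i\<close>. Transition maps need not be surjective.\<close>

locale inverse_system =
  fixes I :: "'i set" and r :: "'i rel"
    and K :: "'i \<Rightarrow> ('k, 'b) monoid_scheme" and f :: "'i \<Rightarrow> 'i \<Rightarrow> 'k \<Rightarrow> 'k"
  assumes nonempty: "I \<noteq> {}"
    and poset: "partial_order_on I r"
    and directed: "\<lbrakk>i \<in> I; j \<in> I\<rbrakk> \<Longrightarrow> \<exists>k\<in>I. (i, k) \<in> r \<and> (j, k) \<in> r"
    and group: "i \<in> I \<Longrightarrow> group (K i)"
    and hom: "(i, j) \<in> r \<Longrightarrow> f i j \<in> hom (K j) (K i)"
    and ident: "\<lbrakk>i \<in> I; x \<in> carrier (K i)\<rbrakk> \<Longrightarrow> f i i x = x"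
    and comp: "\<lbrakk>(i, j) \<in> r; (j, k) \<in> r; x \<in> carrier (K k)\<rbrakk> \<Longrightarrow> f i j (f j k x) = f i k x"

definition inverse_limit ::
  "'i set \<Rightarrow> 'i rel \<Rightarrow> ('i \<Rightarrow> ('k, 'b) monoid_scheme) \<Rightarrow> ('i \<Rightarrow> 'i \<Rightarrow> 'k \<Rightarrow> 'k) \<Rightarrow> ('i \<Rightarrow> 'k) monoid"
  where "inverse_limit I r K f = (product_group I K)
    \<lparr>carrier := {x \<in> carrier (product_group I K). \<forall>(i, j) \<in> r. f i j (x j) = x i}\<rparr>"

text \<open>The groups in the system carry the discrete topology.\<close>

definition inverse_limit_topology ::
  "'i set \<Rightarrow> 'i rel \<Rightarrow> ('i \<Rightarrow> ('k, 'b) monoid_scheme) \<Rightarrow> ('i \<Rightarrow> 'i \<Rightarrow> 'k \<Rightarrow> 'k) \<Rightarrow> ('i \<Rightarrow> 'k) topology"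
  where "inverse_limit_topology I r K f =
    subtopology (product_topology (\<lambda>i. discrete_topology (carrier (K i))) I)
      (carrier (inverse_limit I r K f))"

text \<open>\<open>(G, T)\<close> is an inverse limit of finite groups satisfying \<open>C\<close>, up to isomorphism of
  topological groups. HOL cannot quantify existentially over the types of the indices and of the
  group elements. Taking both to be \<open>'a set\<close> loses no generality when \<open>C\<close> is
  invariant under isomorphism and inherited by subgroups and quotients, as are all the
  classes used below: the system can then be replaced by that of the quotients \<open>G Mod U\<close>,
  indexed by the open normal subgroups \<open>U\<close> of \<open>G\<close>.\<close>

definition pro_group ::
  "('a set monoid \<Rightarrow> bool) \<Rightarrow> ('a, 'b) monoid_scheme \<Rightarrow> 'a topology \<Rightarrow> bool" where
  "pro_group C G T \<longleftrightarrow> topological_group G T \<and>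
     (\<exists>(I :: 'a set set) r (K :: 'a set \<Rightarrow> 'a set monoid) f h.
        inverse_system I r K f \<and>
        (\<forall>i\<in>I. finite (carrier (K i)) \<and> C (K i)) \<and>
        h \<in> iso G (inverse_limit I r K f) \<and>
        homeomorphic_map T (inverse_limit_topology I r K f) h)"

definition profinite :: "('a, 'b) monoid_scheme \<Rightarrow> 'a topology \<Rightarrow> bool" where
  "profinite = pro_group (\<lambda>_. True)"

definition pronilpotent :: "('a, 'b) monoid_scheme \<Rightarrow> 'a topology \<Rightarrow> bool" where
  "pronilpotent = pro_group nilpotent_group"

definition prosupersolvable :: "('a, 'b) monoid_scheme \<Rightarrow> 'a topology \<Rightarrow> bool" where
  "prosupersolvable = pro_group supersolvable_group"

definition pro_p :: "nat \<Rightarrow> ('a, 'b) monoid_scheme \<Rightarrow> 'a topology \<Rightarrow> bool" where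
  "pro_p p = pro_group (finite_p_group p)"


section \<open>Supplements, Sylow subgroups and conjugacy\<close>

definition closed_supplement ::
  "('a, 'b) monoid_scheme \<Rightarrow> 'a topology \<Rightarrow> 'a set \<Rightarrow> 'a set \<Rightarrow> bool" where
  "closed_supplement G T N H \<longleftrightarrow> closed_subgroup G T H \<and> N <#>\<^bsub>G\<^esub> H = carrier G"

definition pro_p_subgroup ::
  "nat \<Rightarrow> ('a, 'b) monoid_scheme \<Rightarrow> 'a topology \<Rightarrow> 'a set \<Rightarrow> bool" where
  "pro_p_subgroup p G T P \<longleftrightarrow>
     closed_subgroup G T P \<and> pro_p p (G\<lparr>carrier := P\<rparr>) (subtopology T P)"

definition sylow_subgroup ::
  "nat \<Rightarrow> ('a, 'b) monoid_scheme \<Rightarrow> 'a topology \<Rightarrow> 'a set \<Rightarrow> bool" where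
  "sylow_subgroup p G T P \<longleftrightarrow> pro_p_subgroup p G T P \<and>
     (\<forall>Q. pro_p_subgroup p G T Q \<and> P \<subseteq> Q \<longrightarrow> Q = P)"

definition conjugate :: "('a, 'b) monoid_scheme \<Rightarrow> 'a set \<Rightarrow> 'a set \<Rightarrow> bool" where
  "conjugate G H H' \<longleftrightarrow>
     (\<exists>g \<in> carrier G. H' = (\<lambda>x. g \<otimes>\<^bsub>G\<^esub> x \<otimes>\<^bsub>G\<^esub> inv\<^bsub>G\<^esub> g) ` H)"

definition locally_conjugate ::
  "('a, 'b) monoid_scheme \<Rightarrow> 'a topology \<Rightarrow> 'a set \<Rightarrow> 'a set \<Rightarrow> bool" where
  "locally_conjugate G T H H' \<longleftrightarrow>
     (\<forall>p::nat. prime p \<longrightarrow>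
        (\<exists>P P'. sylow_subgroup p (G\<lparr>carrier := H\<rparr>) (subtopology T H) P \<and>
                sylow_subgroup p (G\<lparr>carrier := H'\<rparr>) (subtopology T H') P' \<and>
                conjugate G P P'))"

end

theory Submission
  imports Defs "HOL-Algebra.Sylow" "HOL-Algebra.Group_Action" "HOL-Algebra.Multiplicative_Group"
begin

text \<open>
  The theorem is proved for finite groups first and then transported by compactness.

  In a finite quotient of \<open>G\<close>, both alternatives provide a normal nilpotent subgroup \<open>F\<close> with
  nilpotent quotient: \<open>N\<close> itself in one case, the commutator subgroup in the other, because
  commutators act trivially on the cyclic factors of a supersolvable series
  (\<open>supersolvable_commutator_nilpotent\<close>). For a prime \<open>p\<close> let \<open>R\<^sub>p\<close> be the largest normal
  subgroup of order prime to \<open>p\<close>. It contains the Sylow \<open>q\<close>-subgroups of \<open>F\<close> and of \<open>N\<close> for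
  all \<open>q \<noteq> p\<close>, and it follows that \<open>G/R\<^sub>p\<close> has a normal Sylow \<open>p\<close>-subgroup \<open>S/R\<^sub>p\<close>. Local
  conjugacy allows one to assume that \<open>H\<close> and \<open>H'\<close> share a Sylow \<open>p\<close>-subgroup \<open>P\<close>. Then
  \<open>H R\<^sub>p\<close> and \<open>H' R\<^sub>p\<close> meet \<open>S\<close> in the same subgroup \<open>D = P R\<^sub>p\<close>, which is normal in both. In
  the normalizer of \<open>D\<close>, modulo \<open>D\<close>, they are complements of a \<open>p\<close>-group with order prime to
  \<open>p\<close>, and are conjugate by the Schur-Zassenhaus theorem (\<open>conjugate_modulo_prime_to_core\<close>).
  The conjugating element can be chosen in the Sylow \<open>p\<close>-subgroup of \<open>N\<close>, which lies in \<open>R\<^sub>q\<close> for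
  all \<open>q \<noteq> p\<close>. So the product of these elements over all \<open>p\<close> conjugates \<open>H R\<^sub>p\<close> to \<open>H' R\<^sub>p\<close>
  for all \<open>p\<close> simultaneously. As the index of \<open>H\<close> in \<open>H R\<^sub>p\<close> is prime to \<open>p\<close>, intersecting
  over \<open>p\<close> gives the conjugacy of \<open>H\<close> and \<open>H'\<close> (\<open>finite_supplements_conjugate\<close>).

  In the profinite group, closed subgroups are conjugate as soon as their images in all quotients
  \<open>G/U\<close> by a base of open normal subgroups are, since the conjugating elements modulo \<open>U\<close> form a
  directed family of nonempty closed sets (\<open>conjugate_if_all_images_conjugate\<close>). Local conjugacy
  passes to \<open>G/U\<close> because the Sylow subgroups of \<open>H\<close> are exactly the closed subgroups whose images
  are Sylow subgroups of all the images of \<open>H\<close> (\<open>sylow_subgroup_iff\<close>). The same criterion shows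
  that conjugation preserves Sylow subgroups; together with their existence this gives the
  direction from conjugacy to local conjugacy.
\<close>

section \<open>Conjugation, products and orders of subgroups\<close>

definition conj_set :: "('a, 'b) monoid_scheme \<Rightarrow> 'a \<Rightarrow> 'a set \<Rightarrow> 'a set" where
  "conj_set G g X = (\<lambda>x. g \<otimes>\<^bsub>G\<^esub> x \<otimes>\<^bsub>G\<^esub> inv\<^bsub>G\<^esub> g) ` X"

lemma conjugate_iff: "conjugate G H H' \<longleftrightarrow> (\<exists>g \<in> carrier G. H' = conj_set G g H)"
  by (simp add: conjugate_def conj_set_def)

lemma conj_set_mono: "X \<subseteq> Y \<Longrightarrow> conj_set G g X \<subseteq> conj_set G g Y"
  by (auto simp: conj_set_def)

lemma set_mult_iff: "x \<in> A <#>\<^bsub>G\<^esub> B \<longleftrightarrow> (\<exists>a\<in>A. \<exists>b\<in>B. x = a \<otimes>\<^bsub>G\<^esub> b)"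
  by (auto simp: set_mult_def)

text \<open>Orders are compared prime by prime: \<open>valn q A = valn q B\<close> for finite subgroups \<open>A \<subseteq> B\<close> says that
  the index of \<open>A\<close> in \<open>B\<close> is prime to \<open>q\<close>. In this form index arguments become additions and
  comparisons of natural numbers, with no quotient of cardinalities.\<close>

abbreviation valn :: "nat \<Rightarrow> 'a set \<Rightarrow> nat" where
  "valn q X \<equiv> multiplicity q (card X)"

context group
begin

text \<open>Together with associativity and the rule for the inverse of a product, these cancellation laws
  form a complete rewriting system for words in group elements; this is how the identities
  between such words are checked below.\<close>

lemma inv_cancel_l [simp]:
  assumes "x \<in> carrier G" "y \<in> carrier G"
  shows "inv x \<otimes> (x \<otimes> y) = y" "x \<otimes> (inv x \<otimes> y) = y"
  using assms by (simp_all flip: m_assoc)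

lemmas word_simps = m_assoc inv_mult_group

lemma mem_conj_set:
  assumes "X \<subseteq> carrier G" "g \<in> carrier G"
  shows "x \<in> conj_set G g X \<longleftrightarrow> x \<in> carrier G \<and> inv g \<otimes> x \<otimes> g \<in> X"
proof
  assume "x \<in> conj_set G g X"
  then obtain y where "y \<in> X" "x = g \<otimes> y \<otimes> inv g" by (auto simp: conj_set_def)
  then show "x \<in> carrier G \<and> inv g \<otimes> x \<otimes> g \<in> X"
    using assms by (auto simp: word_simps subset_iff)
next
  assume "x \<in> carrier G \<and> inv g \<otimes> x \<otimes> g \<in> X"
  moreover have "x = g \<otimes> (inv g \<otimes> x \<otimes> g) \<otimes> inv g" if "x \<in> carrier G"
    using that assms by (simp add: word_simps)
  ultimately show "x \<in> conj_set G g X" by (auto simp: conj_set_def)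
qed

lemma conj_set_carrier: "X \<subseteq> carrier G \<Longrightarrow> g \<in> carrier G \<Longrightarrow> conj_set G g X \<subseteq> carrier G"
  by (auto simp: mem_conj_set)

lemma conj_set_one [simp]: "X \<subseteq> carrier G \<Longrightarrow> conj_set G \<one> X = X"
  by (force simp: mem_conj_set subset_iff)

lemma conj_set_conj_set:
  assumes "X \<subseteq> carrier G" "g \<in> carrier G" "h \<in> carrier G"
  shows "conj_set G g (conj_set G h X) = conj_set G (g \<otimes> h) X"
  using assms by (auto simp: mem_conj_set conj_set_carrier word_simps)

lemma conj_set_inv:
  assumes "X \<subseteq> carrier G" "g \<in> carrier G" "Y = conj_set G g X"
  shows "conj_set G (inv g) Y = X"
  using assms by (simp add: conj_set_conj_set)

lemma conj_set_subgroup: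
  assumes "subgroup H G" "g \<in> carrier G"
  shows "subgroup (conj_set G g H) G"
proof -
  interpret H: subgroup H G by fact
  show ?thesis
  proof (rule subgroupI)
    show "conj_set G g H \<subseteq> carrier G" using assms by (simp add: conj_set_carrier H.subset)
    show "conj_set G g H \<noteq> {}" using H.one_closed unfolding conj_set_def by blast
    fix a assume "a \<in> conj_set G g H"
    then obtain x where x: "x \<in> H" "a = g \<otimes> x \<otimes> inv g" by (auto simp: conj_set_def)
    then have "inv a = g \<otimes> inv x \<otimes> inv g" using assms by (simp add: word_simps)
    then show "inv a \<in> conj_set G g H" using x by (auto simp: conj_set_def)
    fix b assume "b \<in> conj_set G g H"
    then obtain y where y: "y \<in> H" "b = g \<otimes> y \<otimes> inv g" by (auto simp: conj_set_def)
    then have "a \<otimes> b = g \<otimes> (x \<otimes> y) \<otimes> inv g" using assms x by (simp add: word_simps)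
    then show "a \<otimes> b \<in> conj_set G g H" using x y by (auto simp: conj_set_def)
  qed
qed

lemma card_conj_set:
  assumes "X \<subseteq> carrier G" "g \<in> carrier G"
  shows "card (conj_set G g X) = card X"
  unfolding conj_set_def
  by (rule card_image) (use assms in \<open>auto simp: inj_on_def subset_iff\<close>)

lemma conj_set_self:
  assumes "subgroup H G" "g \<in> H"
  shows "conj_set G g H = H"
proof -
  interpret H: subgroup H G by fact
  have "x \<in> H" if "x \<in> carrier G" "inv g \<otimes> x \<otimes> g \<in> H" for x
  proof -
    have "g \<otimes> (inv g \<otimes> x \<otimes> g) \<otimes> inv g \<in> H" using that assms by blast
    then show ?thesis using that assms H.mem_carrier[of g] by (simp add: word_simps)
  qed
  moreover have "inv g \<otimes> x \<otimes> g \<in> H" if "x \<in> H" for x using that assms by blast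
  ultimately show ?thesis
    using mem_conj_set[OF H.subset H.mem_carrier[OF assms(2)]] H.subset by blast
qed

lemma conj_set_normal:
  assumes "N \<lhd> G" "g \<in> carrier G"
  shows "conj_set G g N = N"
proof -
  interpret N: normal N G by fact
  have "x \<in> N" if "x \<in> carrier G" "inv g \<otimes> x \<otimes> g \<in> N" for x
    using N.inv_op_closed2[OF assms(2) that(2)] that assms(2) by (simp add: word_simps)
  then show ?thesis
    using mem_conj_set[OF N.subset assms(2)] N.inv_op_closed1[OF assms(2)] N.subset by blast
qed

lemma normalI_conj_set:
  assumes "subgroup N G" "\<And>g. g \<in> carrier G \<Longrightarrow> conj_set G g N \<subseteq> N"
  shows "N \<lhd> G"
  using assms by (intro normal_invI) (auto simp: conj_set_def)

lemma conj_set_set_mult: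
  assumes "A \<subseteq> carrier G" "B \<subseteq> carrier G" "g \<in> carrier G"
  shows "conj_set G g (A <#> B) = conj_set G g A <#> conj_set G g B"
proof -
  have *: "g \<otimes> (a \<otimes> b) \<otimes> inv g = (g \<otimes> a \<otimes> inv g) \<otimes> (g \<otimes> b \<otimes> inv g)" if "a \<in> A" "b \<in> B" for a b
    using that assms by (simp add: word_simps subset_iff)
  show ?thesis
  proof (intro equalityI subsetI)
    fix x assume "x \<in> conj_set G g (A <#> B)"
    then obtain a b where ab: "a \<in> A" "b \<in> B" "x = g \<otimes> (a \<otimes> b) \<otimes> inv g"
      by (auto simp: conj_set_def set_mult_iff)
    then show "x \<in> conj_set G g A <#> conj_set G g B"
      unfolding conj_set_def set_mult_iff using *[OF ab(1,2)] by blast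
  next
    fix x assume "x \<in> conj_set G g A <#> conj_set G g B"
    then obtain a b where ab: "a \<in> A" "b \<in> B" "x = (g \<otimes> a \<otimes> inv g) \<otimes> (g \<otimes> b \<otimes> inv g)"
      by (auto simp: conj_set_def set_mult_iff)
    then show "x \<in> conj_set G g (A <#> B)"
      unfolding conj_set_def ab(3) *[OF ab(1,2), symmetric]
      by (intro imageI) (auto simp: set_mult_iff)
  qed
qed

lemma set_mult_subset_subgroup:
  assumes "subgroup X G" "A \<subseteq> X" "B \<subseteq> X"
  shows "A <#> B \<subseteq> X"
  using assms by (auto simp: set_mult_iff subgroup.m_closed subset_iff)

lemma subset_set_mult:
  assumes "subgroup A G" "subgroup B G"
  shows "A \<subseteq> A <#> B" "B \<subseteq> A <#> B"
proof -
  have "a \<otimes> \<one> \<in> A <#> B" if "a \<in> A" for a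
    using that subgroup.one_closed[OF assms(2)] by (auto simp only: set_mult_iff)
  then show "A \<subseteq> A <#> B"
    using subgroup.mem_carrier[OF assms(1)] by fastforce
  have "\<one> \<otimes> b \<in> A <#> B" if "b \<in> B" for b
    using that subgroup.one_closed[OF assms(1)] by (auto simp only: set_mult_iff)
  then show "B \<subseteq> A <#> B"
    using subgroup.mem_carrier[OF assms(2)] by fastforce
qed

lemma set_mult_commute_normal:
  assumes "subgroup H G" "N \<lhd> G"
  shows "N <#> H = H <#> N"
  using commut_normal[OF assms] by simp

lemma subgroup_set_mult_normal:
  assumes "subgroup H G" "N \<lhd> G"
  shows "subgroup (H <#> N) G"
proof -
  interpret N: normal N G by fact
  interpret H: subgroup H G by fact
  show ?thesis
  proof (rule subgroupI)
    show "H <#> N \<subseteq> carrier G" by (intro setmult_subset_G H.subset N.subset)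
    show "H <#> N \<noteq> {}" using subset_set_mult(1)[OF H.subgroup_axioms N.subgroup_axioms] H.one_closed by blast
    fix x assume "x \<in> H <#> N"
    then obtain h n where x: "h \<in> H" "n \<in> N" "x = h \<otimes> n" by (auto simp: set_mult_iff)
    then have "inv x = inv h \<otimes> (h \<otimes> inv n \<otimes> inv h)" by (simp add: word_simps)
    then show "inv x \<in> H <#> N"
      using x N.inv_op_closed2[of h "inv n"] by (auto simp: set_mult_iff)
    fix y assume "y \<in> H <#> N"
    then obtain k m where y: "k \<in> H" "m \<in> N" "y = k \<otimes> m" by (auto simp: set_mult_iff)
    then have "x \<otimes> y = (h \<otimes> k) \<otimes> ((inv k \<otimes> n \<otimes> k) \<otimes> m)" using x by (simp add: word_simps)
    then show "x \<otimes> y \<in> H <#> N"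
      using x y N.inv_op_closed1[of k n] unfolding set_mult_iff
      by (meson H.m_closed H.mem_carrier N.m_closed)
  qed
qed

lemma normal_set_mult:
  assumes "M \<lhd> G" "N \<lhd> G"
  shows "M <#> N \<lhd> G"
proof (rule normalI_conj_set)
  show "subgroup (M <#> N) G"
    using assms by (simp add: subgroup_set_mult_normal normal_imp_subgroup)
  show "conj_set G g (M <#> N) \<subseteq> M <#> N" if "g \<in> carrier G" for g
    using that conj_set_set_mult[OF normal_imp_subgroup[THEN subgroup.subset, OF assms(1)]
      normal_imp_subgroup[THEN subgroup.subset, OF assms(2)] that]
    by (simp add: conj_set_normal assms)
qed

lemma finite_subgroup_card_pos: "subgroup A G \<Longrightarrow> finite A \<Longrightarrow> card A \<noteq> 0"
  using subgroup.one_closed[of A G] by auto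

lemma card_subgroup_dvd:
  assumes "subgroup A G" "subgroup B G" "A \<subseteq> B"
  shows "card A dvd card B"
proof -
  interpret B: group "G\<lparr>carrier := B\<rparr>" using assms subgroup_imp_group by blast
  have "subgroup A (G\<lparr>carrier := B\<rparr>)" using assms subgroup_incl by blast
  from B.lagrange[OF this] show ?thesis by (simp add: order_def) (metis dvd_triv_right)
qed

lemma valn_mono:
  assumes "subgroup A G" "subgroup B G" "A \<subseteq> B" "finite B"
  shows "valn q A \<le> valn q B"
proof (rule dvd_imp_multiplicity_le)
  show "card A dvd card B" using assms card_subgroup_dvd by blast
  show "card B \<noteq> 0" using assms finite_subgroup_card_pos by blast
qed

text \<open>The usual way to prove two subgroups equal below: for every prime one exhibits a common
  subgroup whose index is prime to it.\<close>

lemma subgroup_eq_by_valn: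
  assumes "subgroup A G" "subgroup B G" "A \<subseteq> B" "finite B"
    and "\<And>q. prime q \<Longrightarrow> valn q B \<le> valn q A"
  shows "A = B"
proof (rule card_subset_eq)
  have pos: "card A \<noteq> 0" "card B \<noteq> 0"
    using finite_subgroup_card_pos[OF assms(1) finite_subset[OF assms(3,4)]]
      finite_subgroup_card_pos[OF assms(2,4)] by auto
  show "card A = card B"
    using pos assms(5) valn_mono[OF assms(1-4)]
    by (rule_tac multiplicity_eq_nat) (simp_all add: order.antisym)
qed (rule assms)+

end

lemma (in group_hom) card_image_mult_kernel:
  assumes "subgroup A G"
  shows "card A = card (h ` A) * card (A \<inter> kernel G H h)"
proof -
  interpret A: group_hom "G\<lparr>carrier := A\<rparr>" "H\<lparr>carrier := h ` A\<rparr>" h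
  proof -
    interpret g: group "G\<lparr>carrier := A\<rparr>" using assms by (simp add: G.subgroup_imp_group)
    interpret h: group "H\<lparr>carrier := h ` A\<rparr>" using assms by (simp add: H.subgroup_imp_group subgroup_img_is_subgroup)
    show "group_hom (G\<lparr>carrier := A\<rparr>) (H\<lparr>carrier := h ` A\<rparr>) h"
      using assms g.group_axioms h.group_axioms
      by (simp add: group_hom_def group_hom_axioms_def hom_def Pi_def subgroup.mem_carrier)
  qed
  have ker: "kernel (G\<lparr>carrier := A\<rparr>) (H\<lparr>carrier := h ` A\<rparr>) h = A \<inter> kernel G H h"
    using assms by (auto simp: kernel_def subgroup.mem_carrier)
  let ?K = "kernel (G\<lparr>carrier := A\<rparr>) (H\<lparr>carrier := h ` A\<rparr>) h"
  have "(\<lambda>X. the_elem (h ` X)) \<in> iso ((G\<lparr>carrier := A\<rparr>) Mod ?K) (H\<lparr>carrier := h ` A\<rparr>)"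
    by (rule A.FactGroup_iso_set) simp
  then have "card (carrier ((G\<lparr>carrier := A\<rparr>) Mod ?K)) = card (h ` A)"
    by (auto simp: iso_def dest: bij_betw_same_card)
  moreover have "card (rcosets\<^bsub>G\<lparr>carrier := A\<rparr>\<^esub> ?K) * card ?K = order (G\<lparr>carrier := A\<rparr>)"
    by (rule A.G.lagrange) (rule A.subgroup_kernel)
  ultimately show ?thesis by (simp add: FactGroup_def order_def ker)
qed

lemma (in normal) rcos_group_hom: "group_hom G (G Mod H) ((#>) H)"
  using factorgroup_is_group r_coset_hom_Mod by (simp add: group_hom_def group_hom_axioms_def is_group)

lemma (in normal) kernel_rcos: "kernel G (G Mod H) ((#>) H) = H"
proof -
  have "x \<in> carrier G \<and> H #> x = H \<longleftrightarrow> x \<in> H" for x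
    using coset_join1[of H x] coset_join2[of x H] subset subgroup_axioms by blast
  then show ?thesis by (simp add: kernel_def)
qed

context group
begin

lemma card_set_mult_normal:
  assumes "subgroup A G" "N \<lhd> G"
  shows "finite (A <#> N) \<Longrightarrow> card (A <#> N) * card (A \<inter> N) = card A * card N"
proof -
  interpret N: normal N G by fact
  interpret q: group_hom G "G Mod N" "(#>) N" by (rule N.rcos_group_hom)
  note k = q.card_image_mult_kernel[unfolded N.kernel_rcos]
  have sub: "subgroup (A <#> N) G" using assms by (simp add: subgroup_set_mult_normal)
  have "(#>) N ` (A <#> N) = (#>) N ` A"
  proof
    show "(#>) N ` (A <#> N) \<subseteq> (#>) N ` A"
    proof clarify
      fix x assume "x \<in> A <#> N"
      then have "x \<in> N <#> A" by (simp add: set_mult_commute_normal[OF assms])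
      then obtain n a where "n \<in> N" "a \<in> A" "x = n \<otimes> a"
        unfolding set_mult_iff by blast
      moreover have "a \<in> carrier G" using subgroup.mem_carrier[OF assms(1) \<open>a \<in> A\<close>] .
      ultimately have "N #> x = N #> a"
        using coset_mult_assoc[OF N.subset N.mem_carrier] N.rcos_const[OF is_group] by simp
      then show "N #> x \<in> (#>) N ` A" using \<open>a \<in> A\<close> by blast
    qed
    show "(#>) N ` A \<subseteq> (#>) N ` (A <#> N)"
      using subset_set_mult(1)[OF assms(1) N.subgroup_axioms] by (rule image_mono)
  qed
  moreover have "(A <#> N) \<inter> N = N" using subset_set_mult(2)[OF assms(1) N.subgroup_axioms] by blast
  ultimately show ?thesis using k[OF sub] k[OF assms(1)] by simp
qed

lemma finite_set_mult: "finite A \<Longrightarrow> finite B \<Longrightarrow> finite (A <#> B)"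
  unfolding set_mult_def by auto

lemma valn_set_mult:
  assumes "subgroup A G" "N \<lhd> G" "finite A" "finite N" "prime q"
  shows "valn q (A <#> N) + valn q (A \<inter> N) = valn q A + valn q N"
proof -
  have N: "subgroup N G" using assms normal_imp_subgroup by blast
  have AN: "subgroup (A <#> N) G" using assms(1,2) by (rule subgroup_set_mult_normal)
  have i: "subgroup (A \<inter> N) G" using assms(1) N by (rule subgroups_Inter_pair)
  have "card (A <#> N) \<noteq> 0"
    using finite_subgroup_card_pos[OF AN finite_set_mult[OF assms(3,4)]] .
  moreover have "card (A \<inter> N) \<noteq> 0"
    using finite_subgroup_card_pos[OF i] assms(3) by blast
  moreover have "card A \<noteq> 0" "card N \<noteq> 0"
    using finite_subgroup_card_pos[OF assms(1,3)] finite_subgroup_card_pos[OF N assms(4)] .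
  moreover have "prime_elem q" using assms(5) by (rule prime_imp_prime_elem)
  ultimately show ?thesis
    using card_set_mult_normal[OF assms(1,2) finite_set_mult[OF assms(3,4)]]
    by (simp flip: prime_elem_multiplicity_mult_distrib)
qed

end

section \<open>Conjugacy of complements\<close>

context group
begin

lemma normal_subset: "N \<lhd> G \<Longrightarrow> N \<subseteq> carrier G"
  by (rule subgroup.subset[OF normal_imp_subgroup])

lemma coprime_Int_trivial:
  assumes "subgroup A G" "subgroup B G" "coprime (card A) (card B)"
  shows "A \<inter> B = {\<one>}"
proof -
  have i: "subgroup (A \<inter> B) G" using assms(1,2) by (rule subgroups_Inter_pair)
  have "card (A \<inter> B) dvd card A" "card (A \<inter> B) dvd card B"
    using card_subgroup_dvd[OF i] assms(1,2) by simp_all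
  then have "card (A \<inter> B) = 1" using assms(3) by (metis coprime_common_divisor_nat)
  then obtain x where "A \<inter> B = {x}" by (auto simp: card_1_singleton_iff)
  then show ?thesis using subgroup.one_closed[OF i] by simp
qed

text \<open>The conjugacy part of the Schur-Zassenhaus theorem for an abelian kernel \<open>A\<close>. For \<open>h \<in> H\<close> let
  \<open>c h\<close> be the element of \<open>A\<close> with \<open>c h \<otimes> h \<in> K\<close>. This is a cocycle, and multiplying the cocycle
  identity over all values of its second argument shows that the \<open>card H\<close>-th power of \<open>c\<close> is the
  coboundary of the product \<open>b\<close> of all values of \<open>c\<close>. Since \<open>card H\<close> is invertible modulo
  \<open>card A\<close>, a suitable power \<open>b'\<close> of \<open>b\<close> has \<open>c\<close> itself as its coboundary, and conjugation by \<open>b'\<close>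
  takes \<open>h\<close> to \<open>c h \<otimes> h\<close>.\<close>

lemma complements_conjugate_abelian:
  assumes A: "A \<lhd> G" "finite A" and comm: "\<And>x y. x \<in> A \<Longrightarrow> y \<in> A \<Longrightarrow> x \<otimes> y = y \<otimes> x"
    and H: "subgroup H G" "finite H" "coprime (card H) (card A)"
    and K: "subgroup K G" "finite K" "coprime (card K) (card A)"
    and HK: "H <#> A = K <#> A"
  shows "\<exists>a\<in>A. conj_set G a H = K"
proof -
  interpret A: normal A G by fact
  interpret H: subgroup H G by fact
  interpret K: subgroup K G by fact
  let ?A = "G\<lparr>carrier := A\<rparr>"
  interpret AA: comm_group ?A
  proof (rule group.group_comm_groupI)
    show "group ?A" using A.subgroup_axioms by (rule subgroup_imp_group)
  qed (use comm in simp)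
  have HA: "H \<inter> A = {\<one>}" and KA: "K \<inter> A = {\<one>}"
    using coprime_Int_trivial[OF H(1) A.subgroup_axioms H(3)]
      coprime_Int_trivial[OF K(1) A.subgroup_axioms K(3)] .
  have ex: "\<exists>a\<in>A. a \<otimes> h \<in> K" if "h \<in> H" for h
  proof -
    have "h \<in> K <#> A" using subset_set_mult(1)[OF H(1) A.subgroup_axioms] that HK by blast
    then have "h \<in> A <#> K" by (simp add: set_mult_commute_normal[OF K(1) A(1)])
    then obtain a k where ak: "a \<in> A" "k \<in> K" "h = a \<otimes> k" by (auto simp: set_mult_iff)
    then have "inv a \<otimes> h = k" by simp
    then show ?thesis using ak by (intro bexI[of _ "inv a"]) auto
  qed
  then obtain c where c: "\<And>h. h \<in> H \<Longrightarrow> c h \<in> A" "\<And>h. h \<in> H \<Longrightarrow> c h \<otimes> h \<in> K"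
    by metis
  have uniq: "a = b" if "a \<in> A" "b \<in> A" "h \<in> H" "a \<otimes> h \<in> K" "b \<otimes> h \<in> K" for a b h
  proof -
    have "(a \<otimes> h) \<otimes> inv (b \<otimes> h) \<in> K" using that(4,5) by blast
    moreover have "(a \<otimes> h) \<otimes> inv (b \<otimes> h) = a \<otimes> inv b" using that by (simp add: word_simps)
    moreover have "a \<otimes> inv b \<in> A" using that by blast
    ultimately have "a \<otimes> inv b = \<one>" using KA by auto
    then show ?thesis using that by (metis A.mem_carrier inv_closed inv_equality inv_inv)
  qed
  have cocycle: "c (h \<otimes> k) = c h \<otimes> (h \<otimes> c k \<otimes> inv h)" if "h \<in> H" "k \<in> H" for h k
  proof (rule uniq)
    show "h \<otimes> k \<in> H" using that by blast
    show "c (h \<otimes> k) \<otimes> (h \<otimes> k) \<in> K" "c (h \<otimes> k) \<in> A" using c that by blast+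
    show "c h \<otimes> (h \<otimes> c k \<otimes> inv h) \<in> A"
      using A.inv_op_closed2[of h "c k"] c that H.mem_carrier by blast
    have "(c h \<otimes> h) \<otimes> (c k \<otimes> k) \<in> K" using c that by blast
    then show "c h \<otimes> (h \<otimes> c k \<otimes> inv h) \<otimes> (h \<otimes> k) \<in> K"
      using c(1) that by (simp add: word_simps)
  qed
  define b where "b = finprod ?A c H"
  have cPi: "c \<in> H \<rightarrow> A" using c(1) by blast
  have bA: "b \<in> A" unfolding b_def using AA.finprod_closed[of c H] cPi by simp
  have "card A \<noteq> 0" using A.subgroup_axioms A(2) by (rule finite_subgroup_card_pos)
  have "card H \<noteq> 0" using H(1,2) by (rule finite_subgroup_card_pos)
  then obtain d x y where d: "d dvd card H" "d dvd card A" "card H * x = card A * y + d"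
    using bezout_add_strong_nat by blast
  \<comment> \<open>So \<open>x\<close> inverts \<open>card H\<close> modulo \<open>card A\<close>.\<close>
  then have xy: "card H * x = card A * y + 1" using H(3) by (metis coprime_common_divisor_nat)
  define b' where "b' = b [^]\<^bsub>?A\<^esub> x"
  have b'A: "b' \<in> A" unfolding b'_def using AA.nat_pow_closed[of b] bA by simp
  have key: "b' = c h \<otimes> (h \<otimes> b' \<otimes> inv h)" if h: "h \<in> H" for h
  proof -
    let ?f = "\<lambda>a. h \<otimes> a \<otimes> inv h"
    have fA: "?f a \<in> A" if "a \<in> A" for a using A.inv_op_closed2[of h a] that h H.mem_carrier by blast
    interpret f: group_hom ?A ?A ?f
      by unfold_locales (use fA h in \<open>auto simp: hom_def word_simps\<close>)
    have ffin: "?f (finprod ?A u X) = finprod ?A (\<lambda>k. ?f (u k)) X" if "finite X" "u \<in> X \<rightarrow> A" for u X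
      using that
    proof (induct X rule: finite_induct)
      case empty
      show ?case using h by simp
    next
      case (insert z X)
      have e1: "finprod ?A u (insert z X) = u z \<otimes> finprod ?A u X"
        using AA.finprod_insert[OF insert(1,2), of u] insert(4) by auto
      have e2: "finprod ?A (\<lambda>k. ?f (u k)) (insert z X) = ?f (u z) \<otimes> finprod ?A (\<lambda>k. ?f (u k)) X"
        using AA.finprod_insert[OF insert(1,2), of "\<lambda>k. ?f (u k)"] insert(4) fA by auto
      have mem: "u z \<in> A" "finprod ?A u X \<in> A"
        using insert(4) AA.finprod_closed[of u X] by auto
      have "?f (u z \<otimes> finprod ?A u X) = ?f (u z) \<otimes> ?f (finprod ?A u X)"
        using f.hom_mult[of "u z" "finprod ?A u X"] mem by simp
      then show ?case using e1 e2 insert(3,4) by auto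
    qed
    have img: "(\<lambda>k. h \<otimes> k) ` H = H"
    proof
      show "(\<lambda>k. h \<otimes> k) ` H \<subseteq> H" using h by blast
      show "H \<subseteq> (\<lambda>k. h \<otimes> k) ` H"
      proof
        fix k assume "k \<in> H"
        then have "k = h \<otimes> (inv h \<otimes> k)" "inv h \<otimes> k \<in> H" using h by auto
        then show "k \<in> (\<lambda>k. h \<otimes> k) ` H" by blast
      qed
    qed
    have inj: "inj_on (\<lambda>k. h \<otimes> k) H" using h by (auto simp: inj_on_def)
    have "b = finprod ?A c ((\<lambda>k. h \<otimes> k) ` H)" by (simp add: b_def img)
    also have "\<dots> = finprod ?A (\<lambda>k. c (h \<otimes> k)) H"
      by (rule AA.finprod_reindex) (use cPi img inj in auto)
    also have "\<dots> = finprod ?A (\<lambda>k. c h \<otimes> ?f (c k)) H"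
    proof (rule AA.finprod_cong')
      show "(\<lambda>k. c h \<otimes> ?f (c k)) \<in> H \<rightarrow> carrier ?A" using c(1) fA h by auto
    qed (use cocycle h in auto)
    also have "\<dots> = finprod ?A (\<lambda>k. c h) H \<otimes> finprod ?A (\<lambda>k. ?f (c k)) H"
      using AA.finprod_multf[of "\<lambda>k. c h" H "\<lambda>k. ?f (c k)"] c(1) fA h by (simp add: Pi_def)
    also have "finprod ?A (\<lambda>k. c h) H = c h [^]\<^bsub>?A\<^esub> card H"
      using AA.finprod_const[of "c h" H] c(1) h by simp
    also have "finprod ?A (\<lambda>k. ?f (c k)) H = ?f b"
      unfolding b_def using ffin[OF H(2) cPi] by simp
    finally have b: "b = c h [^]\<^bsub>?A\<^esub> card H \<otimes> ?f b" .
    let ?d = "c h"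
    have dA: "?d \<in> A" using c(1) h .
    have "b' = (?d [^]\<^bsub>?A\<^esub> card H \<otimes> ?f b) [^]\<^bsub>?A\<^esub> x" unfolding b'_def using b by simp
    also have "\<dots> = (?d [^]\<^bsub>?A\<^esub> card H) [^]\<^bsub>?A\<^esub> x \<otimes> (?f b) [^]\<^bsub>?A\<^esub> x"
      using AA.nat_pow_distrib[of "?d [^]\<^bsub>?A\<^esub> card H" "?f b" x] AA.nat_pow_closed[of ?d "card H"] dA fA[OF bA]
      by simp
    also have "(?d [^]\<^bsub>?A\<^esub> card H) [^]\<^bsub>?A\<^esub> x = ?d [^]\<^bsub>?A\<^esub> (card A * y + 1)"
      using AA.nat_pow_pow[of ?d "card H" x] dA xy by simp
    also have "\<dots> = ?d"
    proof -
      have "?d [^]\<^bsub>?A\<^esub> (card A) = \<one>"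
        using AA.pow_order_eq_1[of ?d] dA by (simp add: order_def)
      then have "?d [^]\<^bsub>?A\<^esub> (card A * y) = \<one>"
        using AA.nat_pow_pow[of ?d "card A" y] AA.nat_pow_one[of y] dA by simp
      then show ?thesis using AA.nat_pow_mult[of ?d "card A * y" 1] dA by simp
    qed
    also have "(?f b) [^]\<^bsub>?A\<^esub> x = ?f b'"
      unfolding b'_def using f.hom_nat_pow[of b x] bA by simp
    finally show ?thesis .
  qed
  have "conj_set G b' H \<subseteq> K"
  proof
    fix z assume "z \<in> conj_set G b' H"
    then obtain h where h: "h \<in> H" "z = b' \<otimes> h \<otimes> inv b'" by (auto simp: conj_set_def)
    have "z = (c h \<otimes> (h \<otimes> b' \<otimes> inv h)) \<otimes> h \<otimes> inv b'" using h key[OF h(1)] by simp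
    also have "\<dots> = c h \<otimes> h" using c(1) h(1) b'A by (simp add: word_simps)
    finally show "z \<in> K" using c(2) h(1) by simp
  qed
  moreover have "card (conj_set G b' H) = card K"
  proof -
    have "card (H <#> A) * card {\<one>} = card H * card A"
      using card_set_mult_normal[OF H(1) A(1) finite_set_mult[OF H(2) A(2)]] HA by simp
    moreover have "card (K <#> A) * card {\<one>} = card K * card A"
      using card_set_mult_normal[OF K(1) A(1) finite_set_mult[OF K(2) A(2)]] KA by simp
    ultimately have "card H = card K" using HK \<open>card A \<noteq> 0\<close> by simp
    then show ?thesis using card_conj_set[OF H.subset, of b'] b'A by simp
  qed
  ultimately have "conj_set G b' H = K" using K(2) by (intro card_subset_eq)
  then show ?thesis using b'A by blast
qed

end

lemma (in group_hom) image_conj_set: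
  assumes "X \<subseteq> carrier G" "g \<in> carrier G"
  shows "h ` conj_set G g X = conj_set H (h g) (h ` X)"
proof -
  have "h (g \<otimes>\<^bsub>G\<^esub> x \<otimes>\<^bsub>G\<^esub> inv\<^bsub>G\<^esub> g) = h g \<otimes>\<^bsub>H\<^esub> h x \<otimes>\<^bsub>H\<^esub> inv\<^bsub>H\<^esub> h g" if "x \<in> X" for x
    using that assms by (auto simp: subset_iff)
  then show ?thesis by (auto simp: conj_set_def image_image intro!: image_cong)
qed

lemma set_mult_eq_if_image_rcos_eq:
  assumes "(\<lambda>x. N #>\<^bsub>G\<^esub> x) ` X = (\<lambda>x. N #>\<^bsub>G\<^esub> x) ` Y"
  shows "N <#>\<^bsub>G\<^esub> X = N <#>\<^bsub>G\<^esub> Y"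
proof -
  have "N <#>\<^bsub>G\<^esub> Z = \<Union>((\<lambda>x. N #>\<^bsub>G\<^esub> x) ` Z)" for Z by (auto simp: set_mult_def r_coset_def)
  then show ?thesis using assms by simp
qed

lemma (in normal) image_rcos_normal:
  assumes "A \<lhd> G"
  shows "(#>) H ` A \<lhd> G Mod H"
  by (rule normal.surj_hom_normal_subgroup[OF assms rcos_group_hom]) (simp add: carrier_FactGroup)

lemma (in normal) image_rcos_set_mult:
  assumes "A \<subseteq> carrier G" "B \<subseteq> carrier G"
  shows "(#>) H ` (A <#> B) = ((#>) H ` A) <#>\<^bsub>G Mod H\<^esub> ((#>) H ` B)"
  by (rule set_mult_hom[OF r_coset_hom_Mod assms])

context group
begin

lemma card_image_rcos_dvd:
  assumes "N \<lhd> G" "subgroup A G"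
  shows "card ((#>) N ` A) dvd card A"
proof -
  interpret N: normal N G by fact
  interpret q: group_hom G "G Mod N" "(#>) N" by (rule N.rcos_group_hom)
  show ?thesis using q.card_image_mult_kernel[OF assms(2)] by simp
qed

text \<open>Induction along the derived series of the kernel: conjugacy modulo the derived subgroup is the
  abelian case in the quotient, and reduces the kernel to its derived subgroup.\<close>

lemma complements_conjugate:
  assumes "A \<lhd> G" "finite A" "(derived G ^^ n) A = {\<one>}"
    and "subgroup H G" "finite H" "coprime (card H) (card A)"
    and "subgroup K G" "finite K" "coprime (card K) (card A)"
    and "H <#> A = K <#> A"
  shows "\<exists>a\<in>A. conj_set G a H = K"
  using assms
proof (induction n arbitrary: A H)
  case 0
  have "subgroup H G" "subgroup K G" "A = {\<one>}" using 0 by simp_all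
  then have "H <#> A = H" "K <#> A = K"
    using subgroup.mem_carrier by (force simp: set_mult_def)+
  then show ?case using 0 \<open>A = {\<one>}\<close> subgroup.subset[OF \<open>subgroup H G\<close>] by simp
next
  case (Suc n)
  interpret A: normal A G by (rule Suc.prems)
  define B where "B = derived G A"
  have BG: "B \<lhd> G" unfolding B_def using Suc.prems(1) by (rule derived_is_normal)
  interpret B: normal B G by (rule BG)
  interpret q: group_hom G "G Mod B" "(#>) B" by (rule B.rcos_group_hom)
  have BA: "B \<subseteq> A" unfolding B_def by (rule derived_incl[OF _ A.subgroup_axioms]) simp
  have H: "subgroup H G" and K: "subgroup K G" by (rule Suc.prems)+
  have card_dvd: "card ((#>) B ` X) dvd card X" if "subgroup X G" for X
    using card_image_rcos_dvd[OF BG that] .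
  have cop: "coprime (card ((#>) B ` X)) (card ((#>) B ` A))" if "subgroup X G" "coprime (card X) (card A)" for X
    using that card_dvd[OF that(1)] card_dvd[OF A.subgroup_axioms] by (meson coprime_divisors)
  have "\<exists>a\<in>(#>) B ` A. conj_set (G Mod B) a ((#>) B ` H) = (#>) B ` K"
  proof (rule q.H.complements_conjugate_abelian)
    show "(#>) B ` A \<lhd> G Mod B" by (rule B.image_rcos_normal[OF Suc.prems(1)])
    show "finite ((#>) B ` A)" "finite ((#>) B ` H)" "finite ((#>) B ` K)" using Suc.prems by simp_all
    show "subgroup ((#>) B ` H) (G Mod B)" "subgroup ((#>) B ` K) (G Mod B)"
      using q.subgroup_img_is_subgroup H K by blast+
    show "coprime (card ((#>) B ` H)) (card ((#>) B ` A))" "coprime (card ((#>) B ` K)) (card ((#>) B ` A))"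
      using cop H K Suc.prems by blast+
    show "(#>) B ` H <#>\<^bsub>G Mod B\<^esub> (#>) B ` A = (#>) B ` K <#>\<^bsub>G Mod B\<^esub> (#>) B ` A"
      using B.image_rcos_set_mult[OF subgroup.subset[OF H] A.subset]
        B.image_rcos_set_mult[OF subgroup.subset[OF K] A.subset] Suc.prems(10) by simp
    fix x y assume "x \<in> (#>) B ` A" "y \<in> (#>) B ` A"
    then obtain a b where ab: "a \<in> A" "b \<in> A" "x = B #> a" "y = B #> b" by blast
    have "a \<otimes> b \<otimes> inv a \<otimes> inv b \<in> B"
      unfolding B_def derived_def by (rule generate.incl) (use ab in blast)
    then have "B #> (a \<otimes> b \<otimes> inv a \<otimes> inv b) = B" by (rule B.rcos_const[OF is_group])
    then have "(B #> (a \<otimes> b \<otimes> inv a \<otimes> inv b)) #> (b \<otimes> a) = B #> (b \<otimes> a)" by simp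
    moreover have "(B #> (a \<otimes> b \<otimes> inv a \<otimes> inv b)) #> (b \<otimes> a) = B #> (a \<otimes> b)"
    proof -
      have "a \<otimes> b \<otimes> inv a \<otimes> inv b \<otimes> (b \<otimes> a) = a \<otimes> b" using ab by (simp add: word_simps)
      then show ?thesis
        using coset_mult_assoc[OF B.subset, of "a \<otimes> b \<otimes> inv a \<otimes> inv b" "b \<otimes> a"] ab by simp
    qed
    ultimately have "B #> (a \<otimes> b) = B #> (b \<otimes> a)" by simp
    then show "x \<otimes>\<^bsub>G Mod B\<^esub> y = y \<otimes>\<^bsub>G Mod B\<^esub> x"
      unfolding ab(3,4) mult_FactGroup B.rcos_sum[OF A.mem_carrier[OF ab(1)] A.mem_carrier[OF ab(2)]]
        B.rcos_sum[OF A.mem_carrier[OF ab(2)] A.mem_carrier[OF ab(1)]] .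
  qed
  then obtain a where a: "a \<in> A" "conj_set (G Mod B) (B #> a) ((#>) B ` H) = (#>) B ` K" by blast
  have aG: "a \<in> carrier G" using a(1) by (rule A.mem_carrier)
  define H1 where "H1 = conj_set G a H"
  have "(#>) B ` H1 = (#>) B ` K"
    unfolding H1_def using q.image_conj_set[OF subgroup.subset[OF H] aG] a(2) by simp
  then have BH: "B <#> H1 = B <#> K" by (rule set_mult_eq_if_image_rcos_eq)
  have H1: "subgroup H1 G" unfolding H1_def by (rule conj_set_subgroup[OF H aG])
  have dvdB: "card B dvd card A" using B.subgroup_axioms A.subgroup_axioms BA by (rule card_subgroup_dvd)
  have "\<exists>b\<in>B. conj_set G b H1 = K"
  proof (rule Suc.IH[OF BG])
    show "finite B" using BA Suc.prems finite_subset by blast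
    show "(derived G ^^ n) B = {\<one>}" using Suc.prems(3) by (simp add: B_def funpow_swap1)
    show "subgroup H1 G" "subgroup K G" by fact+
    show "finite H1" "finite K" using Suc.prems by (simp_all add: H1_def conj_set_def)
    have "card H1 = card H" unfolding H1_def by (rule card_conj_set[OF subgroup.subset[OF H] aG])
    then show "coprime (card H1) (card B)" using dvdB Suc.prems(6) by (metis coprime_divisors dvd_refl)
    show "coprime (card K) (card B)" using dvdB Suc.prems(9) by (metis coprime_divisors dvd_refl)
    show "H1 <#> B = K <#> B" using BH set_mult_commute_normal[OF H1 BG] set_mult_commute_normal[OF K BG] by simp
  qed
  then obtain b where b: "b \<in> B" "conj_set G b H1 = K" by blast
  have "conj_set G (b \<otimes> a) H = K"
    using b aG conj_set_conj_set[OF subgroup.subset[OF H] B.mem_carrier[OF b(1)] aG] by (simp add: H1_def)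
  moreover have "b \<otimes> a \<in> A" using a(1) b(1) BA by blast
  ultimately show ?case by blast
qed

end

lemma coprime_prime_power_if_multiplicity_0:
  fixes p n :: nat
  assumes "prime p" "multiplicity p n = 0" "n \<noteq> 0"
  shows "coprime n (p ^ k)"
proof -
  have "\<not> p dvd n"
    using assms prime_multiplicity_gt_zero_iff[of p n] by auto
  then have "coprime p n" using assms(1) by (simp add: prime_imp_coprime)
  then show ?thesis by (simp add: coprime_commute)
qed

context group
begin

lemma set_mult_absorb:
  assumes "subgroup X G" "subgroup D G" "D \<subseteq> X"
  shows "D <#> X = X" "X <#> D = X"
  using set_mult_subset_subgroup[OF assms(1) assms(3) subset_refl] subset_set_mult(2)[OF assms(2,1)]
    set_mult_subset_subgroup[OF assms(1) subset_refl assms(3)] subset_set_mult(1)[OF assms(1,2)]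
  by auto

text \<open>\<open>complements_conjugate\<close> in the quotient by \<open>D\<close>.\<close>

lemma complements_conjugate_mod:
  assumes fin: "finite (carrier G)" and D: "D \<lhd> G"
    and A: "A \<lhd> G" "(derived G ^^ n) A = {\<one>}"
    and H: "subgroup H G" "D \<subseteq> H" "coprime (card ((#>) D ` H)) (card A)"
    and K: "subgroup K G" "D \<subseteq> K" "coprime (card ((#>) D ` K)) (card A)"
    and HK: "H <#> A = K <#> A"
  shows "\<exists>a\<in>A. conj_set G a H = K"
proof -
  interpret A: normal A G by fact
  interpret D: normal D G by fact
  interpret q: group_hom G "G Mod D" "(#>) D" by (rule D.rcos_group_hom)
  have finX: "finite X" if "subgroup X G" for X
    using subgroup.subset[OF that] fin by (rule finite_subset)
  have dvdA: "card ((#>) D ` A) dvd card A" using card_image_rcos_dvd[OF D A.subgroup_axioms] .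
  have "\<exists>a\<in>(#>) D ` A. conj_set (G Mod D) a ((#>) D ` H) = (#>) D ` K"
  proof (rule q.H.complements_conjugate)
    show "(#>) D ` A \<lhd> G Mod D" by (rule D.image_rcos_normal[OF A(1)])
    show "finite ((#>) D ` A)" "finite ((#>) D ` H)" "finite ((#>) D ` K)"
      using finX[OF A.subgroup_axioms] finX[OF H(1)] finX[OF K(1)] by simp_all
    show "(derived (G Mod D) ^^ n) ((#>) D ` A) = {\<one>\<^bsub>G Mod D\<^esub>}"
      using q.exp_of_derived_img[OF A.subset, of n] A(2) D.subset by simp
    show "subgroup ((#>) D ` H) (G Mod D)" "subgroup ((#>) D ` K) (G Mod D)"
      using q.subgroup_img_is_subgroup[OF H(1)] q.subgroup_img_is_subgroup[OF K(1)] .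
    show "coprime (card ((#>) D ` H)) (card ((#>) D ` A))" "coprime (card ((#>) D ` K)) (card ((#>) D ` A))"
      using coprime_divisors[OF dvd_refl dvdA H(3)] coprime_divisors[OF dvd_refl dvdA K(3)] .
    show "(#>) D ` H <#>\<^bsub>G Mod D\<^esub> (#>) D ` A = (#>) D ` K <#>\<^bsub>G Mod D\<^esub> (#>) D ` A"
      using D.image_rcos_set_mult[OF subgroup.subset[OF H(1)] A.subset]
        D.image_rcos_set_mult[OF subgroup.subset[OF K(1)] A.subset] HK by simp
  qed
  then obtain a where a: "a \<in> A" "conj_set (G Mod D) (D #> a) ((#>) D ` H) = (#>) D ` K" by blast
  have aG: "a \<in> carrier G" using a(1) by (rule A.mem_carrier)
  have sub: "subgroup (conj_set G a H) G" by (rule conj_set_subgroup[OF H(1) aG])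
  have DH: "D \<subseteq> conj_set G a H" using conj_set_mono[OF H(2), of G a] conj_set_normal[OF D aG] by simp
  have "(#>) D ` conj_set G a H = (#>) D ` K"
    using q.image_conj_set[OF subgroup.subset[OF H(1)] aG] a(2) by simp
  then have "D <#> conj_set G a H = D <#> K" by (rule set_mult_eq_if_image_rcos_eq)
  then have "conj_set G a H = K"
    using set_mult_absorb(1)[OF sub D.subgroup_axioms DH] set_mult_absorb(1)[OF K(1) D.subgroup_axioms K(2)] by simp
  then show ?thesis using a(1) by blast
qed

lemma subgroup_normalizer:
  assumes "D \<subseteq> carrier G"
  shows "subgroup {g \<in> carrier G. conj_set G g D = D} G"
proof (rule subgroupI)
  show "{g \<in> carrier G. conj_set G g D = D} \<noteq> {}" using conj_set_one[OF assms] by blast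
next
  fix g assume "g \<in> {g \<in> carrier G. conj_set G g D = D}"
  then show "inv g \<in> {g \<in> carrier G. conj_set G g D = D}"
    using conj_set_inv[OF assms, of g D] by simp
next
  fix g h assume "g \<in> {g \<in> carrier G. conj_set G g D = D}" "h \<in> {g \<in> carrier G. conj_set G g D = D}"
  then show "g \<otimes> h \<in> {g \<in> carrier G. conj_set G g D = D}"
    using conj_set_conj_set[OF assms, of g h] by simp
qed auto

lemma conj_set_consistent:
  assumes "subgroup M G" "g \<in> M"
  shows "conj_set (G\<lparr>carrier := M\<rparr>) g X = conj_set G g X"
  using m_inv_consistent[OF assms] by (simp add: conj_set_def)

lemma conj_set_Int:
  assumes "A \<subseteq> carrier G" "B \<subseteq> carrier G" "g \<in> carrier G"
  shows "conj_set G g (A \<inter> B) = conj_set G g A \<inter> conj_set G g B"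
  using assms mem_conj_set[OF _ assms(3)] by (intro equalityI subsetI) (simp_all add: le_infI1)

lemma exp_of_derived_consistent:
  assumes "X \<subseteq> M" "subgroup M G"
  shows "(derived (G\<lparr>carrier := M\<rparr>) ^^ n) X = (derived G ^^ n) X \<and> (derived G ^^ n) X \<subseteq> M"
proof (induction n)
  case 0
  show ?case using assms by simp
next
  case (Suc n)
  then show ?case using derived_consistent[OF _ assms(2)] derived_incl[OF _ assms(2)] by simp
qed

text \<open>Both \<open>H\<close> and \<open>K\<close> normalize their common intersection \<open>D\<close> with \<open>S\<close>. Modulo \<open>D\<close>, inside the
  normalizer of \<open>D\<close>, they have order prime to \<open>p\<close> and supplement the same \<open>p\<close>-group, so they
  are conjugate by Schur-Zassenhaus.\<close>

lemma conjugate_if_same_trace: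
  assumes fin: "finite (carrier G)" and A: "A \<lhd> G" "(derived G ^^ n) A = {\<one>}"
    and S: "S \<lhd> G" "A \<subseteq> S"
    and H: "subgroup H G" "H \<inter> S = D" "H <#> A = carrier G" "valn p H = valn p D"
    and K: "subgroup K G" "K \<inter> S = D" "K <#> A = carrier G" "valn p K = valn p D"
    and p: "prime p" "card A = p ^ k"
  shows "\<exists>a\<in>A. conj_set G a H = K"
proof -
  interpret A: normal A G by fact
  interpret S: normal S G by fact
  have D: "subgroup D G" using subgroups_Inter_pair[OF H(1) S.subgroup_axioms] H(2) by simp
  note DG = subgroup.subset[OF D]
  define M where "M = {g \<in> carrier G. conj_set G g D = D}"
  have M: "subgroup M G" unfolding M_def by (rule subgroup_normalizer[OF DG])
  let ?M = "G\<lparr>carrier := M\<rparr>"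
  interpret M: group ?M by (rule subgroup_imp_group[OF M])
  define A1 where "A1 = A \<inter> M"
  have A1: "A1 \<lhd> ?M" unfolding A1_def by (rule normal_Int_subgroup[OF M A(1)])
  have inM: "X \<subseteq> M" if "subgroup X G" "X \<inter> S = D" for X
  proof
    fix x assume x: "x \<in> X"
    have xG: "x \<in> carrier G" using that(1) x by (rule subgroup.mem_carrier)
    have "conj_set G x D = D"
      using conj_set_Int[OF subgroup.subset[OF that(1)] S.subset xG] conj_set_self[OF that(1) x]
        conj_set_normal[OF S(1) xG] that(2) by simp
    then show "x \<in> M" using xG by (simp add: M_def)
  qed
  have fact: "X <#> A1 = M" if X: "subgroup X G" "X \<subseteq> M" "X <#> A = carrier G" for X
  proof
    show "X <#> A1 \<subseteq> M" by (rule set_mult_subset_subgroup[OF M X(2)]) (simp add: A1_def)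
    show "M \<subseteq> X <#> A1"
    proof
      fix m assume m: "m \<in> M"
      then have "m \<in> X <#> A" using X(3) by (simp add: M_def)
      then obtain x a where xa: "x \<in> X" "a \<in> A" "m = x \<otimes> a" by (auto simp: set_mult_iff)
      have "x \<in> carrier G" using X(1) xa(1) by (rule subgroup.mem_carrier)
      then have "a = inv x \<otimes> m" using xa by simp
      moreover have "inv x \<otimes> m \<in> M"
        using subgroup.m_closed[OF M subgroup.m_inv_closed[OF M] m] xa(1) X(2) by blast
      ultimately have "a \<in> A1" using xa by (simp add: A1_def)
      then show "m \<in> X <#> A1" using xa by (auto simp: set_mult_iff)
    qed
  qed
  have DM: "D \<lhd> ?M"
  proof (rule M.normalI_conj_set)
    show "subgroup D ?M" using subgroup_incl[OF D M] inM[OF H(1,2)] H(2) by blast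
    show "conj_set ?M g D \<subseteq> D" if "g \<in> carrier ?M" for g
      using that conj_set_consistent[OF M, of g D] by (simp add: M_def)
  qed
  have "card A1 dvd p ^ k"
    using card_subgroup_dvd[OF subgroups_Inter_pair[OF A.subgroup_axioms M] A.subgroup_axioms] p(2)
    by (simp add: A1_def)
  have cop: "coprime (card ((#>\<^bsub>?M\<^esub>) D ` X)) (card A1)"
    if X: "subgroup X G" "X \<inter> S = D" "valn p X = valn p D" for X
  proof -
    interpret D: normal D ?M by (rule DM)
    interpret q: group_hom ?M "?M Mod D" "(#>\<^bsub>?M\<^esub>) D" by (rule D.rcos_group_hom)
    have "subgroup X ?M" using subgroup_incl[OF X(1) M inM[OF X(1,2)]] .
    then have "card X = card ((#>\<^bsub>?M\<^esub>) D ` X) * card (X \<inter> D)"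
      using q.card_image_mult_kernel D.kernel_rcos by simp
    moreover have "X \<inter> D = D" using X(2) by blast
    ultimately have c: "card X = card ((#>\<^bsub>?M\<^esub>) D ` X) * card D" by simp
    have "card X \<noteq> 0"
      using X(1) finite_subset[OF subgroup.subset[OF X(1)] fin] by (rule finite_subgroup_card_pos)
    then have "valn p X = multiplicity p (card ((#>\<^bsub>?M\<^esub>) D ` X)) + valn p D"
      unfolding c by (intro prime_elem_multiplicity_mult_distrib) (use p(1) in auto)
    then have "multiplicity p (card ((#>\<^bsub>?M\<^esub>) D ` X)) = 0" using X(3) by simp
    moreover have "card ((#>\<^bsub>?M\<^esub>) D ` X) \<noteq> 0" using c \<open>card X \<noteq> 0\<close> by (metis mult_0)
    ultimately have "coprime (card ((#>\<^bsub>?M\<^esub>) D ` X)) (p ^ k)"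
      using p(1) by (intro coprime_prime_power_if_multiplicity_0)
    then show ?thesis using coprime_divisors[OF dvd_refl \<open>card A1 dvd p ^ k\<close>] by blast
  qed
  have "\<exists>a\<in>A1. conj_set ?M a H = K"
  proof (rule M.complements_conjugate_mod[OF _ DM A1])
    show "finite (carrier ?M)" using finite_subset[OF subgroup.subset[OF M] fin] by simp
    have A1M: "A1 \<subseteq> M" and A1A: "A1 \<subseteq> A" by (simp_all add: A1_def)
    have "(derived G ^^ n) A1 \<subseteq> {\<one>}" using mono_exp_of_derived[OF A1A, of n] A(2) by simp
    moreover have "\<one> \<in> (derived G ^^ n) A1"
      using subgroup.one_closed[OF exp_of_derived_is_subgroup[OF subgroups_Inter_pair[OF A.subgroup_axioms M]]]
      by (simp add: A1_def)
    ultimately show "(derived ?M ^^ n) A1 = {\<one>\<^bsub>?M\<^esub>}"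
      using exp_of_derived_consistent[OF A1M M, of n] by auto
    show "subgroup H ?M" "subgroup K ?M"
      using subgroup_incl[OF H(1) M inM[OF H(1,2)]] subgroup_incl[OF K(1) M inM[OF K(1,2)]] .
    show "D \<subseteq> H" "D \<subseteq> K" using H(2) K(2) by blast+
    show "coprime (card ((#>\<^bsub>?M\<^esub>) D ` H)) (card A1)" by (rule cop[OF H(1,2,4)])
    show "coprime (card ((#>\<^bsub>?M\<^esub>) D ` K)) (card A1)" by (rule cop[OF K(1,2,4)])
    show "H <#>\<^bsub>?M\<^esub> A1 = K <#>\<^bsub>?M\<^esub> A1"
      using fact[OF H(1) inM[OF H(1,2)] H(3)] fact[OF K(1) inM[OF K(1,2)] K(3)] by simp
  qed
  then obtain a where "a \<in> A1" "conj_set ?M a H = K" by blast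
  then show ?thesis using conj_set_consistent[OF M, of a H] by (auto simp: A1_def)
qed

end

section \<open>Sylow subgroups and the lower central series\<close>

text \<open>The Sylow condition for a subgroup \<open>X\<close>, stated in the ambient group so that \<open>X\<close>, \<open>P\<close> and
  their conjugates live in one group.\<close>

definition finite_sylow :: "nat \<Rightarrow> ('a, 'b) monoid_scheme \<Rightarrow> 'a set \<Rightarrow> 'a set \<Rightarrow> bool" where
  "finite_sylow p G X P \<longleftrightarrow>
     subgroup P G \<and> P \<subseteq> X \<and> (\<exists>k. card P = p ^ k) \<and> valn p P = valn p X"

lemma valn_prime_power:
  assumes "prime p" "prime q" "q \<noteq> p" "card P = p ^ k"
  shows "valn q P = 0"
  using assms by (simp add: multiplicity_distinct_prime_power)

context group
begin

lemma finite_sylow_exists: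
  assumes "finite (carrier G)" "subgroup X G" "prime p"
  shows "\<exists>P. finite_sylow p G X P"
proof -
  interpret X: group "G\<lparr>carrier := X\<rparr>" using assms(2) by (rule subgroup_imp_group)
  have finX: "finite X" using subgroup.subset[OF assms(2)] assms(1) by (rule finite_subset)
  obtain m where m: "card X = p ^ valn p X * m"
    using multiplicity_dvd[of p "card X"] by (metis dvdE)
  obtain P where P: "subgroup P (G\<lparr>carrier := X\<rparr>)" "card P = p ^ valn p X"
    using sylow_thm[OF assms(3) X.is_group, of "valn p X" m] m finX by (auto simp: order_def)
  have "P \<subseteq> X" using subgroup.subset[OF P(1)] by simp
  moreover have "subgroup P G" using incl_subgroup[OF assms(2) P(1)] .
  moreover have "valn p P = valn p X" using P(2) assms(3) by (simp add: prime_gt_1_nat multiplicity_prime_power)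
  ultimately show ?thesis using P(2) by (auto simp: finite_sylow_def)
qed

text \<open>The product of \<open>T'\<close> with the normal subgroup \<open>T\<close> has the same order as \<open>T\<close>, as one sees one prime
  at a time. Applied to a conjugate \<open>T'\<close> of \<open>T\<close>, it makes a subgroup normal in \<open>G\<close>
  that is only known to be normal in \<open>W\<close>.\<close>

lemma subset_normal_by_valn:
  assumes fin: "finite W" and W: "subgroup W G" and T: "T \<lhd> (G\<lparr>carrier := W\<rparr>)"
    and T': "subgroup T' G" "T' \<subseteq> W"
    and val: "\<And>q. prime q \<Longrightarrow> valn q T' \<le> valn q (T' \<inter> T) \<or> valn q W \<le> valn q T"
  shows "T' \<subseteq> T"
proof -
  let ?W = "G\<lparr>carrier := W\<rparr>"
  interpret W: group ?W using W by (rule subgroup_imp_group)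
  have TW: "subgroup T ?W" using T by (rule normal_imp_subgroup)
  have T'W: "subgroup T' ?W" using subgroup_incl[OF T'(1) W T'(2)] .
  have TsW: "T \<subseteq> W" using subgroup.subset[OF TW] by simp
  have P: "subgroup (T' <#>\<^bsub>?W\<^esub> T) ?W" by (rule W.subgroup_set_mult_normal[OF T'W T])
  have sub: "T \<subseteq> T' <#>\<^bsub>?W\<^esub> T" "T' \<subseteq> T' <#>\<^bsub>?W\<^esub> T" using W.subset_set_mult[OF T'W TW] by blast+
  have PW: "T' <#>\<^bsub>?W\<^esub> T \<subseteq> W" using subgroup.subset[OF P] by simp
  have finT: "finite T" "finite T'" using TsW T'(2) fin finite_subset by blast+
  have "T = T' <#>\<^bsub>?W\<^esub> T"
  proof (rule W.subgroup_eq_by_valn[OF TW P sub(1)])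
    show "finite (T' <#>\<^bsub>?W\<^esub> T)" using PW fin by (rule finite_subset)
    fix q :: nat assume q: "prime q"
    consider "valn q T' \<le> valn q (T' \<inter> T)" | "valn q W \<le> valn q T" using val[OF q] by blast
    then show "valn q (T' <#>\<^bsub>?W\<^esub> T) \<le> valn q T"
    proof cases
      case 1
      then show ?thesis using W.valn_set_mult[OF T'W T finT(2,1) q] by simp
    next
      case 2
      have "valn q (T' <#>\<^bsub>?W\<^esub> T) \<le> valn q W"
        using W.valn_mono[OF P W.subgroup_self, of q] PW fin by simp
      then show ?thesis using 2 by simp
    qed
  qed
  then show ?thesis using sub(2) by simp
qed

lemma lower_central_normal: "lower_central G n \<lhd> G"
proof (induction n)
  case 0
  show ?case by (simp add: normal_self)
next
  case (Suc n)
  interpret L: normal "lower_central G n" G by (rule Suc)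
  let ?C = "\<Union>x \<in> lower_central G n. \<Union>y \<in> carrier G. {x \<otimes> y \<otimes> inv x \<otimes> inv y}"
  have "generate G ?C \<lhd> G"
  proof (rule normal_generateI)
    show "?C \<subseteq> carrier G" using L.mem_carrier by auto
    fix c g assume "c \<in> ?C" and g: "g \<in> carrier G"
    then obtain x y where xy: "x \<in> lower_central G n" "y \<in> carrier G" "c = x \<otimes> y \<otimes> inv x \<otimes> inv y" by blast
    have xG: "x \<in> carrier G" using xy(1) by (rule L.mem_carrier)
    let ?x = "g \<otimes> x \<otimes> inv g" let ?y = "g \<otimes> y \<otimes> inv g"
    have "g \<otimes> c \<otimes> inv g = ?x \<otimes> ?y \<otimes> inv ?x \<otimes> inv ?y"
      using xG xy(2,3) g by (simp add: word_simps)
    moreover have "?x \<in> lower_central G n" "?y \<in> carrier G"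
      using L.inv_op_closed2[OF g xy(1)] g xy(2) by simp_all
    ultimately show "g \<otimes> c \<otimes> inv g \<in> ?C" by blast
  qed
  then show ?case by simp
qed

lemma commutator_in_lower_central:
  assumes "x \<in> lower_central G n" "y \<in> carrier G"
  shows "x \<otimes> y \<otimes> inv x \<otimes> inv y \<in> lower_central G (Suc n)"
  using assms by (auto intro!: generate.incl)

lemma lower_central_subset: "lower_central G n \<subseteq> carrier G"
  by (rule normal_subset[OF lower_central_normal])

text \<open>Going down the lower central series \<open>L\<^sub>i\<close>: the group \<open>P L\<^sub>i\<^sub>+\<^sub>1\<close> is normal in \<open>P L\<^sub>i\<close>, because
  \<open>P\<close> and \<open>L\<^sub>i\<close> commute modulo \<open>L\<^sub>i\<^sub>+\<^sub>1\<close>, and it is a Sylow \<open>p\<close>-subgroup of it modulo \<open>L\<^sub>i\<^sub>+\<^sub>1\<close>.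
  Being the only one, it inherits normality in \<open>G\<close> from \<open>P L\<^sub>i\<close>. Stated for all \<open>i\<close>, the lemma
  yields the normality of the Sylow subgroups both of a nilpotent group and of a nilpotent
  quotient.\<close>

lemma sylow_times_lower_central_normal:
  assumes fin: "finite (carrier G)" and p: "prime p" and P: "finite_sylow p G (carrier G) P"
  shows "P <#> lower_central G i \<lhd> G"
proof (induction i)
  have Ps: "subgroup P G" using P by (simp add: finite_sylow_def)
  case 0
  have "P <#> carrier G = carrier G"
    using set_mult_absorb(1)[OF subgroup_self Ps subgroup.subset[OF Ps]] .
  then show ?case by (simp add: normal_self)
next
  case (Suc i)
  have Ps: "subgroup P G" and Pval: "valn p P = valn p (carrier G)" using P by (simp_all add: finite_sylow_def)
  define L where "L = lower_central G i"
  define L' where "L' = lower_central G (Suc i)"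
  define W where "W = P <#> L"
  define T where "T = P <#> L'"
  have L: "L \<lhd> G" and L': "L' \<lhd> G" unfolding L_def L'_def by (rule lower_central_normal)+
  have Ls: "subgroup L G" and L's: "subgroup L' G" using L L' normal_imp_subgroup by blast+
  have W: "W \<lhd> G" using Suc by (simp add: W_def L_def)
  have Ws: "subgroup W G" using W by (rule normal_imp_subgroup)
  have T: "subgroup T G" unfolding T_def by (rule subgroup_set_mult_normal[OF Ps L'])
  have sub: "P \<subseteq> T" "L' \<subseteq> T" "P \<subseteq> W" "L \<subseteq> W"
    unfolding T_def W_def using subset_set_mult[OF Ps L's] subset_set_mult[OF Ps Ls] by blast+
  have comm: "x \<otimes> y \<otimes> inv x \<otimes> inv y \<in> L'" if "x \<in> L" "y \<in> carrier G" for x y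
    using commutator_in_lower_central[of x i y] that by (simp only: L_def L'_def)
  have "L' \<subseteq> L"
  proof -
    have "(\<Union>x \<in> L. \<Union>y \<in> carrier G. {x \<otimes> y \<otimes> inv x \<otimes> inv y}) \<subseteq> L"
    proof clarify
      fix x y assume x: "x \<in> L" and y: "y \<in> carrier G"
      have xG: "x \<in> carrier G" using Ls x by (rule subgroup.mem_carrier)
      have "x \<otimes> (y \<otimes> inv x \<otimes> inv y) \<in> L"
        using normal.inv_op_closed2[OF L y subgroup.m_inv_closed[OF Ls x]] subgroup.m_closed[OF Ls x] by blast
      then show "x \<otimes> y \<otimes> inv x \<otimes> inv y \<in> L" using xG y by (simp add: word_simps)
    qed
    then have "generate G (\<Union>x \<in> L. \<Union>y \<in> carrier G. {x \<otimes> y \<otimes> inv x \<otimes> inv y}) \<subseteq> L"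
      by (rule generate_subgroup_incl[OF _ Ls])
    then show ?thesis by (simp add: L_def L'_def)
  qed
  then have "T \<subseteq> W"
    unfolding T_def using set_mult_subset_subgroup[OF Ws sub(3)] sub(4) by blast
  have finX: "finite X" if "subgroup X G" for X
    using subgroup.subset[OF that] fin by (rule finite_subset)
  let ?W = "G\<lparr>carrier := W\<rparr>"
  interpret WG: group ?W using Ws by (rule subgroup_imp_group)
  have TW: "T \<lhd> ?W"
  proof (rule WG.normalI_conj_set)
    show "subgroup T ?W" using subgroup_incl[OF T Ws \<open>T \<subseteq> W\<close>] .
    fix w assume "w \<in> carrier ?W"
    then have wW: "w \<in> W" by simp
    then obtain x l where xl: "x \<in> P" "l \<in> L" "w = x \<otimes> l" by (auto simp: W_def set_mult_iff)
    have xG: "x \<in> carrier G" and lG: "l \<in> carrier G"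
      using subgroup.mem_carrier[OF Ps xl(1)] subgroup.mem_carrier[OF Ls xl(2)] .
    have "conj_set G l P \<subseteq> T"
    proof
      fix z assume "z \<in> conj_set G l P"
      then obtain y where y: "y \<in> P" "z = l \<otimes> y \<otimes> inv l" by (auto simp: conj_set_def)
      have yG: "y \<in> carrier G" using Ps y(1) by (rule subgroup.mem_carrier)
      have "z = (l \<otimes> y \<otimes> inv l \<otimes> inv y) \<otimes> y" using y(2) yG lG by (simp add: word_simps)
      moreover have "l \<otimes> y \<otimes> inv l \<otimes> inv y \<in> T" using comm[OF xl(2) yG] sub(2) by blast
      moreover have "y \<in> T" using y(1) sub(1) by blast
      ultimately show "z \<in> T" using subgroup.m_closed[OF T] by simp
    qed
    moreover have "conj_set G l L' \<subseteq> T" using conj_set_normal[OF L' lG] sub(2) by simp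
    ultimately have "conj_set G l T \<subseteq> T"
      unfolding T_def conj_set_set_mult[OF subgroup.subset[OF Ps] subgroup.subset[OF L's] lG]
      by (rule set_mult_subset_subgroup[OF T[unfolded T_def]])
    then have "conj_set G x (conj_set G l T) \<subseteq> conj_set G x T" by (rule conj_set_mono)
    also have "\<dots> = T" using conj_set_self[OF T] xl(1) sub(1) by blast
    finally show "conj_set ?W w T \<subseteq> T"
      using conj_set_conj_set[OF subgroup.subset[OF T] xG lG] xl(3) conj_set_consistent[OF Ws wW, of T] by simp
  qed
  have "T \<lhd> G"
  proof (rule normalI_conj_set[OF T])
    fix g assume g: "g \<in> carrier G"
    show "conj_set G g T \<subseteq> T"
    proof (rule subset_normal_by_valn[OF finX[OF Ws] Ws TW])
      show T': "subgroup (conj_set G g T) G" by (rule conj_set_subgroup[OF T g])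
      show "conj_set G g T \<subseteq> W"
        using conj_set_mono[OF \<open>T \<subseteq> W\<close>, of G g] conj_set_normal[OF W g] by simp
      fix q :: nat assume q: "prime q"
      show "valn q (conj_set G g T) \<le> valn q (conj_set G g T \<inter> T) \<or> valn q W \<le> valn q T"
      proof (cases "q = p")
        case True
        have "valn q W \<le> valn q (carrier G)"
          using valn_mono[OF Ws subgroup_self subgroup.subset[OF Ws] fin] .
        also have "\<dots> \<le> valn q T" using valn_mono[OF Ps T sub(1) finX[OF T], of p] Pval True by simp
        finally show ?thesis ..
      next
        case False
        have "valn q P = 0" using P valn_prime_power[OF p q False] by (auto simp: finite_sylow_def)
        then have "valn q T \<le> valn q L'"
          using valn_set_mult[OF Ps L' finX[OF Ps] finX[OF L's] q] by (simp add: T_def)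
        moreover have "valn q L' \<le> valn q (conj_set G g T \<inter> T)"
        proof (rule valn_mono[OF L's])
          show "subgroup (conj_set G g T \<inter> T) G" by (rule subgroups_Inter_pair[OF T' T])
          then show "finite (conj_set G g T \<inter> T)" by (rule finX)
          show "L' \<subseteq> conj_set G g T \<inter> T"
            using conj_set_mono[OF sub(2), of G g] conj_set_normal[OF L' g] sub(2) by simp
        qed
        ultimately show ?thesis using card_conj_set[OF subgroup.subset[OF T] g] by simp
      qed
    qed
  qed
  then show ?case by (simp only: T_def L'_def)
qed

text \<open>Normality in \<open>N\<close> is the preceding lemma at the trivial end of the lower central series. A conjugate
  of \<open>P\<close> in \<open>G\<close> is again a Sylow \<open>p\<close>-subgroup of \<open>N\<close>, hence equal to \<open>P\<close>.\<close>

lemma sylow_of_nilpotent_normal: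
  assumes fin: "finite (carrier G)" and p: "prime p" and N: "N \<lhd> G"
    and nil: "lower_central (G\<lparr>carrier := N\<rparr>) m = {\<one>}" and P: "finite_sylow p G N P"
  shows "P \<lhd> G"
proof -
  have Ns: "subgroup N G" using N by (rule normal_imp_subgroup)
  have Ps: "subgroup P G" and PN: "P \<subseteq> N" and Pval: "valn p P = valn p N" using P by (simp_all add: finite_sylow_def)
  let ?N = "G\<lparr>carrier := N\<rparr>"
  interpret NG: group ?N using Ns by (rule subgroup_imp_group)
  have finN: "finite N" using subgroup.subset[OF Ns] fin by (rule finite_subset)
  have PsN: "subgroup P ?N" using subgroup_incl[OF Ps Ns PN] .
  have "finite_sylow p ?N (carrier ?N) P"
    using P PsN by (simp add: finite_sylow_def)
  then have "P <#>\<^bsub>?N\<^esub> lower_central ?N m \<lhd> ?N"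
    using NG.sylow_times_lower_central_normal[OF _ p] finN by simp
  moreover have "P <#>\<^bsub>?N\<^esub> {\<one>} = P"
    using NG.set_mult_absorb(2)[OF PsN NG.triv_subgroup] subgroup.one_closed[OF Ps] by simp
  ultimately have PN': "P \<lhd> ?N" by (simp add: nil)
  show ?thesis
  proof (rule normalI_conj_set[OF Ps])
    fix g assume g: "g \<in> carrier G"
    show "conj_set G g P \<subseteq> P"
    proof (rule subset_normal_by_valn[OF finN Ns PN' conj_set_subgroup[OF Ps g]])
      show "conj_set G g P \<subseteq> N"
        using conj_set_mono[OF PN, of G g] conj_set_normal[OF N g] by simp
      fix q :: nat assume q: "prime q"
      show "valn q (conj_set G g P) \<le> valn q (conj_set G g P \<inter> P) \<or> valn q N \<le> valn q P"
      proof (cases "q = p")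
        case False
        then have "valn q P = 0" using P valn_prime_power[OF p q False] by (auto simp: finite_sylow_def)
        then show ?thesis using card_conj_set[OF subgroup.subset[OF Ps] g] by simp
      qed (simp add: Pval)
    qed
  qed
qed

lemma exists_largest_normal_prime_to:
  assumes fin: "finite (carrier G)" and p: "prime p"
  shows "\<exists>R. R \<lhd> G \<and> valn p R = 0 \<and> (\<forall>Q. Q \<lhd> G \<longrightarrow> valn p Q = 0 \<longrightarrow> Q \<subseteq> R)"
proof -
  let ?P = "\<lambda>R. R \<lhd> G \<and> valn p R = 0"
  have finX: "finite X" if "X \<lhd> G" for X
    using normal_subset[OF that] fin by (rule finite_subset)
  have "?P {\<one>}" using one_is_normal by simp
  moreover have "\<forall>R. ?P R \<longrightarrow> card R \<le> card (carrier G)"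
    using card_mono[OF fin normal_subset] by blast
  ultimately obtain R where R: "?P R" "\<And>Q. ?P Q \<Longrightarrow> card Q \<le> card R"
    using ex_has_greatest_nat[of ?P "{\<one>}" card "card (carrier G) + 1"] by (metis le_imp_less_Suc Suc_eq_plus1)
  have "Q \<subseteq> R" if Q: "Q \<lhd> G" "valn p Q = 0" for Q
  proof -
    have s: "subgroup Q G" "subgroup R G" using Q(1) R(1) normal_imp_subgroup by blast+
    have n: "Q <#> R \<lhd> G" using normal_set_mult[OF Q(1)] R(1) by blast
    have "valn p (Q <#> R) = 0"
      using valn_set_mult[OF s(1) _ finX[OF Q(1)] finX p, of R] Q(2) R(1) by simp
    then have "card (Q <#> R) \<le> card R" using R(2) n by blast
    then have "R = Q <#> R"
      using subset_set_mult(2)[OF s] finX[OF n] by (intro card_seteq)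
    then show ?thesis using subset_set_mult(1)[OF s] by simp
  qed
  then show ?thesis using R(1) by blast
qed

lemma exp_of_derived_subset_lower_central:
  assumes N: "subgroup N G"
  shows "(derived G ^^ i) N \<subseteq> lower_central (G\<lparr>carrier := N\<rparr>) i"
proof (induction i)
  case 0
  show ?case by simp
next
  case (Suc i)
  let ?N = "G\<lparr>carrier := N\<rparr>"
  let ?L = "lower_central ?N i"
  interpret NG: group ?N using N by (rule subgroup_imp_group)
  have LN: "?L \<subseteq> N" using NG.lower_central_subset[of i] by simp
  have "(derived G ^^ Suc i) N \<subseteq> derived G ?L" using mono_derived[OF Suc] by simp
  also have "\<dots> = derived ?N ?L" using derived_consistent[OF LN N] by simp
  also have "\<dots> \<subseteq> lower_central ?N (Suc i)"
    unfolding derived_def lower_central.simps(2)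
    by (rule NG.mono_generate) (use LN in auto)
  finally show ?case .
qed

end

section \<open>Locally conjugate supplements in finite groups\<close>

context group
begin

text \<open>Here \<open>R\<close> is the largest normal subgroup of order prime to \<open>p\<close>. It contains the Sylow
  \<open>q\<close>-subgroups of \<open>N\<close> and \<open>F\<close> for all \<open>q \<noteq> p\<close>, so that modulo \<open>R\<close> both \<open>N\<close> and \<open>F\<close> are
  \<open>p\<close>-groups, and the normal Sylow \<open>p\<close>-subgroup of \<open>G/F\<close> makes that of \<open>G/R\<close> normal; its
  preimage is \<open>S\<close>. Once \<open>H\<close> is replaced by the conjugate \<open>H'\<close> that has a Sylow \<open>p\<close>-subgroup
  \<open>Q\<close> in common with \<open>K\<close>, both \<open>H'R\<close> and \<open>KR\<close> meet \<open>S\<close> in \<open>QR\<close>, and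
  \<open>conjugate_if_same_trace\<close> applies. That the conjugating element lies in the Sylow subgroup
  \<open>A\<close> of \<open>N\<close> allows different primes to be treated independently.\<close>

lemma conjugate_modulo_prime_to_core:
  assumes fin: "finite (carrier G)" and p: "prime p"
    and N: "N \<lhd> G" "lower_central (G\<lparr>carrier := N\<rparr>) m = {\<one>}"
    and F: "F \<lhd> G" "lower_central (G\<lparr>carrier := F\<rparr>) l = {\<one>}" "lower_central G n \<subseteq> F"
    and R: "R \<lhd> G" "valn p R = 0" "\<And>Q. Q \<lhd> G \<Longrightarrow> valn p Q = 0 \<Longrightarrow> Q \<subseteq> R"
    and H: "subgroup H G" "N <#> H = carrier G" "finite_sylow p G H P"
    and K: "subgroup K G" "N <#> K = carrier G" "finite_sylow p G K Q"
    and PQ: "g \<in> carrier G" "conj_set G g P = Q"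
    and A: "finite_sylow p G N A"
  shows "\<exists>a\<in>A. conj_set G a (H <#> R) = K <#> R"
proof -
  have sN: "subgroup N G" and sF: "subgroup F G" and sR: "subgroup R G"
    using N(1) F(1) R(1) normal_imp_subgroup by blast+
  have finX: "finite X" if "subgroup X G" for X
    using subgroup.subset[OF that] fin by (rule finite_subset)
  have mono: "valn q X \<le> valn q Y" if "subgroup X G" "subgroup Y G" "X \<subseteq> Y" for q X Y
    using valn_mono[OF that finX[OF that(2)]] .
  have prod: "valn q (X <#> Y) + valn q (X \<inter> Y) = valn q X + valn q Y"
    if "subgroup X G" "Y \<lhd> G" "prime q" for q X Y
    using valn_set_mult[OF that(1,2) finX[OF that(1)] finX[OF normal_imp_subgroup[OF that(2)]] that(3)] .
  have syl0: "valn q X = 0" if "finite_sylow p G Y X" "prime q" "q \<noteq> p" for q X Y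
    using that valn_prime_power[OF p that(2,3)] by (auto simp: finite_sylow_def)
  have hall: "\<exists>X. subgroup X G \<and> X \<subseteq> M \<inter> R \<and> valn q X = valn q M"
    if M: "M \<lhd> G" "lower_central (G\<lparr>carrier := M\<rparr>) k = {\<one>}" and q: "prime q" "q \<noteq> p" for M k q
  proof -
    obtain X where X: "finite_sylow q G M X"
      using finite_sylow_exists[OF fin normal_imp_subgroup[OF M(1)] q(1)] by blast
    have "X \<lhd> G" using sylow_of_nilpotent_normal[OF fin q(1) M X] .
    moreover have "valn p X = 0" using X valn_prime_power[OF q(1) p] q(2) by (auto simp: finite_sylow_def)
    ultimately have "X \<subseteq> R" by (rule R(3))
    then show ?thesis using X by (auto simp: finite_sylow_def)
  qed
  have AG: "A \<lhd> G" using sylow_of_nilpotent_normal[OF fin p N A] .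
  have sA: "subgroup A G" and AN: "A \<subseteq> N" and valA: "valn p A = valn p N" and "\<exists>k. card A = p ^ k"
    using A by (simp_all add: finite_sylow_def)
  then obtain k where k: "card A = p ^ k" by blast
  have NRA: "(N \<inter> R) <#> A = N"
  proof -
    have i: "subgroup (N \<inter> R) G" by (rule subgroups_Inter_pair[OF sN sR])
    have s: "subgroup ((N \<inter> R) <#> A) G" by (rule subgroup_set_mult_normal[OF i AG])
    show ?thesis
    proof (rule subgroup_eq_by_valn[OF s sN _ finX[OF sN]])
      show "(N \<inter> R) <#> A \<subseteq> N" using set_mult_subset_subgroup[OF sN _ AN, of "N \<inter> R"] by blast
      fix q :: nat assume q: "prime q"
      show "valn q N \<le> valn q ((N \<inter> R) <#> A)"
      proof (cases "q = p")
        case True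
        then show ?thesis using mono[OF sA s subset_set_mult(2)[OF i sA], of p] valA by simp
      next
        case False
        obtain X where X: "subgroup X G" "X \<subseteq> N \<inter> R" "valn q X = valn q N" using hall[OF N q False] by blast
        have "X \<subseteq> (N \<inter> R) <#> A" using X(2) subset_set_mult(1)[OF i sA] by blast
        then show ?thesis using mono[OF X(1) s, of q] X(3) by simp
      qed
    qed
  qed
  obtain P0 where P0: "finite_sylow p G (carrier G) P0" using finite_sylow_exists[OF fin subgroup_self p] by blast
  have sP0: "subgroup P0 G" and valP0: "valn p P0 = valn p (carrier G)" using P0 by (simp_all add: finite_sylow_def)
  have "P0 <#> F = (P0 <#> lower_central G n) <#> F"
  proof -
    have "lower_central G n <#> F = F"
      using set_mult_absorb(1)[OF sF normal_imp_subgroup[OF lower_central_normal] F(3)] .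
    then show ?thesis
      using set_mult_assoc[OF subgroup.subset[OF sP0] lower_central_subset subgroup.subset[OF sF], of n] by simp
  qed
  then have P0F: "P0 <#> F \<lhd> G"
    using normal_set_mult[OF sylow_times_lower_central_normal[OF fin p P0, of n] F(1)] by simp
  have sP0F: "subgroup (P0 <#> F) G" using P0F by (rule normal_imp_subgroup)
  define S where "S = (P0 <#> F) <#> R"
  have S: "S \<lhd> G" unfolding S_def by (rule normal_set_mult[OF P0F R(1)])
  have sS: "subgroup S G" using S by (rule normal_imp_subgroup)
  have subS: "P0 \<subseteq> S" "F \<subseteq> S" "R \<subseteq> S"
    unfolding S_def using subset_set_mult[OF sP0F sR] subset_set_mult[OF sP0 sF] by blast+
  have Sp: "valn p (carrier G) \<le> valn p S" using mono[OF sP0 sS subS(1), of p] valP0 by simp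
  have Sq: "valn q S \<le> valn q R" if q: "prime q" "q \<noteq> p" for q
  proof -
    obtain X where X: "subgroup X G" "X \<subseteq> F \<inter> R" "valn q X = valn q F" using hall[OF F(1,2) q] by blast
    have "X \<subseteq> (P0 <#> F) \<inter> R" using X(2) subset_set_mult(2)[OF sP0 sF] by blast
    then have "valn q F \<le> valn q ((P0 <#> F) \<inter> R)"
      using mono[OF X(1) subgroups_Inter_pair[OF sP0F sR], of q] X(3) by simp
    moreover have "valn q (P0 <#> F) \<le> valn q F" using prod[OF sP0 F(1) q(1)] syl0[OF P0 q] by simp
    ultimately show ?thesis using prod[OF sP0F R(1) q(1)] by (simp add: S_def)
  qed
  have inS: "X \<subseteq> S" if X: "finite_sylow p G Y X" for X Y
  proof -
    have sX: "subgroup X G" using X by (simp add: finite_sylow_def)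
    have "G\<lparr>carrier := carrier G\<rparr> = G" by simp
    show ?thesis
    proof (rule subset_normal_by_valn[OF fin subgroup_self _ sX subgroup.subset[OF sX]])
      fix q :: nat assume q: "prime q"
      show "valn q X \<le> valn q (X \<inter> S) \<or> valn q (carrier G) \<le> valn q S"
        using Sp syl0[OF X q] by (cases "q = p") simp_all
    qed (simp add: S)
  qed
  define D where "D = Q <#> R"
  have sQ: "subgroup Q G" using K(3) by (simp add: finite_sylow_def)
  have sD: "subgroup D G" unfolding D_def by (rule subgroup_set_mult_normal[OF sQ R(1)])
  have trace: "(X <#> R) \<inter> S = D \<and> valn p (X <#> R) = valn p D"
    if X: "subgroup X G" "finite_sylow p G X Q" for X
  proof -
    have QX: "Q \<subseteq> X" and valQ: "valn p Q = valn p X" using X(2) by (simp_all add: finite_sylow_def)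
    have sXR: "subgroup (X <#> R) G" by (rule subgroup_set_mult_normal[OF X(1) R(1)])
    have sI: "subgroup ((X <#> R) \<inter> S) G" by (rule subgroups_Inter_pair[OF sXR sS])
    have DX: "D \<subseteq> X <#> R" unfolding D_def using QX by (rule mono_set_mult) simp
    have DS: "D \<subseteq> S" unfolding D_def by (rule set_mult_subset_subgroup[OF sS inS[OF X(2)] subS(3)])
    have val: "valn p (X <#> R) \<le> valn p D"
      using prod[OF X(1) R(1) p] R(2) valQ mono[OF sQ sD, of p] subset_set_mult(1)[OF sQ sR]
      by (simp add: D_def)
    have "D = (X <#> R) \<inter> S"
    proof (rule subgroup_eq_by_valn[OF sD sI _ finX[OF sI]])
      show "D \<subseteq> (X <#> R) \<inter> S" using DX DS by blast
      fix q :: nat assume q: "prime q"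
      show "valn q ((X <#> R) \<inter> S) \<le> valn q D"
      proof (cases "q = p")
        case True
        then show ?thesis using mono[OF sI sXR, of p] val by simp
      next
        case False
        have "valn q ((X <#> R) \<inter> S) \<le> valn q S" by (rule mono[OF sI sS]) simp
        also have "\<dots> \<le> valn q R" by (rule Sq[OF q False])
        also have "\<dots> \<le> valn q D" using mono[OF sR sD] subset_set_mult(2)[OF sQ sR] by (simp add: D_def)
        finally show ?thesis .
      qed
    qed
    then show ?thesis using val mono[OF sD sXR DX, of p] by simp
  qed
  have supp: "(X <#> R) <#> A = carrier G" if X: "subgroup X G" "N <#> X = carrier G" for X
  proof -
    note s = subgroup.subset[OF X(1)] subgroup.subset[OF sR] subgroup.subset[OF sA]
    have "(X <#> R) <#> A = X <#> (R <#> A)" using set_mult_assoc[OF s] .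
    moreover have "carrier G = X <#> N" using X(2) set_mult_commute_normal[OF X(1) N(1)] by simp
    moreover have "X <#> N \<subseteq> X <#> (R <#> A)"
      using NRA mono_set_mult[of X X "(N \<inter> R) <#> A" "R <#> A" G] mono_set_mult[of "N \<inter> R" R A A G] by simp
    ultimately show ?thesis using setmult_subset_G[OF setmult_subset_G[OF s(1,2)] s(3)] by blast
  qed
  define H' where "H' = conj_set G g H"
  have sH': "subgroup H' G" unfolding H'_def by (rule conj_set_subgroup[OF H(1) PQ(1)])
  have supH': "N <#> H' = carrier G"
  proof -
    have "conj_set G g (carrier G) = carrier G" by (rule conj_set_self[OF subgroup_self PQ(1)])
    then show ?thesis
      using conj_set_set_mult[OF subgroup.subset[OF sN] subgroup.subset[OF H(1)] PQ(1)]
        conj_set_normal[OF N(1) PQ(1)] H(2) by (simp add: H'_def)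
  qed
  have "finite_sylow p G H' Q"
  proof -
    have P: "subgroup P G" "P \<subseteq> H" "valn p P = valn p H" using H(3) by (simp_all add: finite_sylow_def)
    have "card Q = card P" using card_conj_set[OF subgroup.subset[OF P(1)] PQ(1)] PQ(2) by simp
    moreover have "card H' = card H" unfolding H'_def by (rule card_conj_set[OF subgroup.subset[OF H(1)] PQ(1)])
    ultimately show ?thesis
      using K(3) P(3) conj_set_mono[OF P(2), of G g] PQ(2) by (simp add: finite_sylow_def H'_def)
  qed
  note tH' = trace[OF sH' this] and tK = trace[OF K(1,3)]
  have "(derived G ^^ m) A = {\<one>}"
  proof -
    have "(derived G ^^ m) A \<subseteq> (derived G ^^ m) N" by (rule mono_exp_of_derived[OF AN])
    then have "(derived G ^^ m) A \<subseteq> {\<one>}" using exp_of_derived_subset_lower_central[OF sN, of m] N(2) by simp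
    then show ?thesis using subgroup.one_closed[OF exp_of_derived_is_subgroup[OF sA, of m]] by blast
  qed
  then have "\<exists>a\<in>A. conj_set G a (H' <#> R) = K <#> R"
    using conjugate_if_same_trace[OF fin AG _ S inS[OF A] subgroup_set_mult_normal[OF sH' R(1)] _ supp[OF sH' supH'] _
        subgroup_set_mult_normal[OF K(1) R(1)] _ supp[OF K(1,2)] _ p k] tH' tK by blast
  then obtain a where a: "a \<in> A" "conj_set G a (H' <#> R) = K <#> R" by blast
  have aG: "a \<in> carrier G" using sA a(1) by (rule subgroup.mem_carrier)
  have sHR: "subgroup (H <#> R) G" by (rule subgroup_set_mult_normal[OF H(1) R(1)])
  have "H' <#> R = conj_set G g (H <#> R)"
    using conj_set_set_mult[OF subgroup.subset[OF H(1)] subgroup.subset[OF sR] PQ(1)]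
      conj_set_normal[OF R(1) PQ(1)] by (simp add: H'_def)
  then have ag: "conj_set G (a \<otimes> g) (H <#> R) = K <#> R"
    using a(2) conj_set_conj_set[OF subgroup.subset[OF sHR] aG PQ(1)] by simp
  \<comment> \<open>The factor of \<open>a \<otimes> g\<close> in \<open>H <#> R\<close> normalizes that group and can be dropped.\<close>
  have "a \<otimes> g \<in> A <#> (H <#> R)"
    using supp[OF H(1,2)] set_mult_commute_normal[OF sHR AG] aG PQ(1) by simp
  then obtain b y where b: "b \<in> A" "y \<in> H <#> R" "a \<otimes> g = b \<otimes> y" by (auto simp only: set_mult_iff)
  have bG: "b \<in> carrier G" using sA b(1) by (rule subgroup.mem_carrier)
  have yG: "y \<in> carrier G" using sHR b(2) by (rule subgroup.mem_carrier)
  have "conj_set G b (conj_set G y (H <#> R)) = K <#> R"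
    using conj_set_conj_set[OF subgroup.subset[OF sHR] bG yG] b(3) ag by simp
  then show ?thesis using conj_set_self[OF sHR b(2)] b(1) by auto
qed

text \<open>The conjugating element for the prime \<open>p\<close> lies in \<open>R q\<close> for every other prime \<open>q\<close>, hence in
  \<open>H (R q)\<close> and \<open>K (R q)\<close>. Therefore the product of these elements conjugates \<open>H (R p)\<close> to
  \<open>K (R p)\<close> for all \<open>p\<close> at once. Since the index of \<open>K\<close> in \<open>K (R p)\<close> is prime to \<open>p\<close>, the
  intersection \<open>X\<close> of the groups \<open>K (R p)\<close> is \<open>K\<close>, and likewise it is the conjugate of \<open>H\<close>.\<close>

theorem finite_supplements_conjugate:
  assumes fin: "finite (carrier G)"
    and N: "N \<lhd> G" "lower_central (G\<lparr>carrier := N\<rparr>) m = {\<one>}"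
    and F: "F \<lhd> G" "lower_central (G\<lparr>carrier := F\<rparr>) l = {\<one>}" "lower_central G n \<subseteq> F"
    and H: "subgroup H G" "N <#> H = carrier G"
    and K: "subgroup K G" "N <#> K = carrier G"
    and loc: "\<And>p. prime p \<Longrightarrow> \<exists>P Q. finite_sylow p G H P \<and> finite_sylow p G K Q \<and> conjugate G P Q"
  shows "conjugate G H K"
proof -
  have finX: "finite X" if "subgroup X G" for X
    using subgroup.subset[OF that] fin by (rule finite_subset)
  have "\<exists>R. R \<lhd> G \<and> valn p R = 0 \<and> (\<forall>Q. Q \<lhd> G \<longrightarrow> valn p Q = 0 \<longrightarrow> Q \<subseteq> R)" if "prime p" for p
    using exists_largest_normal_prime_to[OF fin that] .
  then obtain R where R: "\<And>p. prime p \<Longrightarrow> R p \<lhd> G" "\<And>p. prime p \<Longrightarrow> valn p (R p) = 0"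
    "\<And>p Q. prime p \<Longrightarrow> Q \<lhd> G \<Longrightarrow> valn p Q = 0 \<Longrightarrow> Q \<subseteq> R p"
    by metis
  have sR: "subgroup (R p) G" if "prime p" for p using R(1)[OF that] by (rule normal_imp_subgroup)
  have sN: "subgroup N G" using N(1) by (rule normal_imp_subgroup)
  have sHR: "subgroup (H <#> R p) G" and sKR: "subgroup (K <#> R p) G" if "prime p" for p
    using subgroup_set_mult_normal[OF H(1) R(1)[OF that]] subgroup_set_mult_normal[OF K(1) R(1)[OF that]] .
  have step: "\<exists>x. x \<in> N \<and> (\<forall>q. prime q \<longrightarrow> q \<noteq> p \<longrightarrow> x \<in> R q) \<and> conj_set G x (H <#> R p) = K <#> R p"
    if p: "prime p" for p
  proof -
    obtain P Q g where PQ: "finite_sylow p G H P" "finite_sylow p G K Q" "g \<in> carrier G" "Q = conj_set G g P"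
      using loc[OF p] by (auto simp: conjugate_iff)
    obtain A where A: "finite_sylow p G N A" using finite_sylow_exists[OF fin sN p] by blast
    have "\<exists>a\<in>A. conj_set G a (H <#> R p) = K <#> R p"
      by (rule conjugate_modulo_prime_to_core[OF fin p N F R(1)[OF p] R(2)[OF p] R(3)[OF p] H PQ(1) K PQ(2,3) PQ(4)[symmetric] A])
    then obtain a where a: "a \<in> A" "conj_set G a (H <#> R p) = K <#> R p" by blast
    have "A \<subseteq> R q" if q: "prime q" "q \<noteq> p" for q
    proof (rule R(3)[OF q(1)])
      show "A \<lhd> G" by (rule sylow_of_nilpotent_normal[OF fin p N A])
      show "valn q A = 0" using A valn_prime_power[OF p q] by (auto simp: finite_sylow_def)
    qed
    moreover have "A \<subseteq> N" using A by (simp add: finite_sylow_def)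
    ultimately show ?thesis using a by (intro exI[of _ a] conjI allI impI) blast+
  qed
  have all: "\<exists>x\<in>N. (\<forall>q. prime q \<longrightarrow> q \<notin> \<pi> \<longrightarrow> x \<in> R q) \<and> (\<forall>p\<in>\<pi>. conj_set G x (H <#> R p) = K <#> R p)"
    if "finite \<pi>" "\<forall>p\<in>\<pi>. prime p" for \<pi> :: "nat set"
    using that
  proof (induction \<pi> rule: finite_induct)
    case empty
    have "\<one> \<in> R q" if "prime q" for q using subgroup.one_closed[OF sR[OF that]] .
    then show ?case using subgroup.one_closed[OF sN] by (intro bexI[of _ \<one>]) simp_all
  next
    case (insert p \<pi>)
    then have p: "prime p" by simp
    obtain x where x: "x \<in> N" "\<And>q. prime q \<Longrightarrow> q \<notin> \<pi> \<Longrightarrow> x \<in> R q"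
      "\<And>q. q \<in> \<pi> \<Longrightarrow> conj_set G x (H <#> R q) = K <#> R q"
      using insert by auto
    obtain y where y: "y \<in> N" "\<And>q. prime q \<Longrightarrow> q \<noteq> p \<Longrightarrow> y \<in> R q" "conj_set G y (H <#> R p) = K <#> R p"
      using step[OF p] by blast
    have xG: "x \<in> carrier G" and yG: "y \<in> carrier G"
      using subgroup.mem_carrier[OF sN x(1)] subgroup.mem_carrier[OF sN y(1)] .
    show ?case
    proof (intro bexI conjI allI impI ballI)
      show "x \<otimes> y \<in> N" using subgroup.m_closed[OF sN x(1) y(1)] .
      show "x \<otimes> y \<in> R q" if "prime q" "q \<notin> insert p \<pi>" for q
        using subgroup.m_closed[OF sR[OF that(1)] x(2)[OF that(1)] y(2)[OF that(1)]] that(2) by simp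
      fix q assume q: "q \<in> insert p \<pi>"
      then have pq: "prime q" using insert by blast
      have "conj_set G x (conj_set G y (H <#> R q)) = K <#> R q"
      proof (cases "q = p")
        case True
        have "x \<in> R p" using x(2)[OF p] insert by blast
        then have "x \<in> K <#> R p" using subset_set_mult(2)[OF K(1) sR[OF p]] by blast
        then show ?thesis using y(3) conj_set_self[OF sKR[OF p]] True by simp
      next
        case False
        have "y \<in> H <#> R q" using subset_set_mult(2)[OF H(1) sR[OF pq]] y(2)[OF pq False] by blast
        then show ?thesis using conj_set_self[OF sHR[OF pq]] x(3) q False by simp
      qed
      then show "conj_set G (x \<otimes> y) (H <#> R q) = K <#> R q"
        using conj_set_conj_set[OF subgroup.subset[OF sHR[OF pq]] xG yG] by simp
    qed
  qed
  define \<pi> where "\<pi> = prime_factors (card (carrier G))"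
  have \<pi>: "prime p" if "p \<in> \<pi>" for p using that by (simp add: \<pi>_def in_prime_factors_imp_prime)
  obtain x where x: "x \<in> N" "\<And>p. p \<in> \<pi> \<Longrightarrow> conj_set G x (H <#> R p) = K <#> R p"
    using all[of \<pi>] \<pi> by (auto simp: \<pi>_def)
  have xG: "x \<in> carrier G" using subgroup.mem_carrier[OF sN x(1)] .
  define H1 where "H1 = conj_set G x H"
  have sH1: "subgroup H1 G" unfolding H1_def by (rule conj_set_subgroup[OF H(1) xG])
  have H1R: "H1 <#> R p = K <#> R p" if "p \<in> \<pi>" for p
    using conj_set_set_mult[OF subgroup.subset[OF H(1)] subgroup.subset[OF sR[OF \<pi>[OF that]]] xG]
      conj_set_normal[OF R(1)[OF \<pi>[OF that]] xG] x(2)[OF that] by (simp add: H1_def)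
  define X where "X = carrier G \<inter> (\<Inter>p\<in>\<pi>. K <#> R p)"
  have sX: "subgroup X G"
  proof -
    have "subgroup (\<Inter>(insert (carrier G) ((\<lambda>p. K <#> R p) ` \<pi>))) G"
      using sKR \<pi> subgroup_self by (intro subgroups_Inter) auto
    then show ?thesis by (simp add: X_def)
  qed
  have eq: "Y = X" if Y: "subgroup Y G" "\<And>p. p \<in> \<pi> \<Longrightarrow> Y <#> R p = K <#> R p" for Y
  proof (rule subgroup_eq_by_valn[OF Y(1) sX _ finX[OF sX]])
    show "Y \<subseteq> X"
      using subgroup.subset[OF Y(1)] subset_set_mult(1)[OF Y(1) sR[OF \<pi>]] Y(2) by (auto simp: X_def)
    fix q :: nat assume q: "prime q"
    show "valn q X \<le> valn q Y"
    proof (cases "q \<in> \<pi>")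
      case True
      have sYR: "subgroup (Y <#> R q) G" by (rule subgroup_set_mult_normal[OF Y(1) R(1)[OF q]])
      have "valn q X \<le> valn q (Y <#> R q)"
        using valn_mono[OF sX sYR _ finX[OF sYR], of q] Y(2)[OF True] True by (auto simp: X_def)
      also have "\<dots> \<le> valn q Y"
        using valn_set_mult[OF Y(1) R(1)[OF q] finX[OF Y(1)] finX[OF sR[OF q]] q] R(2)[OF q] by simp
      finally show ?thesis .
    next
      case False
      have "card (carrier G) \<noteq> 0" using finite_subgroup_card_pos[OF subgroup_self fin] .
      then have "\<not> q dvd card (carrier G)" using False q by (auto simp: \<pi>_def in_prime_factors_iff)
      then have "valn q (carrier G) = 0" by (rule not_dvd_imp_multiplicity_0)
      then show ?thesis using valn_mono[OF sX subgroup_self subgroup.subset[OF sX] fin, of q] by simp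
    qed
  qed
  have "H1 = K" using eq[OF sH1 H1R] eq[OF K(1)] by simp
  then show ?thesis using xG by (auto simp: conjugate_iff H1_def)
qed

end

section \<open>Sylow subgroups containing a given subgroup\<close>

context group
begin

lemma right_translation_action:
  assumes P: "subgroup P G" and Q: "subgroup Q G"
  shows "group_action (G\<lparr>carrier := P\<rparr>) (rcosets Q) (\<lambda>x. \<lambda>c\<in>rcosets Q. c #> inv x)"
proof -
  let ?E = "rcosets Q"
  let ?f = "\<lambda>x. \<lambda>c\<in>?E. c #> inv x"
  interpret Q: subgroup Q G by fact
  have sub: "c \<subseteq> carrier G" if "c \<in> ?E" for c using that by (rule Q.rcosets_carrier[OF is_group])
  have closed: "c #> x \<in> ?E" if c: "c \<in> ?E" and x: "x \<in> carrier G" for c x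
  proof -
    obtain g where "g \<in> carrier G" "c = Q #> g" using c by (auto simp: RCOSETS_def)
    then show ?thesis using coset_mult_assoc[OF Q.subset _ x, of g] rcosetsI[OF Q.subset, of "g \<otimes> x"] x by simp
  qed
  have bij: "?f x \<in> Bij ?E" if x: "x \<in> carrier G" for x
  proof -
    have "bij_betw (\<lambda>c. c #> inv x) ?E ?E"
    proof (rule bij_betwI[where g = "\<lambda>c. c #> x"])
      show "(\<lambda>c. c #> inv x) \<in> ?E \<rightarrow> ?E" "(\<lambda>c. c #> x) \<in> ?E \<rightarrow> ?E" using closed x by simp_all
      fix c assume c: "c \<in> ?E"
      show "(c #> inv x) #> x = c" "(c #> x) #> inv x = c"
        using coset_mult_assoc[OF sub[OF c]] sub[OF c] x by simp_all
    qed
    moreover have "bij_betw (?f x) ?E ?E = bij_betw (\<lambda>c. c #> inv x) ?E ?E"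
      by (rule bij_betw_cong) simp
    ultimately show ?thesis by (simp add: Bij_def)
  qed
  show ?thesis
  proof (intro group_action.intro group_hom.intro group_hom_axioms.intro)
    show "group (G\<lparr>carrier := P\<rparr>)" using P by (rule subgroup_imp_group)
    show "group (BijGroup ?E)" by (rule group_BijGroup)
    show "?f \<in> hom (G\<lparr>carrier := P\<rparr>) (BijGroup ?E)"
    proof (rule homI)
      fix x assume "x \<in> carrier (G\<lparr>carrier := P\<rparr>)"
      then show "?f x \<in> carrier (BijGroup ?E)"
        using bij[of x] subgroup.mem_carrier[OF P, of x] by (simp add: BijGroup_def)
    next
      fix x y assume "x \<in> carrier (G\<lparr>carrier := P\<rparr>)" "y \<in> carrier (G\<lparr>carrier := P\<rparr>)"
      then have xy: "x \<in> carrier G" "y \<in> carrier G" using subgroup.mem_carrier[OF P] by simp_all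
      have "compose ?E (?f x) (?f y) = ?f (x \<otimes> y)"
      proof (rule extensionalityI[of _ ?E])
        fix c assume c: "c \<in> ?E"
        then show "compose ?E (?f x) (?f y) c = ?f (x \<otimes> y) c"
          using xy closed[OF c, of "inv y"] coset_mult_assoc[OF sub[OF c], of "inv y" "inv x"]
          by (simp add: compose_def inv_mult_group)
      qed simp_all
      then show "?f (x \<otimes>\<^bsub>G\<lparr>carrier := P\<rparr>\<^esub> y) = ?f x \<otimes>\<^bsub>BijGroup ?E\<^esub> ?f y"
        using bij xy by (simp add: BijGroup_def)
    qed
  qed
qed

text \<open>The action of \<open>P\<close> on the cosets of \<open>Q\<close>: their number is prime to \<open>p\<close> and orbits have
  \<open>p\<close>-power length, so some coset \<open>Q #> g\<close> is fixed by \<open>P\<close>.\<close>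

lemma prime_power_subgroup_in_conjugate:
  assumes fin: "finite (carrier G)" and p: "prime p"
    and P: "subgroup P G" "card P = p ^ k" and Q: "finite_sylow p G (carrier G) Q"
  shows "\<exists>g\<in>carrier G. P \<subseteq> conj_set G g Q"
proof -
  have sQ: "subgroup Q G" and valQ: "valn p Q = valn p (carrier G)" using Q by (simp_all add: finite_sylow_def)
  let ?E = "rcosets Q" and ?P = "G\<lparr>carrier := P\<rparr>" and ?f = "\<lambda>x. \<lambda>c\<in>rcosets Q. c #> inv x"
  interpret act: group_action ?P ?E ?f by (rule right_translation_action[OF P(1) sQ])
  have "card ?E * card Q = card (carrier G)" using lagrange[OF sQ] by (simp add: order_def)
  moreover have "card (carrier G) \<noteq> 0" using finite_subgroup_card_pos[OF subgroup_self fin] .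
  ultimately have E0: "card ?E \<noteq> 0" and Q0: "card Q \<noteq> 0" and "card (carrier G) = card ?E * card Q"
    by (metis mult_0, metis mult_0_right, metis)
  then have "valn p (carrier G) = valn p ?E + valn p Q"
    using p prime_elem_multiplicity_mult_distrib[of p "card ?E" "card Q"] by simp
  then have "multiplicity p (card ?E) = 0" using valQ by simp
  then have ndvd: "\<not> p dvd card ?E"
    using prime_multiplicity_gt_zero_iff[of p "card ?E"] p E0 by simp
  have finE: "finite ?E" using E0 by (intro card_ge_0_finite) simp
  have "\<exists>Y\<in>orbits ?P ?E ?f. \<not> p dvd card Y"
  proof (rule ccontr)
    assume "\<not> ?thesis"
    then have "p dvd card (\<Union>(orbits ?P ?E ?f))"
      using finE act.disjoint_union by (intro dvd_partition) (auto simp: act.orbits_coverture)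
    then show False using ndvd act.orbits_coverture by simp
  qed
  then obtain c where c: "c \<in> ?E" "\<not> p dvd card (orbit ?P ?f c)" by (auto simp: orbits_def)
  have "card (orbit ?P ?f c) * card (stabilizer ?P ?f c) = p ^ k"
    using act.orbit_stabilizer_theorem[OF c(1)] P(2) by (simp add: order_def)
  then have "card (orbit ?P ?f c) dvd p ^ k" by (metis dvd_triv_left)
  then obtain i where "card (orbit ?P ?f c) = p ^ i" using divides_primepow_nat[OF p] by auto
  then have "card (orbit ?P ?f c) = 1" using c(2) by (cases i) auto
  then obtain d where d: "orbit ?P ?f c = {d}" by (auto simp: card_1_singleton_iff)
  have fixc: "c #> inv x = c" if x: "x \<in> P" for x
  proof -
    have "?f x c \<in> orbit ?P ?f c" unfolding orbit_def using x by auto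
    then have "c #> inv x \<in> {d}" using d c(1) by simp
    moreover have "c \<in> {d}" using act.orbit_refl[OF c(1)] d by simp
    ultimately show ?thesis by simp
  qed
  obtain g where g: "g \<in> carrier G" "c = Q #> g" using c(1) by (auto simp: RCOSETS_def)
  have "P \<subseteq> conj_set G (inv g) Q"
  proof
    fix x assume x: "x \<in> P"
    have xG: "x \<in> carrier G" using P(1) x by (rule subgroup.mem_carrier)
    have "inv x \<in> P" using P(1) x by (rule subgroup.m_inv_closed)
    from fixc[OF this] have "Q #> g #> x = Q #> g" using g xG by simp
    then have "Q #> (g \<otimes> x) = Q #> g" using coset_mult_assoc[OF subgroup.subset[OF sQ] g(1) xG] by simp
    then have "Q #> (g \<otimes> x \<otimes> inv g) = Q"
      using coset_mult_inv2[of Q "g \<otimes> x" g] subgroup.subset[OF sQ] g(1) xG by simp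
    then have "g \<otimes> x \<otimes> inv g \<in> Q" using coset_join1[OF _ _ sQ] g(1) xG by simp
    then show "x \<in> conj_set G (inv g) Q"
      using mem_conj_set[OF subgroup.subset[OF sQ], of "inv g" x] g(1) xG by simp
  qed
  then show ?thesis using g(1) by blast
qed

lemma finite_sylow_exists_above:
  assumes fin: "finite (carrier G)" and p: "prime p" and X: "subgroup X G"
    and P: "subgroup P G" "P \<subseteq> X" "card P = p ^ k"
  shows "\<exists>Q. finite_sylow p G X Q \<and> P \<subseteq> Q"
proof -
  let ?X = "G\<lparr>carrier := X\<rparr>"
  interpret X: group ?X using X by (rule subgroup_imp_group)
  have finX: "finite (carrier ?X)" using finite_subset[OF subgroup.subset[OF X] fin] by simp
  obtain Q where Q: "finite_sylow p G X Q" using finite_sylow_exists[OF fin X p] by blast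
  then have QG: "subgroup Q G" and QX: "Q \<subseteq> X" by (simp_all add: finite_sylow_def)
  have "finite_sylow p ?X (carrier ?X) Q" using Q subgroup_incl[OF QG X QX] by (simp add: finite_sylow_def)
  then obtain g where g: "g \<in> X" "P \<subseteq> conj_set ?X g Q"
    using X.prime_power_subgroup_in_conjugate[OF finX p subgroup_incl[OF P(1) X P(2)] P(3)] by auto
  have gG: "g \<in> carrier G" using X g(1) by (rule subgroup.mem_carrier)
  have "finite_sylow p G X (conj_set G g Q)"
    using Q conj_set_subgroup[OF QG gG] card_conj_set[OF subgroup.subset[OF QG] gG]
      conj_set_mono[OF QX, of G g] conj_set_self[OF X g(1)] by (simp add: finite_sylow_def)
  then show ?thesis using g(2) conj_set_consistent[OF X g(1), of Q] by auto
qed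

end

section \<open>Supersolvable groups and commutators\<close>

context group
begin

lemma conj_group_hom:
  assumes "c \<in> carrier G"
  shows "group_hom G G (\<lambda>x. c \<otimes> x \<otimes> inv c)"
  by unfold_locales (use assms in \<open>auto simp: hom_def word_simps\<close>)

text \<open>Automorphisms of a cyclic group are power maps, so they commute.\<close>

lemma commutator_centralizes_cyclic:
  assumes b: "b \<in> carrier G" and gh: "g \<in> carrier G" "h \<in> carrier G"
    and act: "\<And>x. x \<in> carrier G \<Longrightarrow> \<exists>k::int. x \<otimes> b \<otimes> inv x = b [^] k"
  shows "conj_set G (g \<otimes> h \<otimes> inv g \<otimes> inv h) {b} = {b}"
proof -
  obtain r s :: int where r: "inv g \<otimes> b \<otimes> inv (inv g) = b [^] r" and s: "inv h \<otimes> b \<otimes> inv (inv h) = b [^] s"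
    using act[of "inv g"] act[of "inv h"] gh by auto
  have pw: "x \<otimes> b [^] k \<otimes> inv x = (x \<otimes> b \<otimes> inv x) [^] k" if "x \<in> carrier G" for x and k :: int
    using group_hom.hom_int_pow[OF conj_group_hom[OF that] b] .
  have "inv g \<otimes> (inv h \<otimes> b \<otimes> inv (inv h)) \<otimes> inv (inv g) = b [^] (r * s)"
    using pw[of "inv g" s] r s gh b by (simp add: int_pow_pow)
  moreover have "inv h \<otimes> (inv g \<otimes> b \<otimes> inv (inv g)) \<otimes> inv (inv h) = b [^] (s * r)"
    using pw[of "inv h" r] r s gh b by (simp add: int_pow_pow)
  \<comment> \<open>The two power maps commute, so \<open>inv g \<otimes> inv h\<close> and \<open>inv h \<otimes> inv g\<close> act equally on \<open>b\<close>.\<close>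
  ultimately have eq: "inv g \<otimes> (inv h \<otimes> (b \<otimes> (h \<otimes> g))) = inv h \<otimes> (inv g \<otimes> (b \<otimes> (g \<otimes> h)))"
    using gh b by (simp add: word_simps mult.commute)
  have "(g \<otimes> h) \<otimes> (inv g \<otimes> (inv h \<otimes> (b \<otimes> (h \<otimes> g)))) \<otimes> inv (g \<otimes> h)
      = (g \<otimes> h) \<otimes> (inv h \<otimes> (inv g \<otimes> (b \<otimes> (g \<otimes> h)))) \<otimes> inv (g \<otimes> h)"
    by (simp only: eq)
  then show ?thesis using gh b by (simp add: conj_set_def word_simps)
qed

lemma commutator_subgroup_centralizes_cyclic:
  assumes b: "b \<in> carrier G" and act: "\<And>x. x \<in> carrier G \<Longrightarrow> \<exists>k::int. x \<otimes> b \<otimes> inv x = b [^] k"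
    and g: "g \<in> lower_central G 1"
  shows "g \<otimes> b [^] (k::int) \<otimes> inv g = b [^] k"
proof -
  let ?Z = "{z \<in> carrier G. conj_set G z {b} = {b}}"
  have "(\<Union>x \<in> carrier G. \<Union>y \<in> carrier G. {x \<otimes> y \<otimes> inv x \<otimes> inv y}) \<subseteq> ?Z"
    using commutator_centralizes_cyclic[OF b _ _ act] by auto
  then have "generate G (\<Union>x \<in> carrier G. \<Union>y \<in> carrier G. {x \<otimes> y \<otimes> inv x \<otimes> inv y}) \<subseteq> ?Z"
    using b by (intro generate_subgroup_incl[OF _ subgroup_normalizer]) auto
  then have "g \<in> ?Z" using g by auto
  then have gG: "g \<in> carrier G" and gb: "g \<otimes> b \<otimes> inv g = b" by (simp_all add: conj_set_def)
  from group_hom.hom_int_pow[OF conj_group_hom[OF gG] b, of k] show ?thesis by (simp add: gb)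
qed

end

lemma (in group_hom) image_lower_central_subset:
  "h ` lower_central G n \<subseteq> lower_central H n"
proof (induction n)
  case 0
  show ?case by auto
next
  case (Suc n)
  let ?C = "\<Union>x \<in> lower_central G n. \<Union>y \<in> carrier G. {x \<otimes>\<^bsub>G\<^esub> y \<otimes>\<^bsub>G\<^esub> inv\<^bsub>G\<^esub> x \<otimes>\<^bsub>G\<^esub> inv\<^bsub>G\<^esub> y}"
  let ?D = "\<Union>x \<in> lower_central H n. \<Union>y \<in> carrier H. {x \<otimes>\<^bsub>H\<^esub> y \<otimes>\<^bsub>H\<^esub> inv\<^bsub>H\<^esub> x \<otimes>\<^bsub>H\<^esub> inv\<^bsub>H\<^esub> y}"
  have CG: "?C \<subseteq> carrier G" using G.lower_central_subset[of n] by auto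
  have DH: "?D \<subseteq> carrier H" using H.lower_central_subset[of n] by auto
  have "h ` ?C \<subseteq> ?D"
  proof
    fix z assume "z \<in> h ` ?C"
    then obtain x y where xy: "x \<in> lower_central G n" "y \<in> carrier G"
      "z = h (x \<otimes>\<^bsub>G\<^esub> y \<otimes>\<^bsub>G\<^esub> inv\<^bsub>G\<^esub> x \<otimes>\<^bsub>G\<^esub> inv\<^bsub>G\<^esub> y)" by blast
    have "x \<in> carrier G" using xy(1) G.lower_central_subset[of n] by blast
    then have "z = h x \<otimes>\<^bsub>H\<^esub> h y \<otimes>\<^bsub>H\<^esub> inv\<^bsub>H\<^esub> h x \<otimes>\<^bsub>H\<^esub> inv\<^bsub>H\<^esub> h y" using xy by simp
    moreover have "h x \<in> lower_central H n" using Suc xy(1) by blast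
    moreover have "h y \<in> carrier H" using xy(2) by simp
    ultimately show "z \<in> ?D" by blast
  qed
  then have "generate H (h ` ?C) \<subseteq> generate H ?D" by (rule H.mono_generate)
  then show ?case using generate_img[OF CG] by simp
qed

lemma (in group_hom) lower_central_subset_image:
  assumes surj: "carrier H \<subseteq> h ` carrier G"
  shows "lower_central H n \<subseteq> h ` lower_central G n"
proof (induction n)
  case 0
  show ?case using surj by simp
next
  case (Suc n)
  let ?C = "\<Union>x \<in> lower_central G n. \<Union>y \<in> carrier G. {x \<otimes>\<^bsub>G\<^esub> y \<otimes>\<^bsub>G\<^esub> inv\<^bsub>G\<^esub> x \<otimes>\<^bsub>G\<^esub> inv\<^bsub>G\<^esub> y}"
  let ?D = "\<Union>x \<in> lower_central H n. \<Union>y \<in> carrier H. {x \<otimes>\<^bsub>H\<^esub> y \<otimes>\<^bsub>H\<^esub> inv\<^bsub>H\<^esub> x \<otimes>\<^bsub>H\<^esub> inv\<^bsub>H\<^esub> y}"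
  have CG: "?C \<subseteq> carrier G" using G.lower_central_subset[of n] by auto
  have "?D \<subseteq> h ` ?C"
  proof
    fix z assume "z \<in> ?D"
    then obtain u v where uv: "u \<in> lower_central H n" "v \<in> carrier H"
      "z = u \<otimes>\<^bsub>H\<^esub> v \<otimes>\<^bsub>H\<^esub> inv\<^bsub>H\<^esub> u \<otimes>\<^bsub>H\<^esub> inv\<^bsub>H\<^esub> v" by blast
    obtain x where x: "x \<in> lower_central G n" "u = h x" using uv(1) Suc by blast
    obtain y where y: "y \<in> carrier G" "v = h y" using uv(2) surj by blast
    have "x \<in> carrier G" using x(1) G.lower_central_subset[of n] by blast
    then have "z = h (x \<otimes>\<^bsub>G\<^esub> y \<otimes>\<^bsub>G\<^esub> inv\<^bsub>G\<^esub> x \<otimes>\<^bsub>G\<^esub> inv\<^bsub>G\<^esub> y)" using uv(3) x(2) y by simp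
    then show "z \<in> h ` ?C" using x(1) y(1) by blast
  qed
  then have "generate H ?D \<subseteq> generate H (h ` ?C)" by (rule H.mono_generate)
  then show ?case using generate_img[OF CG] by simp
qed

lemma (in group) commutators_centralize_cyclic_factor:
  assumes A: "A \<lhd> G" and B: "B \<lhd> G" and AB: "A \<subseteq> B"
    and cyc: "cyclic_group ((G\<lparr>carrier := B\<rparr>) Mod A)"
    and x: "x \<in> B" and g: "g \<in> lower_central G 1"
  shows "x \<otimes> g \<otimes> inv x \<otimes> inv g \<in> A"
proof -
  have sB: "subgroup B G" using B by (rule normal_imp_subgroup)
  interpret B: normal B G by fact
  interpret A: normal A G by fact
  interpret q: group_hom G "G Mod A" "(#>) A" by (rule A.rcos_group_hom)
  let ?B = "G\<lparr>carrier := B\<rparr>" let ?Q = "G Mod A"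
  have AB': "A \<lhd> ?B" by (rule normal_restrict_supergroup[OF sB A AB])
  interpret AB: normal A ?B by fact
  interpret QB: group "?B Mod A" by (rule AB.factorgroup_is_group)
  obtain c where c: "c \<in> carrier (?B Mod A)" "carrier (?B Mod A) = range (\<lambda>n::int. c [^]\<^bsub>?B Mod A\<^esub> n)"
    using cyc QB.cyclic_group by blast
  obtain b where b: "b \<in> B" "c = A #> b" using c(1) by (auto simp: carrier_FactGroup)
  have bG: "b \<in> carrier G" using b(1) by (rule B.mem_carrier)
  have gen: "\<exists>k::int. A #> y = (A #> b) [^]\<^bsub>?Q\<^esub> k" if y: "y \<in> B" for y
  proof -
    have "A #> y \<in> carrier (?B Mod A)" using y by (auto simp: carrier_FactGroup)
    then obtain k :: int where k: "A #> y = c [^]\<^bsub>?B Mod A\<^esub> k" using c(2) by blast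
    have "c [^]\<^bsub>?B Mod A\<^esub> k = A #> (b [^]\<^bsub>?B\<^esub> k)" using AB.FactGroup_int_pow[of b k] b by simp
    also have "b [^]\<^bsub>?B\<^esub> k = b [^] k" using int_pow_consistent[OF sB b(1), of k] by simp
    also have "A #> (b [^] k) = (A #> b) [^]\<^bsub>?Q\<^esub> k" using A.FactGroup_int_pow[OF bG, of k] by simp
    finally show ?thesis using k by auto
  qed
  have bQ: "A #> b \<in> carrier ?Q" using q.hom_closed[OF bG] .
  have act: "\<exists>k::int. X \<otimes>\<^bsub>?Q\<^esub> (A #> b) \<otimes>\<^bsub>?Q\<^esub> inv\<^bsub>?Q\<^esub> X = (A #> b) [^]\<^bsub>?Q\<^esub> k"
    if X: "X \<in> carrier ?Q" for X
  proof -
    obtain u where u: "u \<in> carrier G" "X = A #> u" using X by (auto simp: carrier_FactGroup)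
    have "X \<otimes>\<^bsub>?Q\<^esub> (A #> b) \<otimes>\<^bsub>?Q\<^esub> inv\<^bsub>?Q\<^esub> X = A #> (u \<otimes> b \<otimes> inv u)"
      using q.hom_mult[OF u(1) bG] q.hom_mult[of "u \<otimes> b" "inv u"] q.hom_inv[OF u(1)] u bG by simp
    then show ?thesis using gen[OF B.inv_op_closed2[OF u(1) b(1)]] by simp
  qed
  have gG: "g \<in> carrier G" using g lower_central_subset[of 1] by blast
  have xG: "x \<in> carrier G" using x by (rule B.mem_carrier)
  obtain k :: int where k: "A #> x = (A #> b) [^]\<^bsub>?Q\<^esub> k" using gen[OF x] by blast
  have "A #> g \<in> lower_central ?Q 1" using q.image_lower_central_subset[of 1] g by blast
  from q.H.commutator_subgroup_centralizes_cyclic[OF bQ act this, of k]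
  have "(A #> g) \<otimes>\<^bsub>?Q\<^esub> (A #> x) \<otimes>\<^bsub>?Q\<^esub> inv\<^bsub>?Q\<^esub> (A #> g) = A #> x" by (simp only: k)
  then have "A #> (g \<otimes> x \<otimes> inv g) = A #> x"
    using q.hom_mult[OF gG xG] q.hom_mult[of "g \<otimes> x" "inv g"] q.hom_inv[OF gG] gG xG by simp
  then have "A #> (x \<otimes> inv (g \<otimes> x \<otimes> inv g)) = A"
    using coset_mult_inv2[of A x "g \<otimes> x \<otimes> inv g"] A.subset gG xG by simp
  then have "x \<otimes> inv (g \<otimes> x \<otimes> inv g) \<in> A"
    using coset_join1[OF _ _ A.subgroup_axioms] gG xG by simp
  then show ?thesis using gG xG by (simp add: word_simps)
qed

text \<open>Since commutators centralize every factor of a supersolvable series, the traces of that series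
  on the commutator subgroup form a central series.\<close>

lemma (in group) supersolvable_commutator_nilpotent:
  assumes "supersolvable_group G"
  shows "\<exists>n. lower_central (G\<lparr>carrier := lower_central G 1\<rparr>) n = {\<one>}"
proof -
  obtain n S where "S 0 = {\<one>} \<and> S n = carrier G \<and> (\<forall>i\<le>n. S i \<lhd> G) \<and>
      (\<forall>i<n. S i \<subseteq> S (Suc i) \<and> cyclic_group ((G\<lparr>carrier := S (Suc i)\<rparr>) Mod S i))"
    using assms unfolding supersolvable_group_def by (elim conjE exE) (rule that, intro conjI)
  then have S: "S 0 = {\<one>}" "S n = carrier G" "\<And>i. i \<le> n \<Longrightarrow> S i \<lhd> G"
    "\<And>i. i < n \<Longrightarrow> S i \<subseteq> S (Suc i)" "\<And>i. i < n \<Longrightarrow> cyclic_group ((G\<lparr>carrier := S (Suc i)\<rparr>) Mod S i)"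
    by simp_all
  define F where "F = lower_central G 1"
  let ?G = "G\<lparr>carrier := F\<rparr>"
  have sF: "subgroup F G" unfolding F_def using lower_central_normal by (rule normal_imp_subgroup)
  interpret F: group ?G by (rule subgroup_imp_group[OF sF])
  have LF: "lower_central ?G j \<subseteq> F" for j using F.lower_central_subset[of j] by simp
  have "lower_central ?G j \<subseteq> S (n - j)" if "j \<le> n" for j
    using that
  proof (induction j)
    case 0
    show ?case using S(2) subgroup.subset[OF sF] by simp
  next
    case (Suc j)
    define i where "i = n - Suc j"
    have i: "i < n" "n - j = Suc i" using Suc.prems by (auto simp: i_def)
    have sub: "lower_central ?G j \<subseteq> S (Suc i)" using Suc i by simp
    have sS: "subgroup (S i) G" using S(3)[of i] i normal_imp_subgroup by simp
    let ?C = "\<Union>x \<in> lower_central ?G j. \<Union>y \<in> carrier ?G. {x \<otimes>\<^bsub>?G\<^esub> y \<otimes>\<^bsub>?G\<^esub> inv\<^bsub>?G\<^esub> x \<otimes>\<^bsub>?G\<^esub> inv\<^bsub>?G\<^esub> y}"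
    have "?C \<subseteq> S i"
    proof
      fix z assume "z \<in> ?C"
      then obtain x y where xy: "x \<in> lower_central ?G j" "y \<in> F"
        "z = x \<otimes> y \<otimes> inv\<^bsub>?G\<^esub> x \<otimes> inv\<^bsub>?G\<^esub> y" by auto
      have "x \<in> F" using xy(1) LF by blast
      then have "z = x \<otimes> y \<otimes> inv x \<otimes> inv y" using xy m_inv_consistent[OF sF] by simp
      moreover have "x \<otimes> y \<otimes> inv x \<otimes> inv y \<in> S i"
        by (rule commutators_centralize_cyclic_factor[OF S(3) S(3) S(4) S(5) _ xy(2)[unfolded F_def], of i])
          (use i xy(1) sub in auto)
      ultimately show "z \<in> S i" by simp
    qed
    moreover have "?C \<subseteq> F" 
    proof (rule UN_least, rule UN_least)
      fix x y assume xy: "x \<in> lower_central ?G j" "y \<in> carrier ?G"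
      show "{x \<otimes>\<^bsub>?G\<^esub> y \<otimes>\<^bsub>?G\<^esub> inv\<^bsub>?G\<^esub> x \<otimes>\<^bsub>?G\<^esub> inv\<^bsub>?G\<^esub> y} \<subseteq> F"
        using F.commutator_in_lower_central[OF xy] LF[of "Suc j"] by blast
    qed
    ultimately have "generate G ?C \<subseteq> S i" "generate ?G ?C = generate G ?C"
      using generate_subgroup_incl[OF _ sS] generate_consistent[OF _ sF] by blast+
    then show ?case by (simp add: i_def)
  qed
  from this[OF order.refl] have "lower_central ?G n \<subseteq> {\<one>}" using S(1) by simp
  moreover have "\<one> \<in> lower_central ?G n"
    using subgroup.one_closed[OF normal_imp_subgroup[OF F.lower_central_normal[of n]]] by simp
  ultimately show ?thesis unfolding F_def by blast
qed

section \<open>Profinite groups and compactness\<close>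

context group
begin

lemma rcos_eq_iff:
  assumes "subgroup U G" "x \<in> carrier G" "y \<in> carrier G"
  shows "U #> x = U #> y \<longleftrightarrow> x \<otimes> inv y \<in> U"
proof
  assume "U #> x = U #> y"
  then have "x \<in> U #> y" using rcos_self[OF assms(2,1)] by simp
  then obtain u where "u \<in> U" "x = u \<otimes> y" by (auto simp: r_coset_def)
  then show "x \<otimes> inv y \<in> U" using assms subgroup.mem_carrier[OF assms(1)] by (simp add: word_simps)
next
  assume u: "x \<otimes> inv y \<in> U"
  have "x = (x \<otimes> inv y) \<otimes> y" using assms by (simp add: word_simps)
  then have "x \<in> U #> y" using u unfolding r_coset_def by blast
  then show "U #> x = U #> y" using repr_independence[OF _ assms(3,1)] by simp
qed

lemma rcos_eq_mono:
  assumes "subgroup U G" "subgroup V G" "U \<subseteq> V" "x \<in> carrier G" "y \<in> carrier G" "U #> x = U #> y"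
  shows "V #> x = V #> y"
  using assms rcos_eq_iff[of U x y] rcos_eq_iff[of V x y] by blast

text \<open>The two conditions on \<open>x\<close> express membership in the product of \<open>A\<close> and \<open>B\<close>.\<close>

lemma rcos_swap:
  assumes A: "A \<lhd> G" and B: "B \<lhd> G" and x: "x \<in> carrier G" and b: "b \<in> B" "A #> x = A #> b"
  shows "\<exists>a\<in>A. B #> x = B #> a"
proof -
  have sA: "subgroup A G" and sB: "subgroup B G" using A B normal_imp_subgroup by blast+
  have bG: "b \<in> carrier G" using sB b(1) by (rule subgroup.mem_carrier)
  have a: "x \<otimes> inv b \<in> A" using rcos_eq_iff[OF sA x bG] b(2) by simp
  have "x \<otimes> inv (x \<otimes> inv b) = x \<otimes> b \<otimes> inv x" using x bG by (simp add: word_simps)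
  then have "x \<otimes> inv (x \<otimes> inv b) \<in> B" using normal.inv_op_closed2[OF B x b(1)] by simp
  then have "B #> x = B #> (x \<otimes> inv b)" using rcos_eq_iff[OF sB x] x bG by simp
  then show ?thesis using a by blast
qed

end

text \<open>A profinite group together with a base of open normal subgroups. The base is kept as a parameter
  because it is taken from an inverse system, whose groups control the quotients \<open>G/U\<close>.\<close>

locale profinite_base = topological_group G T
  for G :: "('a, 'b) monoid_scheme" (structure) and T :: "'a topology" +
  fixes \<U> :: "'a set set"
  assumes compact: "compact_space T"
    and base_nonempty: "\<U> \<noteq> {}"
    and base_normal: "U \<in> \<U> \<Longrightarrow> U \<lhd> G"
    and base_open: "U \<in> \<U> \<Longrightarrow> openin T U"
    and base_directed: "U \<in> \<U> \<Longrightarrow> V \<in> \<U> \<Longrightarrow> \<exists>W\<in>\<U>. W \<subseteq> U \<inter> V"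
    and base_separating: "\<Inter>\<U> \<subseteq> {\<one>}"

lemma compact_space_directed_Inter_nonempty:
  assumes "compact_space X" "\<C> \<noteq> {}" "\<And>C. C \<in> \<C> \<Longrightarrow> closedin X C" "\<And>C. C \<in> \<C> \<Longrightarrow> C \<noteq> {}"
    and dir: "\<And>C D. C \<in> \<C> \<Longrightarrow> D \<in> \<C> \<Longrightarrow> \<exists>E\<in>\<C>. E \<subseteq> C \<inter> D"
  shows "\<Inter>\<C> \<noteq> {}"
proof -
  have fin: "\<exists>C\<in>\<C>. C \<subseteq> \<Inter>\<F>" if "finite \<F>" "\<F> \<subseteq> \<C>" for \<F>
    using that
  proof (induction \<F> rule: finite_induct)
    case empty
    then show ?case using assms(2) by auto
  next
    case (insert D \<F>)
    then obtain C where C: "C \<in> \<C>" "C \<subseteq> \<Inter>\<F>" by auto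
    moreover obtain E where "E \<in> \<C>" "E \<subseteq> C \<inter> D" using dir[OF C(1), of D] insert by auto
    ultimately show ?case by (intro bexI[of _ E]) auto
  qed
  have "\<Inter>\<F> \<noteq> {}" if F: "finite \<F>" "\<F> \<subseteq> \<C>" for \<F>
  proof -
    obtain C where "C \<in> \<C>" "C \<subseteq> \<Inter>\<F>" using fin[OF F] by blast
    then show ?thesis using assms(4)[of C] by auto
  qed
  then show ?thesis
    using assms(1,3) unfolding compact_space_fip by (elim allE[of _ \<C>]) auto
qed

context topological_group
begin

lemma continuous_map_mult:
  assumes "continuous_map X T f" "continuous_map X T g"
  shows "continuous_map X T (\<lambda>x. f x \<otimes> g x)"
  using continuous_map_compose[OF continuous_map_pairedI[OF assms] continuous_mult]
  by (simp add: o_def)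

lemma continuous_map_const_group: "a \<in> carrier G \<Longrightarrow> continuous_map X T (\<lambda>x. a)"
  by (simp add: topspace_eq)

lemma continuous_map_identity: "continuous_map T T (\<lambda>x. x)"
  using continuous_map_id by (simp add: id_def)

lemma continuous_map_conj:
  assumes "a \<in> carrier G" "b \<in> carrier G"
  shows "continuous_map T T (\<lambda>x. a \<otimes> x \<otimes> b)"
  by (intro continuous_map_mult continuous_map_const_group continuous_map_identity assms)

lemma closedin_conj_set:
  assumes "closedin T X" "g \<in> carrier G"
  shows "closedin T (conj_set G g X)"
proof -
  have X: "X \<subseteq> carrier G" using closedin_subset[OF assms(1)] topspace_eq by simp
  have "closedin T {x \<in> topspace T. inv g \<otimes> x \<otimes> g \<in> X}"
    using closedin_continuous_map_preimage[OF continuous_map_conj assms(1), of "inv g" g] assms(2) by simp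
  moreover have "{x \<in> topspace T. inv g \<otimes> x \<otimes> g \<in> X} = conj_set G g X"
    using mem_conj_set[OF X assms(2)] topspace_eq by blast
  ultimately show ?thesis by simp
qed

lemma openin_rcos:
  assumes "subgroup U G" "openin T U" "x \<in> carrier G"
  shows "openin T (U #> x)"
proof -
  have "continuous_map T T (\<lambda>y. y \<otimes> inv x)"
    using assms(3) by (intro continuous_map_mult continuous_map_const_group continuous_map_identity) simp
  then have "openin T {y \<in> topspace T. y \<otimes> inv x \<in> U}"
    using assms(2) by (rule openin_continuous_map_preimage)
  moreover have "{y \<in> topspace T. y \<otimes> inv x \<in> U} = U #> x"
  proof (intro equalityI subsetI)
    fix y assume "y \<in> {y \<in> topspace T. y \<otimes> inv x \<in> U}"
    then have y: "y \<in> carrier G" "y \<otimes> inv x \<in> U" using topspace_eq by simp_all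
    then have "y = (y \<otimes> inv x) \<otimes> x" using assms(3) by (simp add: word_simps)
    then show "y \<in> U #> x" using y(2) unfolding r_coset_def by blast
  next
    fix y assume "y \<in> U #> x"
    then obtain u where u: "u \<in> U" "y = u \<otimes> x" by (auto simp: r_coset_def)
    have "u \<in> carrier G" using assms(1) u(1) by (rule subgroup.mem_carrier)
    then show "y \<in> {y \<in> topspace T. y \<otimes> inv x \<in> U}" using u assms(3) topspace_eq by (simp add: word_simps)
  qed
  ultimately show ?thesis by simp
qed

text \<open>Any condition on the coset \<open>U #> x\<close> defines a clopen set of elements \<open>x\<close>. Most closed sets fed
  to the compactness argument are of this kind or intersections of such sets with closed subgroups.\<close>

lemma clopen_preimage_rcos:
  assumes U: "subgroup U G" "openin T U"
  shows "openin T {x \<in> carrier G. P (U #> x)}" "closedin T {x \<in> carrier G. P (U #> x)}"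
proof -
  have op: "openin T {x \<in> carrier G. Q (U #> x)}" for Q
  proof -
    have "{x \<in> carrier G. Q (U #> x)} = (\<Union>x\<in>{x \<in> carrier G. Q (U #> x)}. U #> x)"
    proof (intro equalityI subsetI)
      fix x assume "x \<in> {x \<in> carrier G. Q (U #> x)}"
      then show "x \<in> (\<Union>x\<in>{x \<in> carrier G. Q (U #> x)}. U #> x)" using rcos_self[OF _ U(1)] by blast
    next
      fix y assume "y \<in> (\<Union>x\<in>{x \<in> carrier G. Q (U #> x)}. U #> x)"
      then obtain x where x: "x \<in> carrier G" "Q (U #> x)" "y \<in> U #> x" by blast
      have "U #> x = U #> y" by (rule repr_independence[OF x(3,1) U(1)])
      moreover have "y \<in> carrier G"
        using x(3) r_coset_subset_G[OF subgroup.subset[OF U(1)] x(1)] by blast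
      ultimately show "y \<in> {x \<in> carrier G. Q (U #> x)}" using x(2) by simp
    qed
    moreover have "openin T (\<Union>x\<in>{x \<in> carrier G. Q (U #> x)}. U #> x)"
      using openin_rcos[OF U] by (intro openin_Union) auto
    ultimately show ?thesis by simp
  qed
  show "openin T {x \<in> carrier G. P (U #> x)}" by (rule op)
  have "openin T (topspace T - {x \<in> carrier G. P (U #> x)})"
  proof -
    have "topspace T - {x \<in> carrier G. P (U #> x)} = {x \<in> carrier G. \<not> P (U #> x)}"
      using topspace_eq by auto
    then show ?thesis using op[of "\<lambda>X. \<not> P X"] by simp
  qed
  then show "closedin T {x \<in> carrier G. P (U #> x)}"
    using topspace_eq by (auto simp: closedin_def)
qed

end

context profinite_base
begin

lemma base_subgroup: "U \<in> \<U> \<Longrightarrow> subgroup U G"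
  using base_normal by (rule normal_imp_subgroup)

lemma base_closed:
  assumes "U \<in> \<U>"
  shows "closedin T U"
proof -
  have "{x \<in> carrier G. U #> x = U} = U"
    using coset_join1[OF _ _ base_subgroup[OF assms]] coset_join2[OF _ base_subgroup[OF assms]]
      subgroup.mem_carrier[OF base_subgroup[OF assms]] by blast
  then show ?thesis
    using clopen_preimage_rcos(2)[OF base_subgroup[OF assms] base_open[OF assms], of "\<lambda>X. X = U"] by simp
qed

lemma finite_base_quotient:
  assumes U: "U \<in> \<U>"
  shows "finite (carrier (G Mod U))"
proof -
  have "\<forall>c\<in>rcosets U. openin T c"
    using openin_rcos[OF base_subgroup[OF U] base_open[OF U]] by (auto simp: RCOSETS_def)
  moreover have "topspace T \<subseteq> \<Union>(rcosets U)"
    using rcosets_part_G[OF base_subgroup[OF U]] topspace_eq by simp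
  ultimately obtain \<F> where F: "finite \<F>" "\<F> \<subseteq> rcosets U" "topspace T \<subseteq> \<Union>\<F>"
    using compact unfolding compact_space_alt by meson
  have "rcosets U \<subseteq> \<F>"
  proof
    fix c assume c: "c \<in> rcosets U"
    then obtain x where x: "x \<in> carrier G" "c = U #> x" by (auto simp: RCOSETS_def)
    then obtain d where d: "d \<in> \<F>" "x \<in> d" using F(3) topspace_eq by auto
    obtain y where y: "y \<in> carrier G" "d = U #> y" using d(1) F(2) by (auto simp: RCOSETS_def)
    have "d = c" using repr_independence[of x U y] d(2) y x base_subgroup[OF U] by simp
    then show "c \<in> \<F>" using d(1) by simp
  qed
  then show ?thesis using F(1) finite_subset by (simp add: FactGroup_def)
qed

text \<open>The compactness principle in the form in which it is used: a property that can be satisfied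
  modulo each \<open>U\<close>, and that becomes weaker as \<open>U\<close> grows, can be satisfied for all \<open>U\<close> at once.\<close>

lemma compact_base_Inter:
  assumes "\<And>U. U \<in> \<U> \<Longrightarrow> closedin T (C U)" "\<And>U. U \<in> \<U> \<Longrightarrow> C U \<noteq> {}"
    and "\<And>U V. U \<in> \<U> \<Longrightarrow> V \<in> \<U> \<Longrightarrow> U \<subseteq> V \<Longrightarrow> C U \<subseteq> C V"
  shows "\<exists>x. \<forall>U\<in>\<U>. x \<in> C U"
proof -
  have "\<Inter>(C ` \<U>) \<noteq> {}"
  proof (rule compact_space_directed_Inter_nonempty[OF compact])
    show "C ` \<U> \<noteq> {}" using base_nonempty by simp
    fix X Y assume "X \<in> C ` \<U>" "Y \<in> C ` \<U>"
    then obtain U V where UV: "U \<in> \<U>" "V \<in> \<U>" "X = C U" "Y = C V" by blast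
    obtain W where W: "W \<in> \<U>" "W \<subseteq> U \<inter> V" using base_directed[OF UV(1,2)] by blast
    then have "C W \<subseteq> X \<inter> Y" using assms(3)[OF W(1) UV(1)] assms(3)[OF W(1) UV(2)] UV(3,4) by blast
    then show "\<exists>E\<in>C ` \<U>. E \<subseteq> X \<inter> Y" using W(1) by blast
  qed (use assms(1,2) in auto)
  then show ?thesis by blast
qed

text \<open>The cosets \<open>U #> x\<close> shrink to \<open>x\<close>, and each of them meets \<open>X\<close>.\<close>

lemma mem_closed_if_all_rcos:
  assumes X: "closedin T X" and x: "x \<in> carrier G" "\<And>U. U \<in> \<U> \<Longrightarrow> U #> x \<in> (#>) U ` X"
  shows "x \<in> X"
proof -
  have XG: "X \<subseteq> carrier G" using closedin_subset[OF X] topspace_eq by simp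
  have "\<exists>y. \<forall>U\<in>\<U>. y \<in> X \<inter> {y \<in> carrier G. U #> y = U #> x}"
  proof (rule compact_base_Inter)
    fix U assume U: "U \<in> \<U>"
    show "closedin T (X \<inter> {y \<in> carrier G. U #> y = U #> x})"
      using X clopen_preimage_rcos(2)[OF base_subgroup[OF U] base_open[OF U], of "\<lambda>c. c = U #> x"]
      by (rule closedin_Int)
    obtain y where "y \<in> X" "U #> x = U #> y" using x(2)[OF U] by blast
    then have "y \<in> X \<inter> {y \<in> carrier G. U #> y = U #> x}" using XG by auto
    then show "X \<inter> {y \<in> carrier G. U #> y = U #> x} \<noteq> {}" by blast
    fix V assume V: "V \<in> \<U>" "U \<subseteq> V"
    show "X \<inter> {y \<in> carrier G. U #> y = U #> x} \<subseteq> X \<inter> {y \<in> carrier G. V #> y = V #> x}"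
      using rcos_eq_mono[OF base_subgroup[OF U] base_subgroup[OF V(1)] V(2) _ x(1)] by blast
  qed
  then obtain y where y: "\<And>U. U \<in> \<U> \<Longrightarrow> y \<in> X \<and> y \<in> carrier G \<and> U #> y = U #> x" by blast
  then have yX: "y \<in> X" and yG: "y \<in> carrier G" using base_nonempty by blast+
  have "y \<otimes> inv x \<in> U" if "U \<in> \<U>" for U
    using y[OF that] rcos_eq_iff[OF base_subgroup[OF that] yG x(1)] by blast
  then have "y \<otimes> inv x = \<one>" using base_separating by blast
  then have "y \<otimes> inv x \<otimes> x = x" using x(1) by simp
  then have "y = x" using x(1) yG by (simp add: word_simps)
  then show ?thesis using yX by simp
qed

lemma closed_eq_if_all_images_eq:
  assumes "closedin T X" "closedin T Y" "\<And>U. U \<in> \<U> \<Longrightarrow> (#>) U ` X = (#>) U ` Y"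
  shows "X = Y"
proof -
  have "X \<subseteq> carrier G" "Y \<subseteq> carrier G"
    using closedin_subset[OF assms(1)] closedin_subset[OF assms(2)] topspace_eq by simp_all
  then show ?thesis
    using mem_closed_if_all_rcos[OF assms(1)] mem_closed_if_all_rcos[OF assms(2)] assms(3) by blast
qed

lemma base_below_open:
  assumes W: "openin T W" "\<one> \<in> W"
  shows "\<exists>U\<in>\<U>. U \<subseteq> W"
proof (rule ccontr)
  assume neg: "\<not> ?thesis"
  have "\<exists>x. \<forall>U\<in>\<U>. x \<in> U - W"
  proof (rule compact_base_Inter)
    fix U assume U: "U \<in> \<U>"
    show "closedin T (U - W)" using base_closed[OF U] W(1) by (rule closedin_diff)
    show "U - W \<noteq> {}" using neg U by blast
  qed blast
  then obtain x where "\<And>U. U \<in> \<U> \<Longrightarrow> x \<in> U - W" by blast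
  then have "x = \<one>" "x \<notin> W" using base_separating base_nonempty by blast+
  then show False using W(2) by simp
qed

text \<open>The elements that conjugate \<open>H\<close> to \<open>K\<close> modulo \<open>U\<close> form a nonempty closed set, which shrinks
  with \<open>U\<close>.\<close>

lemma conjugate_if_all_images_conjugate:
  assumes H: "closedin T H" and K: "closedin T K"
    and conj: "\<And>U. U \<in> \<U> \<Longrightarrow> conjugate (G Mod U) ((#>) U ` H) ((#>) U ` K)"
  shows "conjugate G H K"
proof -
  have HG: "H \<subseteq> carrier G" and KG: "K \<subseteq> carrier G"
    using closedin_subset[OF H] closedin_subset[OF K] topspace_eq by simp_all
  let ?C = "\<lambda>U. {g \<in> carrier G. conj_set (G Mod U) (U #> g) ((#>) U ` H) = (#>) U ` K}"
  have img: "(#>) U ` conj_set G g H = conj_set (G Mod U) (U #> g) ((#>) U ` H)"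
    if "U \<in> \<U>" "g \<in> carrier G" for U g
    using group_hom.image_conj_set[OF normal.rcos_group_hom[OF base_normal[OF that(1)]] HG that(2)] .
  have "\<exists>g. \<forall>U\<in>\<U>. g \<in> ?C U"
  proof (rule compact_base_Inter)
    fix U assume U: "U \<in> \<U>"
    show "closedin T (?C U)"
      using clopen_preimage_rcos(2)[OF base_subgroup[OF U] base_open[OF U],
          of "\<lambda>c. conj_set (G Mod U) c ((#>) U ` H) = (#>) U ` K"] .
    show "?C U \<noteq> {}" using conj[OF U] by (auto simp: conjugate_iff carrier_FactGroup)
    fix V assume V: "V \<in> \<U>" "U \<subseteq> V"
    have le: "(#>) V ` X \<subseteq> (#>) V ` Y" if "X \<subseteq> carrier G" "Y \<subseteq> carrier G" "(#>) U ` X = (#>) U ` Y" for X Y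
    proof clarify
      fix x assume x: "x \<in> X"
      then have "U #> x \<in> (#>) U ` Y" using that(3) by blast
      then obtain y where "y \<in> Y" "U #> x = U #> y" by blast
      then have "V #> x = V #> y"
        using rcos_eq_mono[OF base_subgroup[OF U] base_subgroup[OF V(1)] V(2)] that x by blast
      then show "V #> x \<in> (#>) V ` Y" using \<open>y \<in> Y\<close> by blast
    qed
    show "?C U \<subseteq> ?C V"
    proof clarify
      fix g assume g: "g \<in> carrier G" "conj_set (G Mod U) (U #> g) ((#>) U ` H) = (#>) U ` K"
      have "(#>) U ` conj_set G g H = (#>) U ` K" using img[OF U g(1)] g(2) by simp
      then have "(#>) V ` conj_set G g H = (#>) V ` K"
        using le[OF conj_set_carrier[OF HG g(1)] KG] le[OF KG conj_set_carrier[OF HG g(1)]] by blast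
      then show "conj_set (G Mod V) (V #> g) ((#>) V ` H) = (#>) V ` K" using img[OF V(1) g(1)] by simp
    qed
  qed
  then obtain g where g: "\<And>U. U \<in> \<U> \<Longrightarrow> g \<in> ?C U" by blast
  then have gG: "g \<in> carrier G" using base_nonempty by blast
  have "conj_set G g H = K"
    by (rule closed_eq_if_all_images_eq[OF closedin_conj_set[OF H gG] K]) (use img[OF _ gG] g in auto)
  then show ?thesis using gG by (auto simp: conjugate_iff)
qed

end

section \<open>Inverse limits\<close>

lemma compact_space_inverse_limit_topology:
  assumes sys: "inverse_system I r K f" and fin: "\<And>i. i \<in> I \<Longrightarrow> finite (carrier (K i))"
  shows "compact_space (inverse_limit_topology I r K f)"
proof -
  interpret inverse_system I r K f by fact
  let ?P = "product_topology (\<lambda>i. discrete_topology (carrier (K i))) I"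
  let ?L = "carrier (inverse_limit I r K f)"
  have rI: "i \<in> I" "j \<in> I" if "(i, j) \<in> r" for i j
    using partial_order_onD(4)[OF poset] that by blast+
  have P: "compact_space ?P"
    unfolding compact_space_product_topology using fin by (simp add: compact_space_discrete_topology)
  let ?E = "\<lambda>(i, j). {x \<in> topspace ?P. f i j (x j) = x i}"
  have E: "closedin ?P (?E ij)" if ij: "ij \<in> r" for ij
  proof -
    obtain i j where ij': "ij = (i, j)" by fastforce
    then have r: "(i, j) \<in> r" using ij by simp
    have "continuous_map ?P (discrete_topology (carrier (K i))) (f i j \<circ> (\<lambda>x. x j))"
    proof (rule continuous_map_compose[OF continuous_map_product_projection[OF rI(2)[OF r]]])
      show "continuous_map (discrete_topology (carrier (K j))) (discrete_topology (carrier (K i))) (f i j)"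
        using hom[OF r] by (simp add: hom_def)
    qed
    moreover have "continuous_map ?P (discrete_topology (carrier (K i))) (\<lambda>x. x i)"
      by (rule continuous_map_product_projection[OF rI(1)[OF r]])
    ultimately have "closedin ?P {x \<in> topspace ?P. (f i j \<circ> (\<lambda>x. x j)) x = x i}"
      by (rule closedin_continuous_maps_eq[OF Hausdorff_space_discrete_topology])
    then show ?thesis using ij' by simp
  qed
  have "?L = topspace ?P \<inter> (\<Inter>ij\<in>r. ?E ij)"
    by (auto simp: inverse_limit_def)
  moreover have "closedin ?P (topspace ?P \<inter> (\<Inter>ij\<in>r. ?E ij))"
  proof (cases "r = {}")
    case False
    then have "closedin ?P (\<Inter>ij\<in>r. ?E ij)" using E by (intro closedin_INT) auto
    then show ?thesis by (intro closedin_Int closedin_topspace)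
  qed (use closedin_topspace[of ?P] in simp)
  ultimately have "closedin ?P ?L" by simp
  then show ?thesis
    unfolding inverse_limit_topology_def
    by (intro compact_space_subtopology closedin_compact_space[OF P])
qed

text \<open>The base consists of the kernels of the projections to the groups of the inverse system, so each
  \<open>G/U\<close> embeds into a group of the class \<open>C\<close>.\<close>

theorem pro_group_imp_base:
  fixes G :: "('a, 'b) monoid_scheme" (structure) and T :: "'a topology"
  assumes "pro_group C G T"
  shows "\<exists>\<U>. profinite_base G T \<U> \<and>
    (\<forall>U\<in>\<U>. \<exists>(K :: 'a set monoid) \<phi>. group_hom G K \<phi> \<and> finite (carrier K) \<and> C K \<and> kernel G K \<phi> = U)"
proof -
  obtain I :: "'a set set" and r and K :: "'a set \<Rightarrow> 'a set monoid" and f h where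
    top: "topological_group G T" and sys: "inverse_system I r K f"
    and K: "\<forall>i\<in>I. finite (carrier (K i)) \<and> C (K i)"
    and iso: "h \<in> iso G (inverse_limit I r K f)"
    and homeo: "homeomorphic_map T (inverse_limit_topology I r K f) h"
    using assms unfolding pro_group_def by (elim conjE exE) (rule that)
  interpret topological_group G T by fact
  interpret sys: inverse_system I r K f by fact
  let ?L = "inverse_limit I r K f"
  let ?P = "product_topology (\<lambda>i. discrete_topology (carrier (K i))) I"
  have hL: "h x \<in> carrier ?L" if "x \<in> carrier G" for x using iso that by (auto simp: iso_def hom_def)
  have hK: "h x i \<in> carrier (K i)" if "x \<in> carrier G" "i \<in> I" for x i
    using hL[OF that(1)] that(2) by (auto simp: inverse_limit_def)
  have hmult: "h (x \<otimes> y) = (\<lambda>i\<in>I. h x i \<otimes>\<^bsub>K i\<^esub> h y i)" if "x \<in> carrier G" "y \<in> carrier G" for x y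
    using iso that by (auto simp: iso_def hom_def inverse_limit_def)
  have hom: "group_hom G (K i) (\<lambda>x. h x i)" if i: "i \<in> I" for i
  proof (intro group_hom.intro group_hom_axioms.intro is_group sys.group[OF i] homI)
    show "h x i \<in> carrier (K i)" if "x \<in> carrier G" for x using hK[OF that i] .
    show "h (x \<otimes> y) i = h x i \<otimes>\<^bsub>K i\<^esub> h y i" if "x \<in> carrier G" "y \<in> carrier G" for x y
      using hmult[OF that] i by simp
  qed
  have compat: "f i j (h x j) = h x i" if "(i, j) \<in> r" "x \<in> carrier G" for i j x
    using hL[OF that(2)] that(1) by (auto simp: inverse_limit_def)
  define U where "U = (\<lambda>i. kernel G (K i) (\<lambda>x. h x i))"
  have U_iff: "x \<in> U i \<longleftrightarrow> x \<in> carrier G \<and> h x i = \<one>\<^bsub>K i\<^esub>" for x i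
    by (simp add: U_def kernel_def)
  have cont: "continuous_map T (discrete_topology (carrier (K i))) (\<lambda>x. h x i)" if i: "i \<in> I" for i
  proof -
    have "continuous_map T ?P h"
      using homeomorphic_imp_continuous_map[OF homeo] unfolding inverse_limit_topology_def
      by (rule continuous_map_into_fulltopology)
    then show ?thesis
      using continuous_map_compose[OF _ continuous_map_product_projection[OF i]] by (simp add: o_def)
  qed
  have "profinite_base G T (U ` I)"
  proof (intro profinite_base.intro profinite_base_axioms.intro)
    show "topological_group G T" by (rule top)
    have "compact_space (inverse_limit_topology I r K f)"
      using compact_space_inverse_limit_topology[OF sys] K by blast
    then show "compact_space T"
      using homeomorphic_compact_space[OF homeomorphic_map_imp_homeomorphic_space[OF homeo]] by simp
    show "U ` I \<noteq> {}" using sys.nonempty by simp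
    show "X \<lhd> G" if "X \<in> U ` I" for X
      using that group_hom.normal_kernel[OF hom] by (auto simp: U_def)
    show "openin T X" if X: "X \<in> U ` I" for X
    proof -
      obtain i where i: "i \<in> I" "X = U i" using X by blast
      have "openin (discrete_topology (carrier (K i))) {\<one>\<^bsub>K i\<^esub>}"
        using group.is_monoid[OF sys.group[OF i(1)]] by (simp add: monoid.one_closed)
      from openin_continuous_map_preimage[OF cont[OF i(1)] this]
      have "openin T {x \<in> topspace T. h x i \<in> {\<one>\<^bsub>K i\<^esub>}}" .
      moreover have "{x \<in> topspace T. h x i \<in> {\<one>\<^bsub>K i\<^esub>}} = U i"
        using U_iff topspace_eq by auto
      ultimately show ?thesis using i(2) by simp
    qed
    show "\<exists>W\<in>U ` I. W \<subseteq> X \<inter> Y" if XY: "X \<in> U ` I" "Y \<in> U ` I" for X Y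
    proof -
      obtain i j where ij: "i \<in> I" "j \<in> I" "X = U i" "Y = U j" using XY by blast
      obtain k where k: "k \<in> I" "(i, k) \<in> r" "(j, k) \<in> r" using sys.directed[OF ij(1,2)] by blast
      have "U k \<subseteq> U l" if l: "l \<in> I" "(l, k) \<in> r" for l
      proof
        fix x assume "x \<in> U k"
        then have x: "x \<in> carrier G" "h x k = \<one>\<^bsub>K k\<^esub>" by (simp_all add: U_iff)
        have "h x l = f l k \<one>\<^bsub>K k\<^esub>" using compat[OF l(2) x(1)] x(2) by simp
        also have "\<dots> = \<one>\<^bsub>K l\<^esub>"
          by (rule hom_one[OF sys.hom[OF l(2)] sys.group[OF k(1)] sys.group[OF l(1)]])
        finally show "x \<in> U l" using x(1) by (simp add: U_iff)
      qed
      then have "U k \<subseteq> X \<inter> Y" using ij k by simp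
      then show ?thesis using k(1) by blast
    qed
    show "\<Inter>(U ` I) \<subseteq> {\<one>}"
    proof
      fix x assume x: "x \<in> \<Inter>(U ` I)"
      then have xG: "x \<in> carrier G" using sys.nonempty by (auto simp: U_iff)
      have "h x = h \<one>"
      proof (rule extensionalityI[of _ I])
        show "h x \<in> extensional I" "h \<one> \<in> extensional I"
          using hL[OF xG] hL[OF one_closed] by (auto simp: inverse_limit_def PiE_def)
        fix i assume i: "i \<in> I"
        then have "h x i = \<one>\<^bsub>K i\<^esub>" using x by (auto simp: U_iff)
        then show "h x i = h \<one> i" using group_hom.hom_one[OF hom[OF i]] by simp
      qed
      moreover have "inj_on h (carrier G)" using iso by (simp add: iso_def bij_betw_def)
      ultimately show "x \<in> {\<one>}" using xG by (simp add: inj_on_eq_iff)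
    qed
  qed
  moreover have "\<forall>X\<in>U ` I. \<exists>(K :: 'a set monoid) \<phi>. group_hom G K \<phi> \<and> finite (carrier K) \<and> C K \<and> kernel G K \<phi> = X"
  proof
    fix X assume "X \<in> U ` I"
    then obtain i where i: "i \<in> I" "X = U i" by blast
    then have "group_hom G (K i) (\<lambda>x. h x i) \<and> finite (carrier (K i)) \<and> C (K i) \<and> kernel G (K i) (\<lambda>x. h x i) = X"
      using hom[OF i(1)] K by (simp add: U_def)
    then show "\<exists>(K :: 'a set monoid) \<phi>. group_hom G K \<phi> \<and> finite (carrier K) \<and> C K \<and> kernel G K \<phi> = X" by blast
  qed
  ultimately show ?thesis by blast
qed

text \<open>This is what is used of a group that is an inverse limit on its own account, such as \<open>N\<close>, \<open>G/N\<close>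
  or a Sylow subgroup: its topology comes from \<open>G\<close>, but its inverse system is unrelated to
  the base chosen in \<open>G\<close>. The kernel of \<open>\<phi>\<close> is small in the topology of \<open>G\<close>, and \<open>\<phi>\<close> takes values
  in a group of the class.\<close>

lemma pro_group_hom_below_open:
  fixes G :: "('a, 'b) monoid_scheme" and T :: "'a topology"
  assumes "pro_group C G T" "openin T W" "\<one>\<^bsub>G\<^esub> \<in> W"
  shows "\<exists>(K :: 'a set monoid) \<phi>. group_hom G K \<phi> \<and> finite (carrier K) \<and> C K \<and> kernel G K \<phi> \<subseteq> W"
proof -
  obtain \<U> where base: "profinite_base G T \<U>" and K: "\<And>U. U \<in> \<U> \<Longrightarrow>
    \<exists>(K :: 'a set monoid) \<phi>. group_hom G K \<phi> \<and> finite (carrier K) \<and> C K \<and> kernel G K \<phi> = U"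
    using pro_group_imp_base[OF assms(1)] by blast
  obtain U where "U \<in> \<U>" "U \<subseteq> W" using profinite_base.base_below_open[OF base assms(2,3)] by blast
  then show ?thesis using K[of U] by blast
qed

lemma (in topological_group) topological_group_subgroup:
  assumes "subgroup H G"
  shows "topological_group (G\<lparr>carrier := H\<rparr>) (subtopology T H)"
proof -
  have HG: "H \<subseteq> carrier G" using assms by (rule subgroup.subset)
  interpret H: group "G\<lparr>carrier := H\<rparr>" using assms by (rule subgroup_imp_group)
  have ts: "topspace (subtopology T H) = H" using HG topspace_eq by auto
  show ?thesis
  proof (intro topological_group.intro topological_group_axioms.intro H.is_group)
    show "topspace (subtopology T H) = carrier (G\<lparr>carrier := H\<rparr>)" using ts by simp
    have "continuous_map (prod_topology (subtopology T H) (subtopology T H)) T (\<lambda>(x, y). x \<otimes> y)"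
      unfolding prod_topology_subtopology by (intro continuous_map_from_subtopology continuous_mult)
    moreover have "(\<lambda>(x, y). x \<otimes> y) \<in> topspace (prod_topology (subtopology T H) (subtopology T H)) \<rightarrow> H"
      unfolding topspace_prod_topology ts using subgroup.m_closed[OF assms] by auto
    ultimately show "continuous_map (prod_topology (subtopology T H) (subtopology T H)) (subtopology T H)
        (\<lambda>(x, y). x \<otimes>\<^bsub>G\<lparr>carrier := H\<rparr>\<^esub> y)"
      by (simp add: continuous_map_in_subtopology)
    have "continuous_map (subtopology T H) (subtopology T H) (\<lambda>x. inv x)"
      unfolding continuous_map_in_subtopology ts
      using continuous_map_from_subtopology[OF continuous_inv] subgroup.m_inv_closed[OF assms] by auto
    then show "continuous_map (subtopology T H) (subtopology T H) (\<lambda>x. inv\<^bsub>G\<lparr>carrier := H\<rparr>\<^esub> x)"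
      by (rule continuous_map_eq) (use ts m_inv_consistent[OF assms] in simp)
  qed
qed

lemma (in profinite_base) profinite_base_closed_subgroup:
  assumes H: "closed_subgroup G T H"
  shows "profinite_base (G\<lparr>carrier := H\<rparr>) (subtopology T H) ((\<lambda>U. U \<inter> H) ` \<U>)"
proof -
  have sH: "subgroup H G" and cH: "closedin T H" using H by (simp_all add: closed_subgroup_def)
  show ?thesis
  proof (intro profinite_base.intro profinite_base_axioms.intro topological_group_subgroup[OF sH])
    show "compact_space (subtopology T H)"
      by (intro compact_space_subtopology closedin_compact_space[OF compact cH])
    show "(\<lambda>U. U \<inter> H) ` \<U> \<noteq> {}" using base_nonempty by simp
    show "X \<lhd> G\<lparr>carrier := H\<rparr>" if "X \<in> (\<lambda>U. U \<inter> H) ` \<U>" for X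
      using that normal_Int_subgroup[OF sH base_normal] by auto
    show "openin (subtopology T H) X" if "X \<in> (\<lambda>U. U \<inter> H) ` \<U>" for X
      using that base_open by (auto simp: openin_subtopology)
    show "\<exists>W\<in>(\<lambda>U. U \<inter> H) ` \<U>. W \<subseteq> X \<inter> Y"
      if XY: "X \<in> (\<lambda>U. U \<inter> H) ` \<U>" "Y \<in> (\<lambda>U. U \<inter> H) ` \<U>" for X Y
    proof -
      obtain U V where UV: "U \<in> \<U>" "V \<in> \<U>" "X = U \<inter> H" "Y = V \<inter> H" using XY by blast
      obtain W where W: "W \<in> \<U>" "W \<subseteq> U \<inter> V" using base_directed[OF UV(1,2)] by blast
      show ?thesis
      proof (rule bexI)
        show "W \<inter> H \<subseteq> X \<inter> Y" using W(2) UV(3,4) by auto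
        show "W \<inter> H \<in> (\<lambda>U. U \<inter> H) ` \<U>" using W(1) by (rule imageI)
      qed
    qed
    show "\<Inter>((\<lambda>U. U \<inter> H) ` \<U>) \<subseteq> {\<one>\<^bsub>G\<lparr>carrier := H\<rparr>\<^esub>}"
    proof -
      have "\<Inter>((\<lambda>U. U \<inter> H) ` \<U>) \<subseteq> \<Inter>\<U>" by (intro Inter_greatest) auto
      then show ?thesis using base_separating by simp
    qed
  qed
qed

text \<open>The inverse system of the quotients \<open>G/U\<close>, indexed by the base under reverse inclusion. The
  canonical map is onto by compactness, and a continuous bijection from a compact space to a
  Hausdorff space is a homeomorphism.\<close>

theorem (in profinite_base) pro_groupI:
  assumes C: "\<And>U. U \<in> \<U> \<Longrightarrow> C (G Mod U)"
  shows "pro_group C G T"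
proof -
  define r where "r = {(U, V). U \<in> \<U> \<and> V \<in> \<U> \<and> V \<subseteq> U}"
  define K where "K = (\<lambda>U. G Mod U)"
  define f where "f = (\<lambda>U (V :: 'a set) X. U <#> X)"
  define h where "h = (\<lambda>x. \<lambda>U\<in>\<U>. U #> x)"
  have absorb: "U <#> (V #> x) = U #> x" if "U \<in> \<U>" "V \<in> \<U>" "V \<subseteq> U" "x \<in> carrier G" for U V x
  proof -
    note s = base_subgroup[OF that(1)] base_subgroup[OF that(2)]
    have "U <#> (V #> x) = (U <#> V) #> x"
      using setmult_rcos_assoc[OF subgroup.subset[OF s(1)] subgroup.subset[OF s(2)] that(4)] .
    then show ?thesis using set_mult_absorb(2)[OF s that(3)] by simp
  qed
  have carr: "\<exists>x\<in>carrier G. X = U #> x" if "X \<in> carrier (G Mod U)" for U X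
    using that by (auto simp: carrier_FactGroup)
  have sys: "inverse_system \<U> r K f"
  proof (rule inverse_system.intro)
    show "\<U> \<noteq> {}" by (rule base_nonempty)
    show "partial_order_on \<U> r"
      by (auto simp: r_def partial_order_on_def preorder_on_def refl_on_def trans_def antisym_def)
    show "\<exists>k\<in>\<U>. (i, k) \<in> r \<and> (j, k) \<in> r" if "i \<in> \<U>" "j \<in> \<U>" for i j
      using base_directed[OF that] that by (auto simp: r_def)
    show "group (K i)" if "i \<in> \<U>" for i
      unfolding K_def by (rule normal.factorgroup_is_group[OF base_normal[OF that]])
    show "f i j \<in> hom (K j) (K i)" if ij: "(i, j) \<in> r" for i j
    proof -
      have ij': "i \<in> \<U>" "j \<in> \<U>" "j \<subseteq> i" using ij by (simp_all add: r_def)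
      interpret i: normal i G by (rule base_normal[OF ij'(1)])
      interpret j: normal j G by (rule base_normal[OF ij'(2)])
      show ?thesis
      proof (rule homI)
        fix X assume "X \<in> carrier (K j)"
        then obtain x where x: "x \<in> carrier G" "X = j #> x" using carr by (auto simp: K_def)
        then show "f i j X \<in> carrier (K i)"
          using absorb[OF ij' x(1)] by (simp add: f_def K_def carrier_FactGroup)
        fix Y assume "Y \<in> carrier (K j)"
        then obtain y where y: "y \<in> carrier G" "Y = j #> y" using carr by (auto simp: K_def)
        have "f i j (j #> (x \<otimes> y)) = (i #> x) <#> (i #> y)"
          using absorb[OF ij' m_closed[OF x(1) y(1)]] i.rcos_sum[OF x(1) y(1)] by (simp add: f_def)
        then show "f i j (X \<otimes>\<^bsub>K j\<^esub> Y) = f i j X \<otimes>\<^bsub>K i\<^esub> f i j Y"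
          using x y j.rcos_sum[OF x(1) y(1)] absorb[OF ij'] by (simp add: f_def K_def)
      qed
    qed
    show "f i i x = x" if "i \<in> \<U>" "x \<in> carrier (K i)" for i x
      using that carr[of x i] absorb[OF that(1) that(1)] by (auto simp: f_def K_def)
    show "f i j (f j k x) = f i k x" if ijk: "(i, j) \<in> r" "(j, k) \<in> r" "x \<in> carrier (K k)" for i j k x
    proof -
      have m: "i \<in> \<U>" "j \<in> \<U>" "k \<in> \<U>" "j \<subseteq> i" "k \<subseteq> j" using ijk by (simp_all add: r_def)
      obtain y where y: "y \<in> carrier G" "x = k #> y" using carr ijk(3) by (auto simp: K_def)
      show ?thesis
        using absorb[OF m(2,3,5) y(1)] absorb[OF m(1,2,4) y(1)] absorb[OF m(1,3) _ y(1)] m(4,5) y(2)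
        by (simp add: f_def)
    qed
  qed
  let ?L = "inverse_limit \<U> r K f"
  have hL: "h x \<in> carrier ?L" if "x \<in> carrier G" for x
    using that absorb by (auto simp: inverse_limit_def h_def K_def f_def r_def carrier_FactGroup)
  have inj: "inj_on h (carrier G)"
  proof (rule inj_onI)
    fix x y assume xy: "x \<in> carrier G" "y \<in> carrier G" "h x = h y"
    have "x \<otimes> inv y \<in> U" if U: "U \<in> \<U>" for U
    proof -
      have "h x U = h y U" using xy(3) by simp
      then have "U #> x = U #> y" using U by (simp add: h_def)
      then show ?thesis using rcos_eq_iff[OF base_subgroup[OF U] xy(1,2)] by simp
    qed
    then have "x \<otimes> inv y = \<one>" using base_separating by blast
    then have "x \<otimes> inv y \<otimes> y = y" using xy by simp
    then show "x = y" using xy by (simp add: word_simps)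
  qed
  have surj: "z \<in> h ` carrier G" if z: "z \<in> carrier ?L" for z
  proof -
    have zU: "z U \<in> carrier (G Mod U)" if "U \<in> \<U>" for U
      using z that by (auto simp: inverse_limit_def K_def)
    have ext: "z \<in> extensional \<U>" using z by (auto simp: inverse_limit_def PiE_def)
    have compat: "U <#> z V = z U" if "U \<in> \<U>" "V \<in> \<U>" "V \<subseteq> U" for U V
      using z that by (auto simp: inverse_limit_def f_def r_def)
    have "\<exists>x. \<forall>U\<in>\<U>. x \<in> {x \<in> carrier G. U #> x = z U}"
    proof (rule compact_base_Inter)
      fix U assume U: "U \<in> \<U>"
      show "closedin T {x \<in> carrier G. U #> x = z U}"
        using clopen_preimage_rcos(2)[OF base_subgroup[OF U] base_open[OF U], of "\<lambda>c. c = z U"] .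
      show "{x \<in> carrier G. U #> x = z U} \<noteq> {}" using carr[OF zU[OF U]] by auto
      fix V assume V: "V \<in> \<U>" "U \<subseteq> V"
      show "{x \<in> carrier G. U #> x = z U} \<subseteq> {x \<in> carrier G. V #> x = z V}"
      proof clarify
        fix x assume x: "x \<in> carrier G" "U #> x = z U"
        then show "V #> x = z V" using absorb[OF V(1) U V(2) x(1)] compat[OF V(1) U V(2)] by simp
      qed
    qed
    then obtain x where x: "\<And>U. U \<in> \<U> \<Longrightarrow> x \<in> carrier G \<and> U #> x = z U" by blast
    then have xG: "x \<in> carrier G" using base_nonempty by blast
    have "z = h x"
      by (rule extensionalityI[OF ext]) (use x in \<open>simp_all add: h_def\<close>)
    then show ?thesis using xG by blast
  qed
  have img: "h ` carrier G = carrier ?L" using hL surj by blast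
  have "h \<in> iso G ?L"
  proof (rule isoI)
    show "h \<in> hom G ?L"
    proof (rule homI)
      show "h x \<in> carrier ?L" if "x \<in> carrier G" for x using hL[OF that] .
      fix x y assume "x \<in> carrier G" "y \<in> carrier G"
      then have "U #> (x \<otimes> y) = (U #> x) <#> (U #> y)" if "U \<in> \<U>" for U
        using normal.rcos_sum[OF base_normal[OF that]] by simp
      then show "h (x \<otimes> y) = h x \<otimes>\<^bsub>?L\<^esub> h y"
        by (auto simp: h_def inverse_limit_def K_def intro!: restrict_ext)
    qed
    show "bij_betw h (carrier G) (carrier ?L)" using inj img by (simp add: bij_betw_def)
  qed
  moreover have "homeomorphic_map T (inverse_limit_topology \<U> r K f) h"
  proof (rule continuous_imp_homeomorphic_map[OF _ compact])
    let ?P = "product_topology (\<lambda>U. discrete_topology (carrier (K U))) \<U>"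
    have sub: "carrier ?L \<subseteq> topspace ?P" by (auto simp: inverse_limit_def)
    have ts: "topspace (inverse_limit_topology \<U> r K f) = carrier ?L"
      using sub by (auto simp: inverse_limit_topology_def)
    show "Hausdorff_space (inverse_limit_topology \<U> r K f)"
      unfolding inverse_limit_topology_def
      by (intro Hausdorff_space_subtopology) (simp add: Hausdorff_space_product_topology)
    show "h ` topspace T = topspace (inverse_limit_topology \<U> r K f)" using img ts topspace_eq by simp
    show "inj_on h (topspace T)" using inj topspace_eq by simp
    have "continuous_map T ?P h"
      unfolding continuous_map_componentwise
    proof (intro conjI ballI)
      show "h ` topspace T \<subseteq> extensional \<U>" by (auto simp: h_def)
      fix U assume U: "U \<in> \<U>"
      show "continuous_map T (discrete_topology (carrier (K U))) (\<lambda>x. h x U)"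
        unfolding continuous_map_def
      proof (intro conjI allI impI)
        show "(\<lambda>x. h x U) \<in> topspace T \<rightarrow> topspace (discrete_topology (carrier (K U)))"
          using U topspace_eq by (auto simp: h_def K_def carrier_FactGroup)
        fix X
        show "openin T {x \<in> topspace T. h x U \<in> X}"
          using clopen_preimage_rcos(1)[OF base_subgroup[OF U] base_open[OF U], of "\<lambda>c. c \<in> X"] U topspace_eq
          by (simp add: h_def)
      qed
    qed
    then show "continuous_map T (inverse_limit_topology \<U> r K f) h"
      using hL topspace_eq by (auto simp: inverse_limit_topology_def continuous_map_in_subtopology)
  qed
  moreover have "\<forall>i\<in>\<U>. finite (carrier (K i)) \<and> C (K i)"
    using finite_base_quotient C by (simp add: K_def)
  ultimately show ?thesis
    using sys topological_group_axioms unfolding pro_group_def by blast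
qed

section \<open>Sylow subgroups of profinite groups\<close>

text \<open>If \<open>\<psi>\<close> factors through \<open>\<phi>\<close>, the induced map from the image of \<open>\<phi>\<close> to that of \<open>\<psi>\<close> is a
  homomorphism whose kernel is the image of the kernel of \<open>\<psi>\<close>. Only the orders of the images occur
  here, so the lemma also serves for infinite groups with finite quotients.\<close>

lemma card_image_factor:
  assumes \<phi>: "group_hom A K \<phi>" and \<psi>: "group_hom A L \<psi>" and ker: "kernel A K \<phi> \<subseteq> kernel A L \<psi>"
  shows "card (\<phi> ` carrier A) = card (\<psi> ` carrier A) * card (\<phi> ` kernel A L \<psi>)"
proof -
  interpret \<phi>: group_hom A K \<phi> by fact
  interpret \<psi>: group_hom A L \<psi> by fact
  let ?I = "\<phi> ` carrier A"
  let ?K = "K\<lparr>carrier := ?I\<rparr>"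
  define \<theta> where "\<theta> = (\<lambda>k. \<psi> (inv_into (carrier A) \<phi> k))"
  have eq: "\<psi> x = \<psi> y" if xy: "x \<in> carrier A" "y \<in> carrier A" "\<phi> x = \<phi> y" for x y
  proof -
    have "\<phi> (x \<otimes>\<^bsub>A\<^esub> inv\<^bsub>A\<^esub> y) = \<one>\<^bsub>K\<^esub>" using xy by simp
    then have "x \<otimes>\<^bsub>A\<^esub> inv\<^bsub>A\<^esub> y \<in> kernel A K \<phi>" using xy by (simp add: kernel_def)
    then have "x \<otimes>\<^bsub>A\<^esub> inv\<^bsub>A\<^esub> y \<in> kernel A L \<psi>" using ker by blast
    then have "\<psi> x \<otimes>\<^bsub>L\<^esub> inv\<^bsub>L\<^esub> \<psi> y = \<one>\<^bsub>L\<^esub>" using xy by (simp add: kernel_def)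
    then have "\<psi> x \<otimes>\<^bsub>L\<^esub> inv\<^bsub>L\<^esub> \<psi> y \<otimes>\<^bsub>L\<^esub> \<psi> y = \<psi> y" using xy by simp
    then show ?thesis using xy by (simp add: \<psi>.H.m_assoc)
  qed
  have \<theta>: "\<theta> (\<phi> x) = \<psi> x" if "x \<in> carrier A" for x
  proof -
    have "\<phi> x \<in> ?I" using that by simp
    note i = inv_into_into[OF this] f_inv_into_f[OF this]
    show ?thesis unfolding \<theta>_def by (rule eq[OF i(1) that i(2)])
  qed
  have sI: "subgroup ?I K" using \<phi>.subgroup_img_is_subgroup[OF \<phi>.G.subgroup_self] .
  interpret KI: group ?K by (rule \<phi>.H.subgroup_imp_group[OF sI])
  interpret \<theta>: group_hom ?K L \<theta>
  proof (intro group_hom.intro group_hom_axioms.intro KI.is_group \<psi>.H.is_group homI)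
    fix x assume "x \<in> carrier ?K"
    then obtain a where a: "a \<in> carrier A" "x = \<phi> a" by auto
    then show "\<theta> x \<in> carrier L" using \<theta> by simp
    fix y assume "y \<in> carrier ?K"
    then obtain b where b: "b \<in> carrier A" "y = \<phi> b" by auto
    have "\<theta> (\<phi> (a \<otimes>\<^bsub>A\<^esub> b)) = \<psi> a \<otimes>\<^bsub>L\<^esub> \<psi> b" using \<theta>[of "a \<otimes>\<^bsub>A\<^esub> b"] a b by simp
    then show "\<theta> (x \<otimes>\<^bsub>?K\<^esub> y) = \<theta> x \<otimes>\<^bsub>L\<^esub> \<theta> y" using \<theta> a b by simp
  qed
  have "card (carrier ?K) = card (\<theta> ` carrier ?K) * card (carrier ?K \<inter> kernel ?K L \<theta>)"
    by (rule \<theta>.card_image_mult_kernel[OF KI.subgroup_self])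
  moreover have "\<theta> ` carrier ?K = \<psi> ` carrier A" using \<theta> by (auto simp: image_image)
  moreover have "carrier ?K \<inter> kernel ?K L \<theta> = \<phi> ` kernel A L \<psi>"
    using \<theta> by (auto simp: kernel_def)
  ultimately show ?thesis by simp
qed

lemma (in group) card_image_rcos_factor:
  assumes W: "W \<lhd> G" and V: "V \<lhd> G" and WV: "W \<subseteq> V" and Y: "subgroup Y G"
  shows "card ((#>) W ` Y) = card ((#>) V ` Y) * card ((#>) W ` (Y \<inter> V))"
proof -
  let ?Y = "G\<lparr>carrier := Y\<rparr>"
  interpret W: normal W G by fact
  interpret V: normal V G by fact
  have ind: "group_hom ?Y (G Mod W) ((#>) W)" "group_hom ?Y (G Mod V) ((#>) V)"
    using group_hom.induced_group_hom'[OF W.rcos_group_hom Y] group_hom.induced_group_hom'[OF V.rcos_group_hom Y] .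
  have ker: "kernel ?Y (G Mod W) ((#>) W) = Y \<inter> W" "kernel ?Y (G Mod V) ((#>) V) = Y \<inter> V"
    using W.kernel_rcos V.kernel_rcos subgroup.subset[OF Y] by (auto simp: kernel_def)
  have "Y \<inter> W \<subseteq> Y \<inter> V" using WV by blast
  then show ?thesis using card_image_factor[OF ind, unfolded ker] by simp
qed

lemma (in group) pro_p_subgroup_of_subgroup:
  assumes H: "closed_subgroup G T H"
  shows "pro_p_subgroup p (G\<lparr>carrier := H\<rparr>) (subtopology T H) P \<longleftrightarrow> pro_p_subgroup p G T P \<and> P \<subseteq> H"
proof -
  have sH: "subgroup H G" and cH: "closedin T H" using H by (simp_all add: closed_subgroup_def)
  have "subgroup P (G\<lparr>carrier := H\<rparr>) \<longleftrightarrow> subgroup P G \<and> P \<subseteq> H"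
    using incl_subgroup[OF sH] subgroup_incl[OF _ sH] subgroup.subset[of P "G\<lparr>carrier := H\<rparr>"] by auto
  moreover have "closedin (subtopology T H) P \<longleftrightarrow> closedin T P \<and> P \<subseteq> H"
    using closedin_closed_subtopology[OF cH] .
  moreover have "subtopology (subtopology T H) P = subtopology T P" if "P \<subseteq> H"
    using that by (simp add: subtopology_subtopology Int_absorb1)
  ultimately show ?thesis by (auto simp: pro_p_subgroup_def closed_subgroup_def)
qed

context profinite_base
begin

lemma image_rcos_subgroup:
  assumes "U \<in> \<U>" "subgroup X G"
  shows "subgroup ((#>) U ` X) (G Mod U)"
  using group_hom.subgroup_img_is_subgroup[OF normal.rcos_group_hom[OF base_normal[OF assms(1)]] assms(2)] .

lemma group_base_quotient: "U \<in> \<U> \<Longrightarrow> group (G Mod U)"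
  by (rule normal.factorgroup_is_group[OF base_normal])

lemma finite_image_rcos:
  assumes "U \<in> \<U>" "X \<subseteq> carrier G"
  shows "finite ((#>) U ` X)"
proof (rule finite_subset[OF _ finite_base_quotient[OF assms(1)]])
  show "(#>) U ` X \<subseteq> carrier (G Mod U)" using assms(2) by (auto simp: carrier_FactGroup)
qed

text \<open>For a homomorphism \<open>\<phi>\<close> from \<open>P\<close> to a finite \<open>p\<close>-group with kernel inside \<open>U\<close>, the
  image of \<open>P\<close> in \<open>G/U\<close> is a quotient of its image under \<open>\<phi>\<close>.\<close>

lemma pro_p_subgroup_image:
  assumes P: "pro_p_subgroup p G T P" and p: "prime p" and U: "U \<in> \<U>"
  shows "\<exists>k. card ((#>) U ` P) = p ^ k"
proof -
  have sP: "subgroup P G" and pro: "pro_p p (G\<lparr>carrier := P\<rparr>) (subtopology T P)"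
    using P by (simp_all add: pro_p_subgroup_def closed_subgroup_def)
  let ?P = "G\<lparr>carrier := P\<rparr>"
  interpret U: normal U G by (rule base_normal[OF U])
  have "openin (subtopology T P) (U \<inter> P)" using base_open[OF U] by (auto simp: openin_subtopology)
  moreover have "\<one>\<^bsub>?P\<^esub> \<in> U \<inter> P" using subgroup.one_closed[OF sP] U.one_closed by simp
  ultimately have "\<exists>(K :: 'a set monoid) \<phi>. group_hom ?P K \<phi> \<and> finite (carrier K) \<and> finite_p_group p K \<and> kernel ?P K \<phi> \<subseteq> U \<inter> P"
    by (rule pro_group_hom_below_open[OF pro[unfolded pro_p_def]])
  then obtain K :: "'a set monoid" and \<phi> where \<phi>: "group_hom ?P K \<phi>" and K: "finite_p_group p K"
    and ker: "kernel ?P K \<phi> \<subseteq> U \<inter> P"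
    by (elim exE conjE) (rule that)
  interpret \<phi>: group_hom ?P K \<phi> by fact
  obtain k where k: "order K = p ^ k" using K by (auto simp: finite_p_group_def)
  have ind: "group_hom ?P (G Mod U) ((#>) U)"
    using group_hom.induced_group_hom'[OF U.rcos_group_hom sP] .
  have "kernel ?P (G Mod U) ((#>) U) = U \<inter> P"
    using U.kernel_rcos subgroup.subset[OF sP] by (auto simp: kernel_def)
  then have "card (\<phi> ` P) = card ((#>) U ` P) * card (\<phi> ` (U \<inter> P))"
    using card_image_factor[OF \<phi> ind] ker by simp
  then have "card ((#>) U ` P) dvd card (\<phi> ` P)" by simp
  also have "card (\<phi> ` P) dvd p ^ k"
  proof -
    have s: "subgroup (\<phi> ` P) K" using \<phi>.subgroup_img_is_subgroup[OF \<phi>.G.subgroup_self] by simp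
    show ?thesis
      using \<phi>.H.card_subgroup_dvd[OF s \<phi>.H.subgroup_self subgroup.subset[OF s]] k by (simp add: order_def)
  qed
  finally show ?thesis using divides_primepow_nat[OF p] by auto
qed

lemma pro_p_subgroupI:
  assumes Q: "closed_subgroup G T Q" and k: "\<And>U. U \<in> \<U> \<Longrightarrow> \<exists>k. card ((#>) U ` Q) = p ^ k"
  shows "pro_p_subgroup p G T Q"
proof -
  have sQ: "subgroup Q G" using Q by (simp add: closed_subgroup_def)
  let ?Q = "G\<lparr>carrier := Q\<rparr>"
  interpret Q: profinite_base ?Q "subtopology T Q" "(\<lambda>U. U \<inter> Q) ` \<U>"
    by (rule profinite_base_closed_subgroup[OF Q])
  have "pro_group (finite_p_group p) ?Q (subtopology T Q)"
  proof (rule Q.pro_groupI)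
    fix X assume X: "X \<in> (\<lambda>U. U \<inter> Q) ` \<U>"
    then obtain U where U: "U \<in> \<U>" "X = U \<inter> Q" by blast
    interpret U: normal U G by (rule base_normal[OF U(1)])
    interpret X: normal X ?Q by (rule Q.base_normal[OF X])
    have ind: "group_hom ?Q (G Mod U) ((#>) U)"
      using group_hom.induced_group_hom'[OF U.rcos_group_hom sQ] .
    have kerU: "kernel ?Q (G Mod U) ((#>) U) = X"
      using U.kernel_rcos subgroup.subset[OF sQ] U(2) by (auto simp: kernel_def)
    have "card ((#>) U ` Q) = card ((#>\<^bsub>?Q\<^esub>) X ` Q) * card ((#>) U ` X)"
      using card_image_factor[OF ind X.rcos_group_hom, unfolded kerU X.kernel_rcos] by simp
    moreover have "card ((#>\<^bsub>?Q\<^esub>) X ` Q) = card ((#>) U ` Q) * card ((#>\<^bsub>?Q\<^esub>) X ` X)"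
      using card_image_factor[OF X.rcos_group_hom ind, unfolded kerU X.kernel_rcos] by simp
    ultimately have "card ((#>\<^bsub>?Q\<^esub>) X ` Q) dvd card ((#>) U ` Q)" "card ((#>) U ` Q) dvd card ((#>\<^bsub>?Q\<^esub>) X ` Q)"
      by (metis dvd_triv_left)+
    then have "card ((#>\<^bsub>?Q\<^esub>) X ` Q) = card ((#>) U ` Q)" by (simp add: dvd_antisym)
    then have "\<exists>k. order (?Q Mod X) = p ^ k" using k[OF U(1)] by (simp add: order_def carrier_FactGroup)
    then show "finite_p_group p (?Q Mod X)"
      using X.factorgroup_is_group Q.finite_base_quotient[OF X] by (simp add: finite_p_group_def)
  qed
  then show ?thesis using Q by (simp add: pro_p_subgroup_def pro_p_def)
qed

lemma closed_subgroup_preimage: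
  assumes U: "U \<in> \<U>" and Y: "closed_subgroup G T Y" and Z: "subgroup Z (G Mod U)"
  shows "closed_subgroup G T (Y \<inter> {y \<in> carrier G. U #> y \<in> Z})"
proof -
  interpret U: normal U G by (rule base_normal[OF U])
  interpret q: group_hom G "G Mod U" "(#>) U" by (rule U.rcos_group_hom)
  have "subgroup {y \<in> carrier G. U #> y \<in> Z} G"
  proof (rule subgroupI)
    show "{y \<in> carrier G. U #> y \<in> Z} \<noteq> {}" using subgroup.one_closed[OF Z] q.hom_one by force
    fix a assume "a \<in> {y \<in> carrier G. U #> y \<in> Z}"
    then have a: "a \<in> carrier G" "U #> a \<in> Z" by simp_all
    then show "inv a \<in> {y \<in> carrier G. U #> y \<in> Z}"
      using subgroup.m_inv_closed[OF Z a(2)] q.hom_inv[OF a(1)] by simp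
    fix b assume "b \<in> {y \<in> carrier G. U #> y \<in> Z}"
    then have b: "b \<in> carrier G" "U #> b \<in> Z" by simp_all
    then show "a \<otimes> b \<in> {y \<in> carrier G. U #> y \<in> Z}"
      using subgroup.m_closed[OF Z a(2) b(2)] q.hom_mult[OF a(1) b(1)] a(1) by simp
  qed auto
  moreover have "closedin T {y \<in> carrier G. U #> y \<in> Z}"
    by (rule clopen_preimage_rcos(2)[OF base_subgroup[OF U] base_open[OF U], of "\<lambda>c. c \<in> Z"])
  ultimately show ?thesis
    using Y by (simp add: closed_subgroup_def subgroups_Inter_pair closedin_Int)
qed

text \<open>An index prime to \<open>p\<close> is passed from \<open>G/U\<close> to \<open>G/V\<close> through a common refinement \<open>W\<close>: it is kept on
  the way up to \<open>G/W\<close>, since \<open>Y1\<close> contains the part of \<open>Y\<close> in \<open>U\<close>, and on the way down to \<open>G/V\<close>,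
  since indices of images divide indices.\<close>

lemma valn_image_transfer:
  assumes p: "prime p" and U: "U \<in> \<U>" and V: "V \<in> \<U>"
    and Y: "subgroup Y G" and Y1: "subgroup Y1 G" "Y1 \<subseteq> Y" "Y \<inter> U \<subseteq> Y1"
    and val: "valn p ((#>) U ` Y) \<le> valn p ((#>) U ` Y1)"
  shows "valn p ((#>) V ` Y) \<le> valn p ((#>) V ` Y1)"
proof -
  obtain W where W: "W \<in> \<U>" "W \<subseteq> U" "W \<subseteq> V" using base_directed[OF U V] by auto
  note nor = base_normal[OF W(1)] base_normal[OF U] base_normal[OF V]
  have nz: "card ((#>) X ` S) \<noteq> 0" if "X \<in> \<U>" "subgroup S G" for X S
    using finite_image_rcos[OF that(1) subgroup.subset[OF that(2)]] subgroup.one_closed[OF that(2)] by auto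
  have split: "valn p ((#>) W ` S) = valn p ((#>) X ` S) + valn p ((#>) W ` (S \<inter> X))"
    if X: "X \<in> \<U>" "W \<subseteq> X" and S: "subgroup S G" for X S
  proof -
    have c: "card ((#>) W ` S) = card ((#>) X ` S) * card ((#>) W ` (S \<inter> X))"
      by (rule card_image_rcos_factor[OF nor(1) base_normal[OF X(1)] X(2) S])
    show ?thesis
      unfolding c using nz[OF X(1) S] nz[OF W(1) subgroups_Inter_pair[OF S base_subgroup[OF X(1)]]] p
      by (intro prime_elem_multiplicity_mult_distrib) simp_all
  qed
  have "Y1 \<inter> U = Y \<inter> U" using Y1(2,3) by blast
  then have "valn p ((#>) W ` Y) \<le> valn p ((#>) W ` Y1)"
    using split[OF U W(2) Y] split[OF U W(2) Y1(1)] val by simp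
  moreover have "valn p ((#>) W ` (Y1 \<inter> V)) \<le> valn p ((#>) W ` (Y \<inter> V))"
  proof (rule group.valn_mono[OF group_base_quotient[OF W(1)]])
    show "subgroup ((#>) W ` (Y1 \<inter> V)) (G Mod W)" "subgroup ((#>) W ` (Y \<inter> V)) (G Mod W)"
      using image_rcos_subgroup[OF W(1) subgroups_Inter_pair[OF Y1(1) base_subgroup[OF V]]]
        image_rcos_subgroup[OF W(1) subgroups_Inter_pair[OF Y base_subgroup[OF V]]] .
    show "(#>) W ` (Y1 \<inter> V) \<subseteq> (#>) W ` (Y \<inter> V)" using Y1(2) by blast
    show "finite ((#>) W ` (Y \<inter> V))"
      by (rule finite_image_rcos[OF W(1) subset_trans[OF Int_lower1 subgroup.subset[OF Y]]])
  qed
  ultimately show ?thesis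
    using split[OF V W(3) Y] split[OF V W(3) Y1(1)] by simp
qed

text \<open>Zorn's lemma is applied downwards, to the closed subgroups \<open>Y\<close> between \<open>P\<close> and \<open>H\<close> whose index in
  \<open>H\<close> is prime to \<open>p\<close> in every quotient. By compactness the family is closed under intersections
  of chains. The preimage in \<open>Y\<close> of a Sylow \<open>p\<close>-subgroup of the image of \<open>Y\<close> in
  \<open>G/U\<close> belongs to the family again, if the Sylow subgroup contains the image of \<open>P\<close>.
  So for a minimal \<open>Y\<close> it is all of \<open>Y\<close>, and the images of \<open>Y\<close> are \<open>p\<close>-groups.\<close>

theorem sylow_exists_above:
  assumes p: "prime p" and H: "closed_subgroup G T H" and P: "subgroup P G" "P \<subseteq> H"
    and pk: "\<And>U. U \<in> \<U> \<Longrightarrow> \<exists>k. card ((#>) U ` P) = p ^ k"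
  shows "\<exists>Q. closed_subgroup G T Q \<and> P \<subseteq> Q \<and> Q \<subseteq> H \<and>
    (\<forall>U\<in>\<U>. finite_sylow p (G Mod U) ((#>) U ` H) ((#>) U ` Q))"
proof -
  define \<Y> where "\<Y> = {Y. closed_subgroup G T Y \<and> P \<subseteq> Y \<and> Y \<subseteq> H \<and>
    (\<forall>U\<in>\<U>. valn p ((#>) U ` Y) = valn p ((#>) U ` H))}"
  have sH: "subgroup H G" using H by (simp add: closed_subgroup_def)
  have HY: "H \<in> \<Y>" using H P(2) by (simp add: \<Y>_def)
  have Ysub: "Y \<subseteq> carrier G" if "Y \<in> \<Y>" for Y
    using that by (auto simp: \<Y>_def closed_subgroup_def dest: subgroup.subset)
  have chain: "\<Inter>\<C> \<in> \<Y>" if ne: "\<C> \<noteq> {}" and sub: "\<C> \<subseteq> \<Y>" and lin: "\<And>X Y. X \<in> \<C> \<Longrightarrow> Y \<in> \<C> \<Longrightarrow> X \<subseteq> Y \<or> Y \<subseteq> X" for \<C>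
  proof -
    have cl: "closed_subgroup G T (\<Inter>\<C>)"
      using ne sub by (auto simp: closed_subgroup_def \<Y>_def intro!: subgroups_Inter closedin_Inter)
    have "valn p ((#>) U ` \<Inter>\<C>) = valn p ((#>) U ` H)" if U: "U \<in> \<U>" for U
    proof -
      \<comment> \<open>The images of the members of the chain in the finite group \<open>G/U\<close> have a least element.\<close>
      obtain Y0 where Y0: "Y0 \<in> \<C>" "\<And>Y. Y \<in> \<C> \<Longrightarrow> card ((#>) U ` Y0) \<le> card ((#>) U ` Y)"
        using ne ex_has_least_nat[of "\<lambda>Y. Y \<in> \<C>" _ "\<lambda>Y. card ((#>) U ` Y)"] by auto
      have min: "(#>) U ` Y0 \<subseteq> (#>) U ` Y" if Y: "Y \<in> \<C>" for Y
      proof (cases "Y0 \<subseteq> Y")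
        case False
        then have "(#>) U ` Y \<subseteq> (#>) U ` Y0" using lin[OF Y Y0(1)] by blast
        then have "(#>) U ` Y = (#>) U ` Y0"
          using Y0 Y finite_image_rcos[OF U Ysub, of Y0] sub by (intro card_seteq) auto
        then show ?thesis by simp
      qed blast
      have "(#>) U ` Y0 \<subseteq> (#>) U ` \<Inter>\<C>"
      proof
        fix c assume c: "c \<in> (#>) U ` Y0"
        let ?D = "(\<lambda>Y. Y \<inter> {y \<in> carrier G. U #> y = c}) ` \<C>"
        have "\<Inter>?D \<noteq> {}"
        proof (rule compact_space_directed_Inter_nonempty[OF compact])
          show "?D \<noteq> {}" using ne by simp
          show "closedin T D" if D: "D \<in> ?D" for D
          proof -
            obtain Y where Y: "Y \<in> \<C>" "D = Y \<inter> {y \<in> carrier G. U #> y = c}" using D by blast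
            have "closedin T Y" using Y(1) sub by (auto simp: \<Y>_def closed_subgroup_def)
            then show ?thesis
              using clopen_preimage_rcos(2)[OF base_subgroup[OF U] base_open[OF U], of "\<lambda>d. d = c"] Y(2)
              by (simp add: closedin_Int)
          qed
          show "D \<noteq> {}" if D: "D \<in> ?D" for D
          proof -
            obtain Y where Y: "Y \<in> \<C>" "D = Y \<inter> {y \<in> carrier G. U #> y = c}" using D by blast
            obtain y where y: "y \<in> Y" "c = U #> y" using c min[OF Y(1)] by blast
            then have "y \<in> D" using Y Ysub[of Y] sub by auto
            then show ?thesis by blast
          qed
          show "\<exists>E\<in>?D. E \<subseteq> D \<inter> D'" if DD: "D \<in> ?D" "D' \<in> ?D" for D D'
          proof -
            obtain Y Y' where Y: "Y \<in> \<C>" "D = Y \<inter> {y \<in> carrier G. U #> y = c}"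
              and Y': "Y' \<in> \<C>" "D' = Y' \<inter> {y \<in> carrier G. U #> y = c}" using DD by blast
            have "D \<subseteq> D \<inter> D' \<or> D' \<subseteq> D \<inter> D'" using lin[OF Y(1) Y'(1)] Y(2) Y'(2) by auto
            then show ?thesis using DD by (elim disjE) (rule bexI, assumption+)+
          qed
        qed
        then obtain y where "y \<in> \<Inter>?D" by (metis ex_in_conv)
        then have y: "y \<in> Y \<and> U #> y = c" if "Y \<in> \<C>" for Y using that by blast
        then have "y \<in> \<Inter>\<C>" "U #> y = c" using Y0(1) by blast+
        then show "c \<in> (#>) U ` \<Inter>\<C>" by blast
      qed
      moreover have "(#>) U ` \<Inter>\<C> \<subseteq> (#>) U ` Y0" using Y0(1) by blast
      ultimately have "(#>) U ` \<Inter>\<C> = (#>) U ` Y0" by (rule equalityI[rotated])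
      then show ?thesis using Y0(1) sub U by (auto simp: \<Y>_def)
    qed
    moreover have "P \<subseteq> \<Inter>\<C>" "\<Inter>\<C> \<subseteq> H" using ne sub by (auto simp: \<Y>_def)
    ultimately show ?thesis using cl by (simp add: \<Y>_def)
  qed
  \<comment> \<open>Complements turn the search for a minimal element into one for a maximal element.\<close>
  have "\<exists>M\<in>uminus ` \<Y>. \<forall>X\<in>uminus ` \<Y>. M \<subseteq> X \<longrightarrow> X = M"
  proof (rule subset_Zorn_nonempty)
    show "uminus ` \<Y> \<noteq> {}" using HY by blast
    fix \<C> assume C: "\<C> \<noteq> {}" "subset.chain (uminus ` \<Y>) \<C>"
    have "\<Inter>(uminus ` \<C>) \<in> \<Y>"
    proof (rule chain)
      show "uminus ` \<C> \<noteq> {}" using C(1) by simp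
      have C': "\<C> \<subseteq> uminus ` \<Y>" "\<And>X Y. X \<in> \<C> \<Longrightarrow> Y \<in> \<C> \<Longrightarrow> X \<subseteq> Y \<or> Y \<subseteq> X"
        using C(2) unfolding subset_chain_def by blast+
      show "uminus ` \<C> \<subseteq> \<Y>"
      proof
        fix X assume "X \<in> uminus ` \<C>"
        then have "- X \<in> \<C>" by auto
        then obtain Z where "Z \<in> \<Y>" "- X = - Z" using C'(1) by blast
        then show "X \<in> \<Y>" by simp
      qed
      fix X Y assume "X \<in> uminus ` \<C>" "Y \<in> uminus ` \<C>"
      then have "- X \<in> \<C>" "- Y \<in> \<C>" by auto
      from C'(2)[OF this] show "X \<subseteq> Y \<or> Y \<subseteq> X" by auto
    qed
    moreover have "\<Union>\<C> = - \<Inter>(uminus ` \<C>)" by auto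
    ultimately show "\<Union>\<C> \<in> uminus ` \<Y>" by blast
  qed
  then obtain Y where Y: "Y \<in> \<Y>" and minY: "\<And>X. X \<in> \<Y> \<Longrightarrow> X \<subseteq> Y \<Longrightarrow> X = Y" by auto
  have cY: "closed_subgroup G T Y" and PY: "P \<subseteq> Y" and YH: "Y \<subseteq> H"
    and valY: "\<And>U. U \<in> \<U> \<Longrightarrow> valn p ((#>) U ` Y) = valn p ((#>) U ` H)"
    using Y by (simp_all add: \<Y>_def)
  have sY: "subgroup Y G" using cY by (simp add: closed_subgroup_def)
  have "finite_sylow p (G Mod U) ((#>) U ` H) ((#>) U ` Y)" if U: "U \<in> \<U>" for U
  proof -
    interpret Q: group "G Mod U" by (rule group_base_quotient[OF U])
    obtain k where k: "card ((#>) U ` P) = p ^ k" using pk[OF U] by blast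
    have "(#>) U ` P \<subseteq> (#>) U ` Y" using PY by (rule image_mono)
    then obtain Z where Z: "finite_sylow p (G Mod U) ((#>) U ` Y) Z" "(#>) U ` P \<subseteq> Z"
      using Q.finite_sylow_exists_above[OF finite_base_quotient[OF U] p image_rcos_subgroup[OF U sY]
          image_rcos_subgroup[OF U P(1)] _ k] by blast
    then have sZ: "subgroup Z (G Mod U)" and ZY: "Z \<subseteq> (#>) U ` Y" and valZ: "valn p Z = valn p ((#>) U ` Y)"
      by (simp_all add: finite_sylow_def)
    define Y1 where "Y1 = Y \<inter> {y \<in> carrier G. U #> y \<in> Z}"
    have cY1: "closed_subgroup G T Y1" unfolding Y1_def by (rule closed_subgroup_preimage[OF U cY sZ])
    then have sY1: "subgroup Y1 G" by (simp add: closed_subgroup_def)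
    have Y1Y: "Y1 \<subseteq> Y" by (auto simp: Y1_def)
    have img: "(#>) U ` Y1 = Z"
      using ZY subgroup.subset[OF sY] by (auto simp: Y1_def)
    have YU: "Y \<inter> U \<subseteq> Y1"
    proof
      fix y assume y: "y \<in> Y \<inter> U"
      then have yG: "y \<in> carrier G" using subgroup.mem_carrier[OF sY] by blast
      have "U #> y = U" using coset_join2[OF yG base_subgroup[OF U]] y by blast
      then show "y \<in> Y1" using y yG subgroup.one_closed[OF sZ] by (simp add: Y1_def)
    qed
    have "Y1 \<in> \<Y>"
    proof -
      have "valn p ((#>) V ` Y1) = valn p ((#>) V ` H)" if V: "V \<in> \<U>" for V
      proof (rule antisym)
        have "valn p ((#>) V ` Y) \<le> valn p ((#>) V ` Y1)"
          by (rule valn_image_transfer[OF p U V sY sY1 Y1Y YU]) (simp add: img valZ)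
        then show "valn p ((#>) V ` H) \<le> valn p ((#>) V ` Y1)" using valY[OF V] by simp
        show "valn p ((#>) V ` Y1) \<le> valn p ((#>) V ` H)"
        proof (rule group.valn_mono[OF group_base_quotient[OF V] image_rcos_subgroup[OF V sY1] image_rcos_subgroup[OF V sH]])
          show "(#>) V ` Y1 \<subseteq> (#>) V ` H" using Y1Y YH by blast
          show "finite ((#>) V ` H)" by (rule finite_image_rcos[OF V subgroup.subset[OF sH]])
        qed
      qed
      moreover have "P \<subseteq> Y1" using PY Z(2) subgroup.subset[OF P(1)] by (auto simp: Y1_def)
      ultimately show ?thesis using cY1 Y1Y YH by (auto simp: \<Y>_def)
    qed
    then have "Y1 = Y" using Y1Y by (rule minY)
    then have "Z = (#>) U ` Y" using img by simp
    then show ?thesis using Z(1) valY[OF U] YH by (auto simp: finite_sylow_def)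
  qed
  then show ?thesis using cY PY YH by blast
qed

text \<open>Maximality among pro-\<open>p\<close> subgroups is a condition on the whole group; this criterion reduces it to
  the finite quotients, and so makes local conjugacy pass to them. From left to right, a maximal
  pro-\<open>p\<close> subgroup equals any subgroup found above it by \<open>sylow_exists_above\<close>.\<close>

theorem sylow_subgroup_iff:
  assumes p: "prime p" and H: "closed_subgroup G T H"
  shows "sylow_subgroup p (G\<lparr>carrier := H\<rparr>) (subtopology T H) P \<longleftrightarrow>
    closed_subgroup G T P \<and> P \<subseteq> H \<and> (\<forall>U\<in>\<U>. finite_sylow p (G Mod U) ((#>) U ` H) ((#>) U ` P))"
    (is "?L \<longleftrightarrow> ?R")
proof
  assume L: ?L
  then have P: "pro_p_subgroup p G T P" "P \<subseteq> H"
    and max: "\<And>Q. pro_p_subgroup p G T Q \<Longrightarrow> Q \<subseteq> H \<Longrightarrow> P \<subseteq> Q \<Longrightarrow> Q = P"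
    by (simp_all add: sylow_subgroup_def pro_p_subgroup_of_subgroup[OF H])
  have sP: "subgroup P G" using P(1) by (simp add: pro_p_subgroup_def closed_subgroup_def)
  obtain Q where Q: "closed_subgroup G T Q" "P \<subseteq> Q" "Q \<subseteq> H"
    "\<And>U. U \<in> \<U> \<Longrightarrow> finite_sylow p (G Mod U) ((#>) U ` H) ((#>) U ` Q)"
    using sylow_exists_above[OF p H sP P(2) pro_p_subgroup_image[OF P(1) p]] by blast
  have "pro_p_subgroup p G T Q"
    using Q(4) by (intro pro_p_subgroupI[OF Q(1)]) (simp add: finite_sylow_def)
  then have "Q = P" using Q(2,3) by (intro max)
  then show ?R using Q by simp
next
  assume R: ?R
  then have cP: "closed_subgroup G T P" and PH: "P \<subseteq> H"
    and syl: "\<And>U. U \<in> \<U> \<Longrightarrow> finite_sylow p (G Mod U) ((#>) U ` H) ((#>) U ` P)" by simp_all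
  have "pro_p_subgroup p G T P"
    using syl by (intro pro_p_subgroupI[OF cP]) (simp add: finite_sylow_def)
  moreover have "Q = P" if Q: "pro_p_subgroup p G T Q" "Q \<subseteq> H" "P \<subseteq> Q" for Q
  proof (rule closed_eq_if_all_images_eq)
    have sQ: "subgroup Q G" using Q(1) by (simp add: pro_p_subgroup_def closed_subgroup_def)
    have sH: "subgroup H G" using H by (simp add: closed_subgroup_def)
    show "closedin T Q" "closedin T P" using Q(1) cP by (simp_all add: pro_p_subgroup_def closed_subgroup_def)
    fix U assume U: "U \<in> \<U>"
    interpret G': group "G Mod U" by (rule group_base_quotient[OF U])
    obtain k where k: "card ((#>) U ` Q) = p ^ k" using pro_p_subgroup_image[OF Q(1) p U] by blast
    have fin: "finite ((#>) U ` Q)" "finite ((#>) U ` H)"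
      using finite_image_rcos[OF U subgroup.subset[OF sQ]] finite_image_rcos[OF U subgroup.subset[OF sH]] .
    have "(#>) U ` P = (#>) U ` Q"
    proof (rule G'.subgroup_eq_by_valn[OF _ image_rcos_subgroup[OF U sQ] image_mono[OF Q(3)] fin(1)])
      show "subgroup ((#>) U ` P) (G Mod U)" using syl[OF U] by (simp add: finite_sylow_def)
      fix q :: nat assume q: "prime q"
      show "valn q ((#>) U ` Q) \<le> valn q ((#>) U ` P)"
      proof (cases "q = p")
        case True
        have "valn p ((#>) U ` Q) \<le> valn p ((#>) U ` H)"
          by (rule G'.valn_mono[OF image_rcos_subgroup[OF U sQ] image_rcos_subgroup[OF U sH] image_mono[OF Q(2)] fin(2)])
        then show ?thesis using True syl[OF U] by (simp add: finite_sylow_def)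
      next
        case False
        then show ?thesis using valn_prime_power[OF p q False k] by simp
      qed
    qed
    then show "(#>) U ` Q = (#>) U ` P" by simp
  qed
  ultimately show ?L
    using PH by (simp add: sylow_subgroup_def pro_p_subgroup_of_subgroup[OF H])
qed

end

section \<open>Local conjugacy and conjugacy in profinite groups\<close>

lemma (in group_hom) group_hom_between_subgroups:
  assumes "subgroup M G" "subgroup L H" "h ` M \<subseteq> L"
  shows "group_hom (G\<lparr>carrier := M\<rparr>) (H\<lparr>carrier := L\<rparr>) h"
proof (intro group_hom.intro group_hom_axioms.intro homI)
  show "group (G\<lparr>carrier := M\<rparr>)" "group (H\<lparr>carrier := L\<rparr>)"
    using G.subgroup_imp_group[OF assms(1)] H.subgroup_imp_group[OF assms(2)] .
  show "h x \<in> carrier (H\<lparr>carrier := L\<rparr>)" if "x \<in> carrier (G\<lparr>carrier := M\<rparr>)" for x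
    using that assms(3) by auto
  show "h (x \<otimes>\<^bsub>G\<lparr>carrier := M\<rparr>\<^esub> y) = h x \<otimes>\<^bsub>H\<lparr>carrier := L\<rparr>\<^esub> h y"
    if "x \<in> carrier (G\<lparr>carrier := M\<rparr>)" "y \<in> carrier (G\<lparr>carrier := M\<rparr>)" for x y
    using that subgroup.mem_carrier[OF assms(1)] by simp
qed

lemma (in group_hom) lower_central_subset_kernel:
  assumes "lower_central H n = {\<one>\<^bsub>H\<^esub>}"
  shows "lower_central G n \<subseteq> kernel G H h"
  using image_lower_central_subset[of n] G.lower_central_subset[of n] assms by (auto simp: kernel_def)

lemma (in normal) lower_central_quotient_trivial:
  assumes M: "subgroup M G" and L: "lower_central (G\<lparr>carrier := M\<rparr>) n \<subseteq> H"
  shows "lower_central ((G Mod H)\<lparr>carrier := (#>) H ` M\<rparr>) n = {\<one>\<^bsub>G Mod H\<^esub>}"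
proof -
  interpret q: group_hom G "G Mod H" "(#>) H" by (rule rcos_group_hom)
  have s: "subgroup ((#>) H ` M) (G Mod H)" by (rule q.subgroup_img_is_subgroup[OF M])
  interpret r: group_hom "G\<lparr>carrier := M\<rparr>" "(G Mod H)\<lparr>carrier := (#>) H ` M\<rparr>" "(#>) H"
    by (rule q.group_hom_between_subgroups[OF M s subset_refl])
  have "lower_central ((G Mod H)\<lparr>carrier := (#>) H ` M\<rparr>) n \<subseteq> (#>) H ` lower_central (G\<lparr>carrier := M\<rparr>) n"
    by (rule r.lower_central_subset_image) simp
  also have "\<dots> \<subseteq> (#>) H ` H" using L by (rule image_mono)
  also have "\<dots> \<subseteq> {\<one>\<^bsub>G Mod H\<^esub>}" using rcos_const[OF is_group] by auto
  finally have "lower_central ((G Mod H)\<lparr>carrier := (#>) H ` M\<rparr>) n \<subseteq> {\<one>\<^bsub>G Mod H\<^esub>}" .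
  moreover have "\<one>\<^bsub>G Mod H\<^esub> \<in> lower_central ((G Mod H)\<lparr>carrier := (#>) H ` M\<rparr>) n"
    using subgroup.one_closed[OF normal_imp_subgroup[OF r.H.lower_central_normal[of n]]] by simp
  ultimately show ?thesis by blast
qed

context profinite_base
begin

lemma pronilpotent_lower_central:
  assumes N: "subgroup N G" and nil: "pronilpotent (G\<lparr>carrier := N\<rparr>) (subtopology T N)" and U: "U \<in> \<U>"
  shows "\<exists>n. lower_central (G\<lparr>carrier := N\<rparr>) n \<subseteq> U"
proof -
  let ?N = "G\<lparr>carrier := N\<rparr>"
  have "openin (subtopology T N) (U \<inter> N)" using base_open[OF U] by (auto simp: openin_subtopology)
  moreover have "\<one>\<^bsub>?N\<^esub> \<in> U \<inter> N"
    using subgroup.one_closed[OF N] subgroup.one_closed[OF base_subgroup[OF U]] by simp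
  ultimately have "\<exists>(K :: 'a set monoid) \<phi>. group_hom ?N K \<phi> \<and> finite (carrier K) \<and> nilpotent_group K \<and> kernel ?N K \<phi> \<subseteq> U \<inter> N"
    by (rule pro_group_hom_below_open[OF nil[unfolded pronilpotent_def]])
  then obtain K :: "'a set monoid" and \<phi> where \<phi>: "group_hom ?N K \<phi>" and K: "nilpotent_group K"
    and ker: "kernel ?N K \<phi> \<subseteq> U \<inter> N"
    by (elim exE conjE) (rule that)
  obtain n where "lower_central K n = {\<one>\<^bsub>K\<^esub>}" using K by (auto simp: nilpotent_group_def)
  from group_hom.lower_central_subset_kernel[OF \<phi> this] show ?thesis
    using ker by (intro exI[of _ n]) blast
qed

text \<open>The image of \<open>U\<close> in \<open>G/N\<close> is open, so it contains the kernel of a homomorphism to a nilpotent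
  group; hence a term of the lower central series of \<open>G\<close> lies in \<open>NU\<close>.\<close>

lemma lower_central_quotient_in_image:
  assumes N: "N \<lhd> G" and nil: "pronilpotent (G Mod N) (coset_topology G T N)" and U: "U \<in> \<U>"
  shows "\<exists>n. lower_central (G Mod U) n \<subseteq> (#>) U ` N"
proof -
  interpret N: normal N G by fact
  interpret U: normal U G by (rule base_normal[OF U])
  let ?W = "(#>) N ` U"
  have "N #> x \<in> ?W \<longleftrightarrow> U #> x \<in> (#>) U ` N" if x: "x \<in> carrier G" for x
  proof
    assume "N #> x \<in> ?W"
    then obtain u where "u \<in> U" "N #> x = N #> u" by blast
    then show "U #> x \<in> (#>) U ` N" using rcos_swap[OF N base_normal[OF U] x] by blast
  next
    assume "U #> x \<in> (#>) U ` N"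
    then obtain y where "y \<in> N" "U #> x = U #> y" by blast
    then show "N #> x \<in> ?W" using rcos_swap[OF base_normal[OF U] N x] by blast
  qed
  then have "{x \<in> topspace T. N #> x \<in> ?W} = {x \<in> carrier G. U #> x \<in> (#>) U ` N}"
    using topspace_eq by auto
  then have "openin T {x \<in> topspace T. N #> x \<in> ?W}"
    using clopen_preimage_rcos(1)[OF base_subgroup[OF U] base_open[OF U], of "\<lambda>c. c \<in> (#>) U ` N"] by simp
  moreover have "?W \<subseteq> carrier (G Mod N)" using U.subset by (auto simp: carrier_FactGroup)
  ultimately have "openin (coset_topology G T N) ?W" by (simp add: openin_coset_topology)
  moreover have "\<one>\<^bsub>G Mod N\<^esub> \<in> ?W"
    using imageI[OF U.one_closed, of "(#>) N"] coset_mult_one[OF N.subset] by simp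
  ultimately have "\<exists>(K :: 'a set set monoid) \<phi>. group_hom (G Mod N) K \<phi> \<and> finite (carrier K) \<and> nilpotent_group K \<and> kernel (G Mod N) K \<phi> \<subseteq> ?W"
    by (rule pro_group_hom_below_open[OF nil[unfolded pronilpotent_def]])
  then obtain K :: "'a set set monoid" and \<phi> where \<phi>: "group_hom (G Mod N) K \<phi>" and K: "nilpotent_group K"
    and ker: "kernel (G Mod N) K \<phi> \<subseteq> ?W"
    by (elim exE conjE) (rule that)
  obtain n where n: "lower_central K n = {\<one>\<^bsub>K\<^esub>}" using K by (auto simp: nilpotent_group_def)
  have "lower_central (G Mod N) n \<subseteq> ?W" using group_hom.lower_central_subset_kernel[OF \<phi> n] ker by blast
  then have LW: "(#>) N ` lower_central G n \<subseteq> ?W"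
    using group_hom.image_lower_central_subset[OF N.rcos_group_hom, of n] by blast
  have "lower_central (G Mod U) n \<subseteq> (#>) U ` lower_central G n"
    by (rule group_hom.lower_central_subset_image[OF U.rcos_group_hom]) (simp add: carrier_FactGroup)
  moreover have "(#>) U ` lower_central G n \<subseteq> (#>) U ` N"
  proof clarify
    fix x assume x: "x \<in> lower_central G n"
    then have xG: "x \<in> carrier G" using lower_central_subset[of n] by blast
    obtain u where "u \<in> U" "N #> x = N #> u" using LW x by blast
    then show "U #> x \<in> (#>) U ` N" using rcos_swap[OF N base_normal[OF U] xG] by blast
  qed
  ultimately show ?thesis by blast
qed

lemma conjugate_imp_locally_conjugate:
  assumes H: "closed_subgroup G T H" and H': "closed_subgroup G T H'" and conj: "conjugate G H H'"
  shows "locally_conjugate G T H H'"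
  unfolding locally_conjugate_def
proof (intro allI impI)
  fix p :: nat assume p: "prime p"
  obtain g where g: "g \<in> carrier G" "H' = conj_set G g H" using conj by (auto simp: conjugate_iff)
  have sH: "subgroup H G" using H by (simp add: closed_subgroup_def)
  have "\<exists>k. card ((#>) U ` {\<one>}) = p ^ k" if "U \<in> \<U>" for U by (intro exI[of _ 0]) simp
  then obtain P where P: "closed_subgroup G T P" "P \<subseteq> H"
    "\<And>U. U \<in> \<U> \<Longrightarrow> finite_sylow p (G Mod U) ((#>) U ` H) ((#>) U ` P)"
    using sylow_exists_above[OF p H triv_subgroup, of] subgroup.one_closed[OF sH] by auto
  have sP: "subgroup P G" and cP: "closedin T P" using P(1) by (simp_all add: closed_subgroup_def)
  define P' where "P' = conj_set G g P"
  have "closed_subgroup G T P'"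
    using conj_set_subgroup[OF sP g(1)] closedin_conj_set[OF cP g(1)] by (simp add: P'_def closed_subgroup_def)
  moreover have "P' \<subseteq> H'" unfolding P'_def g(2) by (rule conj_set_mono[OF P(2)])
  moreover have "finite_sylow p (G Mod U) ((#>) U ` H') ((#>) U ` P')" if U: "U \<in> \<U>" for U
  proof -
    interpret U: normal U G by (rule base_normal[OF U])
    interpret q: group_hom G "G Mod U" "(#>) U" by (rule U.rcos_group_hom)
    have c: "card (conj_set (G Mod U) (U #> g) ((#>) U ` X)) = card ((#>) U ` X)" if "subgroup X G" for X
      by (rule q.H.card_conj_set[OF subgroup.subset[OF q.subgroup_img_is_subgroup[OF that]] q.hom_closed[OF g(1)]])
    have e: "(#>) U ` H' = conj_set (G Mod U) (U #> g) ((#>) U ` H)" "(#>) U ` P' = conj_set (G Mod U) (U #> g) ((#>) U ` P)"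
      unfolding P'_def g(2) using q.image_conj_set[OF subgroup.subset g(1)] sH sP by blast+
    show ?thesis
      using P(3)[OF U] q.H.conj_set_subgroup[OF q.subgroup_img_is_subgroup[OF sP] q.hom_closed[OF g(1)]]
        conj_set_mono[of "(#>) U ` P" "(#>) U ` H" "G Mod U" "U #> g"]
      by (simp add: finite_sylow_def e c[OF sH] c[OF sP])
  qed
  ultimately have "sylow_subgroup p (G\<lparr>carrier := H'\<rparr>) (subtopology T H') P'"
    using sylow_subgroup_iff[OF p H'] by blast
  moreover have "sylow_subgroup p (G\<lparr>carrier := H\<rparr>) (subtopology T H) P"
    using sylow_subgroup_iff[OF p H] P by blast
  moreover have "conjugate G P P'" using g(1) by (auto simp: conjugate_iff P'_def)
  ultimately show "\<exists>P P'. sylow_subgroup p (G\<lparr>carrier := H\<rparr>) (subtopology T H) P \<and>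
      sylow_subgroup p (G\<lparr>carrier := H'\<rparr>) (subtopology T H') P' \<and> conjugate G P P'" by blast
qed

text \<open>The common form of both alternatives of the theorem: in every quotient, \<open>F\<close> becomes a nilpotent
  normal subgroup with nilpotent quotient.\<close>

lemma locally_conjugate_imp_conjugate:
  assumes N: "N \<lhd> G" "\<And>U. U \<in> \<U> \<Longrightarrow> \<exists>m. lower_central (G\<lparr>carrier := N\<rparr>) m \<subseteq> U"
    and F: "F \<lhd> G" "\<And>U. U \<in> \<U> \<Longrightarrow> \<exists>l. lower_central (G\<lparr>carrier := F\<rparr>) l \<subseteq> U"
      "\<And>U. U \<in> \<U> \<Longrightarrow> \<exists>n. lower_central (G Mod U) n \<subseteq> (#>) U ` F"
    and H: "closed_supplement G T N H" and H': "closed_supplement G T N H'"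
    and loc: "locally_conjugate G T H H'"
  shows "conjugate G H H'"
proof -
  have cH: "closed_subgroup G T H" "N <#> H = carrier G" and cH': "closed_subgroup G T H'" "N <#> H' = carrier G"
    using H H' by (simp_all add: closed_supplement_def)
  have sH: "subgroup H G" "closedin T H" and sH': "subgroup H' G" "closedin T H'"
    using cH(1) cH'(1) by (simp_all add: closed_subgroup_def)
  show ?thesis
  proof (rule conjugate_if_all_images_conjugate[OF sH(2) sH'(2)])
    fix U assume U: "U \<in> \<U>"
    interpret U: normal U G by (rule base_normal[OF U])
    interpret q: group_hom G "G Mod U" "(#>) U" by (rule U.rcos_group_hom)
    obtain m l n where m: "lower_central (G\<lparr>carrier := N\<rparr>) m \<subseteq> U"
      and l: "lower_central (G\<lparr>carrier := F\<rparr>) l \<subseteq> U" and n: "lower_central (G Mod U) n \<subseteq> (#>) U ` F"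
      using N(2)[OF U] F(2)[OF U] F(3)[OF U] by blast
    have supp: "(#>) U ` N <#>\<^bsub>G Mod U\<^esub> (#>) U ` X = carrier (G Mod U)" if X: "subgroup X G" "N <#> X = carrier G" for X
      using U.image_rcos_set_mult[OF normal_subset[OF N(1)] subgroup.subset[OF X(1)]] X(2)
      by (simp add: carrier_FactGroup)
    show "conjugate (G Mod U) ((#>) U ` H) ((#>) U ` H')"
    proof (rule q.H.finite_supplements_conjugate)
      show "finite (carrier (G Mod U))" by (rule finite_base_quotient[OF U])
      show "(#>) U ` N \<lhd> G Mod U" "(#>) U ` F \<lhd> G Mod U"
        using U.image_rcos_normal[OF N(1)] U.image_rcos_normal[OF F(1)] .
      show "lower_central ((G Mod U)\<lparr>carrier := (#>) U ` N\<rparr>) m = {\<one>\<^bsub>G Mod U\<^esub>}"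
        by (rule U.lower_central_quotient_trivial[OF normal_imp_subgroup[OF N(1)] m])
      show "lower_central ((G Mod U)\<lparr>carrier := (#>) U ` F\<rparr>) l = {\<one>\<^bsub>G Mod U\<^esub>}"
        by (rule U.lower_central_quotient_trivial[OF normal_imp_subgroup[OF F(1)] l])
      show "lower_central (G Mod U) n \<subseteq> (#>) U ` F" by (rule n)
      show "subgroup ((#>) U ` H) (G Mod U)" "subgroup ((#>) U ` H') (G Mod U)"
        using image_rcos_subgroup[OF U sH(1)] image_rcos_subgroup[OF U sH'(1)] .
      show "(#>) U ` N <#>\<^bsub>G Mod U\<^esub> (#>) U ` H = carrier (G Mod U)"
        "(#>) U ` N <#>\<^bsub>G Mod U\<^esub> (#>) U ` H' = carrier (G Mod U)"
        using supp[OF sH(1) cH(2)] supp[OF sH'(1) cH'(2)] .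
      fix p :: nat assume p: "prime p"
      obtain P P' where P: "sylow_subgroup p (G\<lparr>carrier := H\<rparr>) (subtopology T H) P"
        "sylow_subgroup p (G\<lparr>carrier := H'\<rparr>) (subtopology T H') P'" "conjugate G P P'"
        using loc p by (auto simp: locally_conjugate_def)
      have syl: "finite_sylow p (G Mod U) ((#>) U ` H) ((#>) U ` P)" "finite_sylow p (G Mod U) ((#>) U ` H') ((#>) U ` P')"
        and sP: "subgroup P G"
        using P(1,2) U by (auto simp: sylow_subgroup_iff[OF p cH(1)] sylow_subgroup_iff[OF p cH'(1)] closed_subgroup_def)
      obtain g where g: "g \<in> carrier G" "P' = conj_set G g P" using P(3) by (auto simp: conjugate_iff)
      have "(#>) U ` P' = conj_set (G Mod U) (U #> g) ((#>) U ` P)"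
        unfolding g(2) by (rule q.image_conj_set[OF subgroup.subset[OF sP] g(1)])
      then have "conjugate (G Mod U) ((#>) U ` P) ((#>) U ` P')"
        using q.hom_closed[OF g(1)] by (auto simp: conjugate_iff)
      then show "\<exists>P Q. finite_sylow p (G Mod U) ((#>) U ` H) P \<and> finite_sylow p (G Mod U) ((#>) U ` H') Q \<and>
          conjugate (G Mod U) P Q" using syl by blast
    qed
  qed
qed

end

theorem theorem1p1:
  fixes G :: "('a, 'b) monoid_scheme" and T :: "'a topology" and N H H' :: "'a set"
  assumes "profinite G T"
    and "N \<lhd> G" and "closedin T N"
    and "pronilpotent (G\<lparr>carrier := N\<rparr>) (subtopology T N)"
    and "prosupersolvable G T \<or> pronilpotent (G Mod N) (coset_topology G T N)"
    and "closed_supplement G T N H" and "closed_supplement G T N H'"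
  shows "conjugate G H H' \<longleftrightarrow> locally_conjugate G T H H'"
proof -
  have cl: "closed_subgroup G T H" "closed_subgroup G T H'"
    using assms(6,7) by (simp_all add: closed_supplement_def)
  have sN: "subgroup N G" using assms(2) by (rule normal_imp_subgroup)
  have fwd: "locally_conjugate G T H H'" if "profinite_base G T \<U>" "conjugate G H H'" for \<U>
    by (rule profinite_base.conjugate_imp_locally_conjugate[OF that(1) cl that(2)])
  from assms(5) show ?thesis
  proof
    assume "pronilpotent (G Mod N) (coset_topology G T N)"
    moreover obtain \<U> where base: "profinite_base G T \<U>"
      using pro_group_imp_base[OF assms(1)[unfolded profinite_def]] by blast
    interpret profinite_base G T \<U> by (rule base)
    have "conjugate G H H'" if "locally_conjugate G T H H'"
      using pronilpotent_lower_central[OF sN assms(4)] lower_central_quotient_in_image[OF assms(2) calculation]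
      by (intro locally_conjugate_imp_conjugate[OF assms(2) _ assms(2) _ _ assms(6,7) that])
    then show ?thesis using fwd[OF base] by blast
  next
    assume "prosupersolvable G T"
    then obtain \<U> where base: "profinite_base G T \<U>" and
      K: "\<And>U. U \<in> \<U> \<Longrightarrow> \<exists>(K :: 'a set monoid) \<phi>. group_hom G K \<phi> \<and> finite (carrier K) \<and> supersolvable_group K \<and> kernel G K \<phi> = U"
      using pro_group_imp_base[of supersolvable_group G T] by (auto simp: prosupersolvable_def)
    interpret profinite_base G T \<U> by (rule base)
    \<comment> \<open>The commutator subgroup: its images are nilpotent because \<open>G/U\<close> embeds into a supersolvable group.\<close>
    define F where "F = lower_central G 1"
    have F: "F \<lhd> G" unfolding F_def by (rule lower_central_normal)
    have F1: "\<exists>l. lower_central (G\<lparr>carrier := F\<rparr>) l \<subseteq> U" if U: "U \<in> \<U>" for U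
    proof -
      obtain K :: "'a set monoid" and \<phi> where \<phi>: "group_hom G K \<phi>" and K: "supersolvable_group K"
        and ker: "kernel G K \<phi> = U" using K[OF U] by (elim exE conjE) (rule that)
      interpret \<phi>: group_hom G K \<phi> by fact
      define E where "E = lower_central K 1"
      have E: "subgroup E K" unfolding E_def by (rule normal_imp_subgroup[OF \<phi>.H.lower_central_normal])
      obtain l where l: "lower_central (K\<lparr>carrier := E\<rparr>) l = {\<one>\<^bsub>K\<^esub>}"
        using \<phi>.H.supersolvable_commutator_nilpotent[OF K] by (auto simp only: E_def)
      have "\<phi> ` F \<subseteq> E" unfolding E_def F_def by (rule \<phi>.image_lower_central_subset)
      from \<phi>.group_hom_between_subgroups[OF normal_imp_subgroup[OF F] E this]
      have "lower_central (G\<lparr>carrier := F\<rparr>) l \<subseteq> kernel (G\<lparr>carrier := F\<rparr>) (K\<lparr>carrier := E\<rparr>) \<phi>"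
        by (rule group_hom.lower_central_subset_kernel) (simp add: l)
      also have "\<dots> \<subseteq> kernel G K \<phi>" using normal_subset[OF F] by (auto simp: kernel_def)
      finally show ?thesis using ker by auto
    qed
    have F2: "\<exists>n. lower_central (G Mod U) n \<subseteq> (\<lambda>x. U #>\<^bsub>G\<^esub> x) ` F" if U: "U \<in> \<U>" for U
      unfolding F_def
      by (intro exI[of _ 1] group_hom.lower_central_subset_image[OF normal.rcos_group_hom[OF base_normal[OF U]]])
        (simp add: carrier_FactGroup)
    have "conjugate G H H'" if "locally_conjugate G T H H'"
      by (rule locally_conjugate_imp_conjugate[OF assms(2) pronilpotent_lower_central[OF sN assms(4)] F F1 F2 assms(6,7) that])
    then show ?thesis using fwd[OF base] by blast
  qed
qed

end
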